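(* Let $r$ be an odd prime, let $n\ge1$ not be a multiple of $r$, and let $a=(a_1,\dots,a_r)$ with $a_1\ge\dots\ge a_r\ge0$ integers, $\sum_ka_k=n$ and $a_k<r$ for every $k$. Assume that the multinomial coefficients $\binom{n-1}{a_1,\dots,a_k-1,\dots,a_r}$, $1\le k\le r$, do not all lie in the same residue class modulo $r$. For each integer $v\ge 0$ let $m_v=\#\{k: a_k=v\}$. Then for $1\le s\le r$, $$N_{\zeta^s}(a)=\frac{(r-1)!}{\prod_{v\ge0}m_v!}\,A_0(a),\qquad N_{-\zeta^s}(a)=\frac{(r-1)!}{\prod_{v\ge0}m_v!}\,A_1(a).$$
   Context: $G(n,r)=\mathbb{Z}_r^n\rtimes S_n$, where $\mathbb{Z}_r=\mathbb{Z}/r\mathbb{Z}$ and $S_n$ permutes coordinates; $G(0,r)$ is trivial. $P(n,r)$ is the set of $r$-tuples $\lambda=(\lambda_1,\dots,\lambda_r)$ of partitions (possibly empty) with $\sum_k|\lambda_k|=n$. Fix a primitive $r$-th root of unity $\zeta$; also write $\zeta$ for the character $\zeta(x;w)=\zeta^{x_1+\dots+x_n}$ of $G(n,r)$ and $\mathrm{sgn}(x;w)$ for the sign of $w$. For a partition $\mu$ of $m$, let $\rho_\mu$ be the corresponding irreducible complex representation of $S_m$, $\chi_\mu$ its character, $f_\mu$ its dimension, and $\rho_\mu^k(x;w)=\zeta^{k(x_1+\dots+x_m)}\rho_\mu(w)$ its extension to $G(m,r)$. For $\lambda\in P(n,r)$ with $b_k=|\lambda_k|$, the irreducible representation of $G(n,r)$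 indexed by $\lambda$ is $$\rho_\lambda=\mathrm{Ind}_{G(b_1,r)\times\dots\times G(b_r,r)}^{G(n,r)}\ \rho_{\lambda_1}^{0}\boxtimes\rho_{\lambda_2}^{1}\boxtimes\dots\boxtimes\rho_{\lambda_r}^{r-1}.$$ $N_{\zeta^s}(a)$ (resp. $N_{-\zeta^s}(a)$) is the number of $\lambda\in P(n,r)$ such that $(|\lambda_1|,\dots,|\lambda_r|)$ is a rearrangement of $a$ and the character $\det\rho_\lambda$ equals $\zeta^s$ (resp. $\zeta^s\cdot\mathrm{sgn}$); for $n=1$, where $\mathrm{sgn}$ is trivial, $N_{-\zeta^s}(a)=0$. Put $g_\mu=\frac{f_\mu-\chi_\mu(s_1)}2$ with $s_1=(1\,2)$ for $|\mu|\ge2$ and $g_\mu=0$ for $|\mu|<2$; $\widehat f_{\lambda_k}=\prod_{j\ne k}f_{\lambda_j}$; multinomial coefficients with a negative lower entry are $0$. For $n\ge2$ and $\lambda$ with $|\lambda_k|=b_k$, $$y_\lambda=f_{\lambda_1}\cdots f_{\lambda_r}\frac{(n-2)!}{b_1!\cdots b_r!}\sum_{1\le i<j\le r}b_ib_j+\sum_{k=1}^r g_{\lambda_k}\widehat f_{\lambda_k}\binom{n-2}{b_1,\dots,b_k-2,\dots,b_r},$$ and $y_\lambda=0$ for $n=1$. $A_0(a)$ (resp. $A_1(a)$) is the number of $\lambda\in P(n,r)$ with $|\lambda_k|=a_k$ for all $k$ (in this order) and $y_\lambda$ even (resp. odd). *)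

theory Defs
  imports
    "HOL-Algebra.Elementary_Groups"
    "HOL-Algebra.Product_Groups"
    "HOL-Algebra.Sym_Groups"
    "HOL-Combinatorics.Permutations"
    "HOL-Library.Function_Algebras"
    "HOL-Library.Multiset"
    "HOL-Number_Theory.Cong"
    "Jordan_Normal_Form.Determinant"
begin

section \<open>Matrix representations\<close>

text \<open>A finite-dimensional complex representation of a group is handled through the matrices
  of its elements, i.e. as a function from group elements to \<^typ>\<open>complex mat\<close>.  Determinant
  and trace do not depend on the choices (bases, coset representatives) made below.\<close>

interpretation cfun: vector_space "\<lambda>(c::complex) (f::'a \<Rightarrow> complex) x. c * f x"
  by unfold_locales (auto simp: fun_eq_iff algebra_simps)

definition some_basis :: "('a \<Rightarrow> complex) set \<Rightarrow> ('a \<Rightarrow> complex) list" where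
  "some_basis V = (SOME bs. distinct bs \<and> cfun.independent (set bs) \<and> cfun.span (set bs) = V)"

text \<open>Only meant for a finite-dimensional subspace \<open>V\<close> that is invariant under the linear
  map \<open>T\<close>: column \<open>j\<close> holds the coordinates of the image of the \<open>j\<close>-th basis vector.\<close>

definition matrix_on ::
    "('a \<Rightarrow> complex) set \<Rightarrow> (('a \<Rightarrow> complex) \<Rightarrow> ('a \<Rightarrow> complex)) \<Rightarrow> complex mat" where
  "matrix_on V T = (let bs = some_basis V in
     mat (length bs) (length bs)
       (\<lambda>(i, j). cfun.representation (set bs) (T (bs ! j)) (bs ! i)))"

definition mat_trace :: "complex mat \<Rightarrow> complex" where
  "mat_trace A = (\<Sum>i<dim_row A. A $$ (i, i))"

definition kronecker :: "complex mat \<Rightarrow> complex mat \<Rightarrow> complex mat" where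
  "kronecker A B = mat (dim_row A * dim_row B) (dim_col A * dim_col B)
     (\<lambda>(i, j). A $$ (i div dim_row B, j div dim_col B) * B $$ (i mod dim_row B, j mod dim_col B))"

definition kronecker_list :: "complex mat list \<Rightarrow> complex mat" where
  "kronecker_list As = foldr kronecker As (1\<^sub>m 1)"

definition left_transversal :: "('g, 'm) monoid_scheme \<Rightarrow> 'g set \<Rightarrow> 'g list \<Rightarrow> bool" where
  "left_transversal G H ts \<longleftrightarrow> distinct ts \<and> set ts \<subseteq> carrier G \<and>
     (\<forall>g\<in>carrier G. \<exists>!t. t \<in> set ts \<and> g \<in> t <#\<^bsub>G\<^esub> H)"

text \<open>Induction of a matrix representation \<open>R\<close> of the subgroup \<open>H\<close> to \<open>G\<close>: for representatives
  \<open>t\<^sub>1, t\<^sub>2, \<dots>\<close> of the left cosets of \<open>H\<close>, the block of the matrix of \<open>g\<close> at position \<open>(p, q)\<close>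
  is \<open>R (t\<^sub>p\<inverse> g t\<^sub>q)\<close> if \<open>t\<^sub>p\<inverse> g t\<^sub>q \<in> H\<close>, and zero otherwise.\<close>

definition induced_rep ::
    "('g, 'm) monoid_scheme \<Rightarrow> 'g set \<Rightarrow> ('g \<Rightarrow> complex mat) \<Rightarrow> 'g \<Rightarrow> complex mat" where
  "induced_rep G H R g =
     (let ts = (SOME ts. left_transversal G H ts); d = dim_row (R \<one>\<^bsub>G\<^esub>) in
      mat (length ts * d) (length ts * d) (\<lambda>(i, j).
        let h = inv\<^bsub>G\<^esub> (ts ! (i div d)) \<otimes>\<^bsub>G\<^esub> g \<otimes>\<^bsub>G\<^esub> (ts ! (j div d)) in
        if h \<in> H then R h $$ (i mod d, j mod d) else 0))"


section \<open>Irreducible representations of symmetric groups\<close>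

definition is_partition :: "nat list \<Rightarrow> bool" where
  "is_partition mu \<longleftrightarrow> sorted_wrt (\<ge>) mu \<and> 0 \<notin> set mu"

text \<open>Row (from 0) and column (from 1) of the entry \<open>i \<in> {1..m}\<close> in the tableau of shape \<open>mu\<close>
  that is filled with \<open>1, \<dots>, m\<close> row by row.\<close>

definition row_of :: "nat list \<Rightarrow> nat \<Rightarrow> nat" where
  "row_of mu i = (LEAST j. i \<le> sum_list (take (Suc j) mu))"

definition col_of :: "nat list \<Rightarrow> nat \<Rightarrow> nat" where
  "col_of mu i = i - sum_list (take (row_of mu i) mu)"

definition row_group :: "nat list \<Rightarrow> (nat \<Rightarrow> nat) set" where
  "row_group mu = {p \<in> carrier (sym_group (sum_list mu)).
     \<forall>i\<in>{1..sum_list mu}. row_of mu (p i) = row_of mu i}"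

definition col_group :: "nat list \<Rightarrow> (nat \<Rightarrow> nat) set" where
  "col_group mu = {q \<in> carrier (sym_group (sum_list mu)).
     \<forall>i\<in>{1..sum_list mu}. col_of mu (q i) = col_of mu i}"

text \<open>Elements of the group algebra of \<open>S\<^sub>m\<close> are complex functions on permutations
  vanishing outside \<open>S\<^sub>m\<close>.\<close>

definition group_algebra :: "nat \<Rightarrow> ((nat \<Rightarrow> nat) \<Rightarrow> complex) set" where
  "group_algebra m = {f. \<forall>g. g \<notin> carrier (sym_group m) \<longrightarrow> f g = 0}"

definition convolve ::
    "nat \<Rightarrow> ((nat \<Rightarrow> nat) \<Rightarrow> complex) \<Rightarrow> ((nat \<Rightarrow> nat) \<Rightarrow> complex) \<Rightarrow> (nat \<Rightarrow> nat) \<Rightarrow> complex" where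
  "convolve m f h = (\<lambda>g. if g \<in> carrier (sym_group m)
     then \<Sum>u\<in>carrier (sym_group m). f u * h (inv_into UNIV u \<circ> g) else 0)"

text \<open>The Young symmetrizer: the sum of \<open>sgn q \<cdot> pq\<close> over \<open>p\<close> in the row group and \<open>q\<close> in the
  column group.\<close>

definition young_symmetrizer :: "nat list \<Rightarrow> (nat \<Rightarrow> nat) \<Rightarrow> complex" where
  "young_symmetrizer mu =
     (\<lambda>g. \<Sum>(p, q) \<in> {(p, q). p \<in> row_group mu \<and> q \<in> col_group mu \<and> p \<circ> q = g}. of_int (sign q))"

text \<open>The irreducible module of \<open>S\<^sub>m\<close> indexed by \<open>mu\<close> is the left ideal of the group algebra
  generated by the Young symmetrizer; so \<open>[m]\<close> gives the trivial representation and
  \<open>[1, \<dots>, 1]\<close> the sign.\<close>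

definition specht_module :: "nat list \<Rightarrow> ((nat \<Rightarrow> nat) \<Rightarrow> complex) set" where
  "specht_module mu =
     (\<lambda>f. convolve (sum_list mu) f (young_symmetrizer mu)) ` group_algebra (sum_list mu)"

definition left_mult ::
    "(nat \<Rightarrow> nat) \<Rightarrow> ((nat \<Rightarrow> nat) \<Rightarrow> complex) \<Rightarrow> (nat \<Rightarrow> nat) \<Rightarrow> complex" where
  "left_mult w f = (\<lambda>g. f (inv_into UNIV w \<circ> g))"

definition specht_rep :: "nat list \<Rightarrow> (nat \<Rightarrow> nat) \<Rightarrow> complex mat" where
  "specht_rep mu w = matrix_on (specht_module mu) (left_mult w)"

definition specht_dim :: "nat list \<Rightarrow> nat" where
  "specht_dim mu = cfun.dim (specht_module mu)"

definition specht_char :: "nat list \<Rightarrow> (nat \<Rightarrow> nat) \<Rightarrow> complex" where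
  "specht_char mu w = mat_trace (specht_rep mu w)"


section \<open>The groups \<open>G(n,r)\<close> and their irreducible representations\<close>

type_synonym gelem = "(nat \<Rightarrow> int) \<times> (nat \<Rightarrow> nat)"

text \<open>A permutation \<open>w\<close> moves the \<open>i\<close>-th coordinate to position \<open>w i\<close>, so
  \<open>(x; w) (y; v) = (x + w\<cdot>y; wv)\<close> with \<open>(w\<cdot>y) i = y (w\<inverse> i)\<close>.\<close>

definition Gnr :: "nat \<Rightarrow> nat \<Rightarrow> gelem monoid" where
  "Gnr n r = (let Z = product_group {1..n} (\<lambda>_. integer_mod_group r); S = sym_group n in
     \<lparr>carrier = carrier Z \<times> carrier S,
      monoid.mult = (\<lambda>(x, w) (y, v). (x \<otimes>\<^bsub>Z\<^esub> (\<lambda>i\<in>{1..n}. y (inv_into UNIV w i)), w \<otimes>\<^bsub>S\<^esub> v)),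
      one = (\<one>\<^bsub>Z\<^esub>, \<one>\<^bsub>S\<^esub>)\<rparr>)"

definition primitive_root_unity :: "nat \<Rightarrow> complex \<Rightarrow> bool" where
  "primitive_root_unity r \<zeta> \<longleftrightarrow> r > 0 \<and> \<zeta> ^ r = 1 \<and> (\<forall>k. 0 < k \<and> k < r \<longrightarrow> \<zeta> ^ k \<noteq> 1)"

definition zeta_char :: "complex \<Rightarrow> nat \<Rightarrow> gelem \<Rightarrow> complex" where
  "zeta_char \<zeta> n = (\<lambda>(x, w). \<zeta> powi (\<Sum>i=1..n. x i))"

definition sgn_char :: "gelem \<Rightarrow> complex" where
  "sgn_char = (\<lambda>(x, w). of_int (sign w))"

definition twisted_rep :: "complex \<Rightarrow> nat list \<Rightarrow> nat \<Rightarrow> gelem \<Rightarrow> complex mat" where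
  "twisted_rep \<zeta> mu k g = (zeta_char \<zeta> (sum_list mu) g) ^ k \<cdot>\<^sub>m specht_rep mu (snd g)"

text \<open>For \<open>b = [b\<^sub>1, \<dots>, b\<^sub>r]\<close> with sum \<open>n\<close>, the set \<open>{1..n}\<close> is cut into consecutive blocks of
  sizes \<open>b\<^sub>1, \<dots>, b\<^sub>r\<close>, and \<open>G(b\<^sub>1,r) \<times> \<dots> \<times> G(b\<^sub>r,r)\<close> is identified with the subgroup of the
  \<open>(x; w)\<close> such that \<open>w\<close> preserves every block.  Lists are indexed from 0.\<close>

definition offset :: "nat list \<Rightarrow> nat \<Rightarrow> nat" where
  "offset b k = sum_list (take k b)"

definition block :: "nat list \<Rightarrow> nat \<Rightarrow> nat set" where
  "block b k = {offset b k + 1 .. offset b k + b ! k}"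

definition young_subgroup :: "nat list \<Rightarrow> nat \<Rightarrow> gelem set" where
  "young_subgroup b r =
     {(x, w) \<in> carrier (Gnr (sum_list b) r). \<forall>k<length b. w ` block b k = block b k}"

text \<open>The projection of an element of this subgroup to the factor \<open>G(b\<^sub>k,r)\<close>.\<close>

definition block_component :: "nat list \<Rightarrow> nat \<Rightarrow> gelem \<Rightarrow> gelem" where
  "block_component b k = (\<lambda>(x, w).
     (\<lambda>i\<in>{1..b ! k}. x (offset b k + i),
      \<lambda>i. if i \<in> {1..b ! k} then w (offset b k + i) - offset b k else i))"

definition Pnr :: "nat \<Rightarrow> nat \<Rightarrow> nat list list set" where
  "Pnr n r = {lam. length lam = r \<and> (\<forall>mu\<in>set lam. is_partition mu) \<and>
     sum_list (map sum_list lam) = n}"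

definition sizes :: "nat list list \<Rightarrow> nat list" where
  "sizes lam = map sum_list lam"

text \<open>With indices from 0, the entry \<open>lam ! k\<close> carries the twist by the \<open>k\<close>-th power
  of the character.\<close>

definition rho :: "complex \<Rightarrow> nat list list \<Rightarrow> gelem \<Rightarrow> complex mat" where
  "rho \<zeta> lam =
     (let b = sizes lam; r = length lam in
      induced_rep (Gnr (sum_list b) r) (young_subgroup b r)
        (\<lambda>h. kronecker_list (map (\<lambda>k. twisted_rep \<zeta> (lam ! k) k (block_component b k h)) [0..<r])))"


section \<open>The counting functions\<close>

definition N_plus :: "nat \<Rightarrow> nat \<Rightarrow> complex \<Rightarrow> nat \<Rightarrow> nat list \<Rightarrow> nat" where
  "N_plus n r \<zeta> s a = card {lam \<in> Pnr n r. mset (sizes lam) = mset a \<and>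
     (\<forall>g\<in>carrier (Gnr n r). det (rho \<zeta> lam g) = zeta_char \<zeta> n g ^ s)}"

definition N_minus :: "nat \<Rightarrow> nat \<Rightarrow> complex \<Rightarrow> nat \<Rightarrow> nat list \<Rightarrow> nat" where
  "N_minus n r \<zeta> s a = (if n = 1 then 0 else card {lam \<in> Pnr n r. mset (sizes lam) = mset a \<and>
     (\<forall>g\<in>carrier (Gnr n r). det (rho \<zeta> lam g) = zeta_char \<zeta> n g ^ s * sgn_char g)})"

text \<open>Only used for entries with sum \<open>N\<close>, where the division is exact.\<close>

definition multinomial :: "nat \<Rightarrow> int list \<Rightarrow> nat" where
  "multinomial N bs = (if \<exists>b\<in>set bs. b < 0 then 0
     else fact N div prod_list (map (\<lambda>b. fact (nat b)) bs))"

text \<open>The quantities \<open>g\<close> and \<open>y\<close> are integers, but by a theorem; they are introduced as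
  complex numbers, and parity is defined accordingly.\<close>

definition g_num :: "nat list \<Rightarrow> complex" where
  "g_num mu = (if sum_list mu \<ge> 2
     then (of_nat (specht_dim mu) - specht_char mu (Transposition.transpose 1 2)) / 2 else 0)"

definition y_num :: "nat list list \<Rightarrow> complex" where
  "y_num lam = (let b = sizes lam; r = length lam; n = sum_list b in
     if n \<ge> 2 then
       (\<Prod>k<r. of_nat (specht_dim (lam ! k)))
         * (fact (n - 2) / (\<Prod>k<r. fact (b ! k)))
         * (\<Sum>j<r. \<Sum>i<j. of_nat (b ! i * b ! j))
       + (\<Sum>k<r. g_num (lam ! k) * (\<Prod>j\<in>{..<r} - {k}. of_nat (specht_dim (lam ! j)))
            * of_nat (multinomial (n - 2) ((map int b)[k := int (b ! k) - 2])))
     else 0)"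

definition is_even :: "complex \<Rightarrow> bool" where
  "is_even z \<longleftrightarrow> (\<exists>k::int. even k \<and> z = of_int k)"

definition is_odd :: "complex \<Rightarrow> bool" where
  "is_odd z \<longleftrightarrow> (\<exists>k::int. odd k \<and> z = of_int k)"

definition A0 :: "nat \<Rightarrow> nat \<Rightarrow> nat list \<Rightarrow> nat" where
  "A0 n r a = card {lam \<in> Pnr n r. sizes lam = a \<and> is_even (y_num lam)}"

definition A1 :: "nat \<Rightarrow> nat \<Rightarrow> nat list \<Rightarrow> nat" where
  "A1 n r a = card {lam \<in> Pnr n r. sizes lam = a \<and> is_odd (y_num lam)}"

end

theory Submission
  imports Defs "Jordan_Normal_Form.Schur_Decomposition" "HOL-Combinatorics.Multiset_Permutations"
begin

text \<open>The hypotheses force \<open>n < r\<close>.  On \<open>(x; w)\<close> the determinant of \<open>\<rho>\<^sub>\<lambda>\<close> is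
  \<open>\<zeta>\<close> to the power \<open>E (x\<^sub>1 + \<dots> + x\<^sub>n)\<close> times the \<open>y\<close>-th power of the sign of \<open>w\<close>, where
  \<open>n b\<^sub>1! \<dots> b\<^sub>r! E = d n! (0 b\<^sub>1 + 1 b\<^sub>2 + \<dots> + (r-1) b\<^sub>r)\<close> and \<open>d\<close> is the product of
  the dimensions \<open>f\<close> of the components.  Every \<open>f\<close> divides the factorial of a number below \<open>r\<close>, so \<open>d\<close>,
  \<open>n!\<close> and \<open>n\<close> are prime to \<open>r\<close>; a cyclic rotation of \<open>\<lambda>\<close> changes the weighted sum by
  \<open>n\<close> modulo \<open>r\<close> and leaves \<open>y\<close> unchanged.  Hence \<open>E\<close> takes every residue modulo \<open>r\<close>
  exactly once on the rotations of \<open>\<lambda>\<close>, and the count for each \<open>s\<close> is \<open>1/r\<close> of the count over all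
  rearrangements of \<open>a\<close>.\<close>

section \<open>Matrices and finite-dimensional function spaces\<close>

text \<open>Bases and coset representatives behind \<open>rho\<close> are arbitrary choices, so only
  traces and determinants are computed. As the determinant is multiplicative and
  \<open>(x; w) = (x; 1)(0; w)\<close>, translations and transpositions suffice. A translation acts
  by a scalar on each coset block: for a representative with permutation \<open>w\<close>,
  coordinate \<open>i\<close> enters with the index of the block containing the preimage of
  \<open>i\<close> under \<open>w\<close>. Over the \<open>n! / (b_1! ... b_r!)\<close> cosets this
  index has mean \<open>(0 b_1 + 1 b_2 + ...) / n\<close>, which is the origin of the equation for
  \<open>E\<close>. A transposition acts as an involution, so its determinant is
  \<open>(-1)^K\<close> with \<open>2 K\<close> equal to dimension minus trace. Evaluating the trace
  gives \<open>K = y\<close>, which also shows that \<open>y\<close> is a natural number. That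
  \<open>f\<close> divides \<open>m!\<close> comes from the Young symmetrizer \<open>c\<close>:
  \<open>c * c = kappa c\<close> with an integer \<open>kappa\<close>, and right multiplication by
  \<open>c\<close> has trace \<open>m!\<close> on the one hand and \<open>kappa f\<close> on the
  other. All \<open>r! / prod m_v!\<close> rearrangements of \<open>a\<close> give the same number
  of even (odd) \<open>y\<close>, because \<open>y\<close> is symmetric in the components; the share
  \<open>1/r\<close> per residue leaves the factor \<open>(r-1)!\<close>.\<close>

lemma div_mod_bounds:
  assumes "i < n * (m::nat)" shows "i div m < n" "i mod m < m"
  using assms by (simp_all add: less_mult_imp_div_less) (cases "m = 0"; simp)

lemma mult_add_less_mult: "i < a \<Longrightarrow> j < b \<Longrightarrow> i * b + j < a * (b::nat)"
proof -
  assume "i < a" "j < b"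
  then have "i * b + j < Suc i * b" "Suc i * b \<le> a * b" by (simp, intro mult_le_mono1) simp
  then show ?thesis by simp
qed

text \<open>Rows of Kronecker products and of induced matrices are indexed by \<open>k div b\<close>
  (block) and \<open>k mod b\<close> (position in the block). Stated over a commutative monoid so
  that traces (\<open>sum.div_mod\<close>) and determinants (\<open>prod.div_mod\<close>) share
  it.\<close>

lemma (in comm_monoid_set) div_mod:
  fixes a b :: nat
  shows "F (\<lambda>k. h (k div b) (k mod b)) {..<a * b} = F (\<lambda>i. F (\<lambda>j. h i j) {..<b}) {..<a}"
proof -
  have "F (\<lambda>k. h (k div b) (k mod b)) {..<a * b} = F (\<lambda>(i, j). h i j) ({..<a} \<times> {..<b})"
    by (rule reindex_bij_witness[where i = "\<lambda>(i, j). i * b + j" and j = "\<lambda>k. (k div b, k mod b)"])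
      (use div_mod_bounds mult_add_less_mult in auto)
  then show ?thesis by (simp add: cartesian_product)
qed

lemma mat_mult_index:
  assumes "A \<in> carrier_mat n m" "B \<in> carrier_mat m l" "i < n" "j < l"
  shows "(A * B) $$ (i, j) = (\<Sum>k<m. A $$ (i, k) * B $$ (k, j))"
  using assms by (auto simp: scalar_prod_def atLeast0LessThan)

lemma mat_trace_mult_comm:
  assumes "A \<in> carrier_mat n m" "B \<in> carrier_mat m n"
  shows "mat_trace (A * B) = mat_trace (B * A)"
proof -
  have "mat_trace (A * B) = (\<Sum>i<n. \<Sum>k<m. A $$ (i, k) * B $$ (k, i))"
    unfolding mat_trace_def using assms by (intro sum.cong) (auto simp: mat_mult_index[OF assms] simp del: index_mult_mat(1))
  also have "\<dots> = (\<Sum>k<m. \<Sum>i<n. B $$ (k, i) * A $$ (i, k))"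
    by (subst sum.swap) (intro sum.cong refl mult.commute)
  also have "\<dots> = mat_trace (B * A)"
    unfolding mat_trace_def using assms
    by (intro sum.cong) (auto simp: mat_mult_index[OF assms(2,1)] simp del: index_mult_mat(1))
  finally show ?thesis .
qed

lemma smult_smult_mat: "a \<cdot>\<^sub>m (b \<cdot>\<^sub>m A) = (a * b :: 'a::semigroup_mult) \<cdot>\<^sub>m A"
  by (rule eq_matI) (auto simp: mult.assoc)

lemma one_smult_mat: "(1::'a::monoid_mult) \<cdot>\<^sub>m A = A"
  by (rule eq_matI) auto

lemma mat_trace_one: "mat_trace (1\<^sub>m n) = of_nat n"
  by (simp add: mat_trace_def)

text \<open>By Schur decomposition \<open>A\<close> is similar to an upper triangular
  \<open>B\<close> with \<open>B * B = 1\<close>. The diagonal of \<open>B\<close> then consists of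
  \<open>1\<close> and \<open>-1\<close>, and \<open>k\<close> counts the entries
  \<open>-1\<close>.\<close>

lemma involution_trace_det:
  fixes A :: "complex mat"
  assumes A: "A \<in> carrier_mat n n" and sq: "A * A = 1\<^sub>m n"
  obtains k where "mat_trace A = of_nat n - 2 * of_nat k" "det A = (-1) ^ k"
proof -
  obtain as where "char_poly A = (\<Prod>a\<leftarrow>as. [:- a, 1:])"
    using char_poly_factorized[OF A] by blast
  from schur_decomposition_exists[OF A this] obtain B
    where B: "B \<in> carrier_mat n n" and ut: "upper_triangular B" and "similar_mat A B"
    by blast
  then obtain P Q where w: "similar_mat_wit A B P Q"
    unfolding similar_mat_def by blast
  from similar_mat_witD2[OF A w] have PQ: "P * Q = 1\<^sub>m n" "Q * P = 1\<^sub>m n"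
    and AB: "A = P * B * Q" and P: "P \<in> carrier_mat n n" and Q: "Q \<in> carrier_mat n n"
    by auto
  have tr: "mat_trace A = mat_trace B"
  proof -
    have "mat_trace A = mat_trace (Q * (P * B))"
      unfolding AB by (rule mat_trace_mult_comm[of _ n n]) (use P Q B in auto)
    also have "Q * (P * B) = (Q * P) * B"
      using P Q B by (simp add: assoc_mult_mat[of _ n n _ n _ n])
    also have "\<dots> = B" using PQ B by simp
    finally show ?thesis .
  qed
  have dt: "det A = det B" by (rule det_similar) fact
  have "similar_mat_wit (A * A) (B * B) P Q"
  proof -
    have "A * A = P * B * (Q * (P * B)) * Q"
      unfolding AB using P Q B by (simp add: assoc_mult_mat[of _ n n _ n _ n])
    also have "Q * (P * B) = (Q * P) * B"
      using P Q B by (simp add: assoc_mult_mat[of _ n n _ n _ n])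
    also have "\<dots> = B" using PQ B by simp
    finally have "A * A = P * (B * B) * Q"
      using P Q B by (simp add: assoc_mult_mat[of _ n n _ n _ n])
    then show ?thesis using P Q B A PQ unfolding similar_mat_wit_def by (auto simp: Let_def)
  qed
  then have "B * B = Q * (A * A) * P"
    by (meson similar_mat_witD similar_mat_wit_sym)
  then have BB: "B * B = 1\<^sub>m n" using P Q PQ sq by simp
  have diag: "B $$ (i, i) = 1 \<or> B $$ (i, i) = -1" if "i < n" for i
  proof -
    have "1 = (B * B) $$ (i, i)" using BB that by simp
    also have "\<dots> = (\<Sum>k<n. B $$ (i, k) * B $$ (k, i))"
      by (rule mat_mult_index[OF B B that that])
    also have "\<dots> = (\<Sum>k<n. if k = i then B $$ (i, i) * B $$ (i, i) else 0)"
    proof (rule sum.cong[OF refl], goal_cases)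
      case (1 k)
      \<comment> \<open>One of the two factors lies strictly below the diagonal unless
        \<open>k = i\<close>, so the diagonal of \<open>B * B\<close> holds the squares of the
        diagonal of \<open>B\<close>.\<close>
      have "B $$ (i, k) = 0" if "k < i" using ut B that \<open>i < n\<close> by auto
      moreover have "B $$ (k, i) = 0" if "i < k" using ut B that 1 by auto
      ultimately show ?case by (metis linorder_neqE_nat mult_eq_0_iff)
    qed
    finally show ?thesis using that by (simp add: square_eq_1_iff)
  qed
  define K where "K = {i. i < n \<and> B $$ (i, i) = -1}"
  have K: "K \<subseteq> {..<n}" "finite K" unfolding K_def by auto
  have eq: "B $$ (i, i) = (if i \<in> K then -1 else 1)" if "i < n" for i
    using diag[OF that] that unfolding K_def by auto
  have "mat_trace B = (\<Sum>i<n. 1 - 2 * (if i \<in> K then 1 else 0))"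
    unfolding mat_trace_def using B by (intro sum.cong) (auto simp: eq)
  also have "\<dots> = of_nat n - 2 * of_nat (card K)"
    using K by (simp add: sum_subtractf sum_distrib_left[symmetric] sum.If_cases Int_absorb1)
  finally have 1: "mat_trace A = of_nat n - 2 * of_nat (card K)" using tr by simp
  have "det B = (\<Prod>i<n. B $$ (i, i))"
    using det_upper_triangular[OF ut B] B
    by (simp add: diag_mat_def prod.list_conv_set_nth atLeast0LessThan)
  also have "\<dots> = (\<Prod>i<n. if i \<in> K then -1 else 1)"
    by (intro prod.cong) (auto simp: eq)
  also have "\<dots> = (-1) ^ card K"
    using K by (simp add: prod.If_cases Int_absorb1)
  finally show thesis using that 1 dt by simp
qed

section \<open>Kronecker products: multiplicativity, traces, scalar matrices\<close>

lemma kronecker_carrier: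
  assumes "A \<in> carrier_mat n m" "B \<in> carrier_mat k l"
  shows "kronecker A B \<in> carrier_mat (n * k) (m * l)"
  using assms by (auto simp: kronecker_def)

lemma kronecker_mult:
  assumes "A \<in> carrier_mat n n" "B \<in> carrier_mat m m" "C \<in> carrier_mat n n" "D \<in> carrier_mat m m"
  shows "kronecker A B * kronecker C D = kronecker (A * C) (B * D)"
proof (rule eq_matI)
  have AB: "kronecker A B \<in> carrier_mat (n * m) (n * m)"
    and CD: "kronecker C D \<in> carrier_mat (n * m) (n * m)"
    and ACBD: "kronecker (A * C) (B * D) \<in> carrier_mat (n * m) (n * m)"
    using assms by (auto intro!: kronecker_carrier)
  show "dim_row (kronecker A B * kronecker C D) = dim_row (kronecker (A * C) (B * D))"
    "dim_col (kronecker A B * kronecker C D) = dim_col (kronecker (A * C) (B * D))"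
    using AB CD ACBD by auto
  fix i j assume "i < dim_row (kronecker (A * C) (B * D))" "j < dim_col (kronecker (A * C) (B * D))"
  then have ij: "i < n * m" "j < n * m" using ACBD by auto
  note b = div_mod_bounds[OF ij(1)] div_mod_bounds[OF ij(2)]
  have "(kronecker A B * kronecker C D) $$ (i, j)
     = (\<Sum>k<n * m. A $$ (i div m, k div m) * B $$ (i mod m, k mod m)
          * (C $$ (k div m, j div m) * D $$ (k mod m, j mod m)))"
    unfolding mat_mult_index[OF AB CD ij] using assms ij by (intro sum.cong) (auto simp: kronecker_def)
  also have "\<dots> = (\<Sum>k<n. \<Sum>l<m. A $$ (i div m, k) * B $$ (i mod m, l)
          * (C $$ (k, j div m) * D $$ (l, j mod m)))"
    by (rule sum.div_mod)
  also have "\<dots> = (\<Sum>k<n. A $$ (i div m, k) * C $$ (k, j div m)) *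
        (\<Sum>l<m. B $$ (i mod m, l) * D $$ (l, j mod m))"
    by (simp add: sum_product mult_ac)
  also have "\<dots> = (A * C) $$ (i div m, j div m) * (B * D) $$ (i mod m, j mod m)"
    using b by (simp add: mat_mult_index[OF assms(1,3)] mat_mult_index[OF assms(2,4)])
  also have "\<dots> = kronecker (A * C) (B * D) $$ (i, j)"
    using ij assms by (auto simp: kronecker_def)
  finally show "(kronecker A B * kronecker C D) $$ (i, j) = kronecker (A * C) (B * D) $$ (i, j)" .
qed

lemma mat_trace_kronecker:
  assumes "A \<in> carrier_mat n n" "B \<in> carrier_mat m m"
  shows "mat_trace (kronecker A B) = mat_trace A * mat_trace B"
proof -
  have "mat_trace (kronecker A B)
      = (\<Sum>k<n * m. A $$ (k div m, k div m) * B $$ (k mod m, k mod m))"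
    unfolding mat_trace_def using assms by (intro sum.cong) (auto simp: kronecker_def)
  also have "\<dots> = (\<Sum>k<n. \<Sum>l<m. A $$ (k, k) * B $$ (l, l))" by (rule sum.div_mod)
  also have "\<dots> = mat_trace A * mat_trace B"
    using assms by (simp add: mat_trace_def sum_product)
  finally show ?thesis .
qed

lemma kronecker_smult_one:
  "kronecker (c \<cdot>\<^sub>m 1\<^sub>m n) (e \<cdot>\<^sub>m 1\<^sub>m m) = (c * e) \<cdot>\<^sub>m 1\<^sub>m (n * m)"
proof (rule eq_matI)
  fix i j assume "i < dim_row ((c * e) \<cdot>\<^sub>m 1\<^sub>m (n * m))" "j < dim_col ((c * e) \<cdot>\<^sub>m 1\<^sub>m (n * m))"
  then have ij: "i < n * m" "j < n * m" by auto
  note b = div_mod_bounds[OF ij(1)] div_mod_bounds[OF ij(2)]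
  have "i = j \<longleftrightarrow> i div m = j div m \<and> i mod m = j mod m"
    by (metis div_mult_mod_eq)
  then show "kronecker (c \<cdot>\<^sub>m 1\<^sub>m n) (e \<cdot>\<^sub>m 1\<^sub>m m) $$ (i, j) = ((c * e) \<cdot>\<^sub>m 1\<^sub>m (n * m)) $$ (i, j)"
    using ij b by (auto simp: kronecker_def)
qed (auto simp: kronecker_def)

lemma kronecker_list_carrier:
  assumes "\<And>k. k \<in> set ks \<Longrightarrow> A k \<in> carrier_mat (d k) (d k)"
  shows "kronecker_list (map A ks) \<in> carrier_mat (prod_list (map d ks)) (prod_list (map d ks))"
  using assms by (induction ks) (auto simp: kronecker_list_def intro!: kronecker_carrier)

lemma kronecker_list_mult:
  assumes "\<And>k. k \<in> set ks \<Longrightarrow> A k \<in> carrier_mat (d k) (d k)"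
    and "\<And>k. k \<in> set ks \<Longrightarrow> B k \<in> carrier_mat (d k) (d k)"
  shows "kronecker_list (map A ks) * kronecker_list (map B ks) = kronecker_list (map (\<lambda>k. A k * B k) ks)"
  using assms
proof (induction ks)
  case (Cons k ks)
  let ?p = "prod_list (map d ks)"
  have "kronecker_list (map A ks) \<in> carrier_mat ?p ?p" "kronecker_list (map B ks) \<in> carrier_mat ?p ?p"
    using Cons.prems by (auto intro!: kronecker_list_carrier)
  then show ?case
    using Cons kronecker_mult[of "A k" "d k" "kronecker_list (map A ks)" ?p "B k" "kronecker_list (map B ks)"]
    by (auto simp: kronecker_list_def)
qed (auto simp: kronecker_list_def)

lemma mat_trace_kronecker_list:
  assumes "\<And>k. k \<in> set ks \<Longrightarrow> A k \<in> carrier_mat (d k) (d k)"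
  shows "mat_trace (kronecker_list (map A ks)) = (\<Prod>k\<leftarrow>ks. mat_trace (A k))"
  using assms
proof (induction ks)
  case (Cons k ks)
  let ?p = "prod_list (map d ks)"
  have "kronecker_list (map A ks) \<in> carrier_mat ?p ?p"
    using Cons.prems by (auto intro!: kronecker_list_carrier)
  then show ?case
    using Cons mat_trace_kronecker[of "A k" "d k" "kronecker_list (map A ks)" ?p]
    by (auto simp: kronecker_list_def)
qed (auto simp: kronecker_list_def mat_trace_one)

lemma kronecker_list_smult_one:
  "kronecker_list (map (\<lambda>k. c k \<cdot>\<^sub>m 1\<^sub>m (d k)) ks) = (\<Prod>k\<leftarrow>ks. c k) \<cdot>\<^sub>m 1\<^sub>m (prod_list (map d ks))"
  by (induction ks) (auto simp: kronecker_list_def kronecker_smult_one)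

section \<open>Bases, matrices of operators and traces on finite-dimensional function spaces\<close>

lemma some_basis:
  assumes "cfun.subspace V" "V \<subseteq> cfun.span F" "finite F"
  shows "distinct (some_basis V)" "cfun.independent (set (some_basis V))"
    "cfun.span (set (some_basis V)) = V" "length (some_basis V) = cfun.dim V"
proof -
  obtain B where B: "B \<subseteq> V" "cfun.independent B" "V \<subseteq> cfun.span B"
    by (rule cfun.basis_exists[of V])
  have "B \<subseteq> cfun.span F" using B(1) assms(2) by (rule subset_trans)
  then have "finite B"
    using cfun.independent_span_bound[OF assms(3) B(2)] by auto
  then obtain bs where bs: "set bs = B" "distinct bs"
    using finite_distinct_list[of B] by auto
  have "cfun.span B = V"
    using cfun.span_minimal[OF B(1) assms(1)] B(3) by (rule subset_antisym)
  \<comment> \<open>The finite spanning set \<open>F\<close> makes the basis finite, so the choice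
    in \<open>some_basis\<close> ranges over a nonempty collection.\<close>
  then have ex: "\<exists>bs. distinct bs \<and> cfun.independent (set bs) \<and> cfun.span (set bs) = V"
    using bs B(2) by (intro exI[of _ bs]) simp
  from someI_ex[OF ex]
  have *: "distinct (some_basis V) \<and> cfun.independent (set (some_basis V)) \<and>
      cfun.span (set (some_basis V)) = V"
    unfolding some_basis_def .
  then show "distinct (some_basis V)" "cfun.independent (set (some_basis V))"
    "cfun.span (set (some_basis V)) = V" by auto
  then show "length (some_basis V) = cfun.dim V"
    using cfun.dim_span_eq_card_independent[of "set (some_basis V)"] by (simp add: distinct_card)
qed

abbreviation cfun_linear :: "(('a \<Rightarrow> complex) \<Rightarrow> ('b \<Rightarrow> complex)) \<Rightarrow> bool" where
  "cfun_linear T \<equiv> Modules.module_hom (\<lambda>c f x. c * f x) (\<lambda>c f x. c * f x) T"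

lemma matrix_on_mult:
  assumes V: "cfun.subspace V" "V \<subseteq> cfun.span F" "finite F"
    and T: "cfun_linear T" "\<And>v. v \<in> V \<Longrightarrow> T v \<in> V"
    and S: "\<And>v. v \<in> V \<Longrightarrow> S v \<in> V"
  shows "matrix_on V (\<lambda>v. T (S v)) = matrix_on V T * matrix_on V S"
proof -
  define bs where "bs = some_basis V"
  let ?n = "length bs" and ?rep = "cfun.representation (set bs)"
  note b = some_basis[OF V, folded bs_def]
  have bV: "bs ! j \<in> V" if "j < ?n" for j using b(3) that cfun.span_base nth_mem by blast
  have mo: "matrix_on V U = mat ?n ?n (\<lambda>(i, j). ?rep (U (bs ! j)) (bs ! i))" for U
    unfolding matrix_on_def bs_def by (simp add: Let_def)
  have car: "matrix_on V U \<in> carrier_mat ?n ?n" for U unfolding mo by simp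
  show ?thesis
  proof (rule eq_matI)
    fix i j assume "i < dim_row (matrix_on V T * matrix_on V S)" "j < dim_col (matrix_on V T * matrix_on V S)"
    then have ij: "i < ?n" "j < ?n" by (auto simp: mo)
    define v where "v = S (bs ! j)"
    have v: "v \<in> V" unfolding v_def using S bV ij by blast
    \<comment> \<open>The image under \<open>S\<close> is expanded in the basis and \<open>T\<close>
      is pushed inside by linearity; the coefficients are the entries of the matrix product.\<close>
    have "v = (\<Sum>c\<in>set bs. (\<lambda>x. ?rep v c * c x))"
      using cfun.sum_representation_eq[OF b(2), of v "set bs"] v b(3) by simp
    then have "T v = T (\<Sum>c\<in>set bs. (\<lambda>x. ?rep v c * c x))" by simp
    also have "\<dots> = (\<Sum>c\<in>set bs. (\<lambda>x. ?rep v c * T c x))"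
      by (simp add: Modules.module_hom.sum[OF T(1)] Modules.module_hom.scale[OF T(1)])
    finally have Tv: "T v = (\<Sum>c\<in>set bs. (\<lambda>x. ?rep v c * T c x))" .
    have TV: "T c \<in> cfun.span (set bs)" if "c \<in> set bs" for c
      using b(3) T(2) cfun.span_base that by blast
    have "?rep (T v) (bs ! i) = (\<Sum>c\<in>set bs. ?rep v c * ?rep (T c) (bs ! i))"
    proof -
      have "?rep (\<Sum>c\<in>set bs. (\<lambda>x. ?rep v c * T c x)) = (\<lambda>d. \<Sum>c\<in>set bs. ?rep (\<lambda>x. ?rep v c * T c x) d)"
        by (rule cfun.representation_sum[OF b(2)], rule cfun.span_scale, rule TV)
      also have "\<dots> = (\<lambda>d. \<Sum>c\<in>set bs. ?rep v c * ?rep (T c) d)"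
        by (intro ext sum.cong refl) (simp only: cfun.representation_scale[OF b(2) TV])
      finally show ?thesis unfolding Tv by (rule fun_cong)
    qed
    also have "\<dots> = (\<Sum>k<?n. ?rep v (bs ! k) * ?rep (T (bs ! k)) (bs ! i))"
      using sum.reindex_bij_betw[OF bij_betw_nth[OF b(1) refl refl],
          of "\<lambda>c. ?rep v c * ?rep (T c) (bs ! i)"] by simp
    finally show "matrix_on V (\<lambda>v. T (S v)) $$ (i, j) = (matrix_on V T * matrix_on V S) $$ (i, j)"
      unfolding mat_mult_index[OF car car ij] using ij
      by (simp add: mo v_def mult.commute)
  qed (auto simp: mo)
qed

lemma matrix_on_id:
  assumes V: "cfun.subspace V" "V \<subseteq> cfun.span F" "finite F"
    and T: "\<And>v. v \<in> V \<Longrightarrow> T v = v"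
  shows "matrix_on V T = 1\<^sub>m (cfun.dim V)"
proof -
  define bs where "bs = some_basis V"
  note b = some_basis[OF V, folded bs_def]
  have bV: "bs ! j \<in> V" if "j < length bs" for j using b(3) that cfun.span_base nth_mem by blast
  show ?thesis
    unfolding matrix_on_def bs_def[symmetric] Let_def
    by (rule eq_matI)
      (auto simp: T bV b(4) cfun.representation_basis[OF b(2)] nth_eq_iff_index_eq[OF b(1)])
qed

lemma matrix_on_carrier:
  assumes V: "cfun.subspace V" "V \<subseteq> cfun.span F" "finite F"
  shows "matrix_on V T \<in> carrier_mat (cfun.dim V) (cfun.dim V)"
  using some_basis(4)[OF V] by (auto simp: matrix_on_def Let_def)

definition delta :: "'a \<Rightarrow> 'a \<Rightarrow> complex" where
  "delta x = (\<lambda>y. if y = x then 1 else 0)"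

lemma sum_fun_apply: "(\<Sum>x\<in>A. f x) y = (\<Sum>x\<in>A. f x y)"
  by (induction A rule: infinite_finite_induct) auto

lemma delta_expansion:
  assumes "finite X" "\<And>x. x \<notin> X \<Longrightarrow> f x = 0"
  shows "(\<Sum>x\<in>X. (\<lambda>y. f x * delta x y)) = f"
proof
  fix y
  have "(\<Sum>x\<in>X. f x * delta x y) = (\<Sum>x\<in>X. if x = y then f x else 0)"
    by (intro sum.cong) (auto simp: delta_def)
  then show "(\<Sum>x\<in>X. (\<lambda>y. f x * delta x y)) y = f y"
    using assms by (simp add: sum_fun_apply)
qed

lemma span_delta:
  assumes "finite X" "\<And>x. x \<notin> X \<Longrightarrow> f x = 0"
  shows "f \<in> cfun.span (delta ` X)"
proof -
  have "(\<Sum>x\<in>X. (\<lambda>y. f x * delta x y)) \<in> cfun.span (delta ` X)"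
    by (rule cfun.span_sum, rule cfun.span_scale, rule cfun.span_base) simp
  then show ?thesis using delta_expansion[OF assms] by simp
qed

text \<open>Both sides are the trace of \<open>R\<close>: the left one in the basis of the \<open>delta x\<close>, the right
  one in a basis that extends a basis of \<open>V\<close>.\<close>

lemma trace_of_quasi_projection:
  assumes X: "finite X" and V: "cfun.subspace V" "\<And>v x. v \<in> V \<Longrightarrow> x \<notin> X \<Longrightarrow> v x = 0"
    and R: "cfun_linear R" "\<And>x. x \<in> X \<Longrightarrow> R (delta x) \<in> V"
    and Rv: "\<And>v. v \<in> V \<Longrightarrow> R v = (\<lambda>x. \<kappa> * v x)"
  shows "(\<Sum>x\<in>X. R (delta x) x) = \<kappa> * of_nat (cfun.dim V)"
proof -
  define W where "W = cfun.span (delta ` X)"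
  have VW: "V \<subseteq> W" unfolding W_def using span_delta[OF X] V(2) by blast
  have W0: "w x = 0" if "w \<in> W" "x \<notin> X" for w x
  proof -
    have "cfun.subspace {f. \<forall>x. x \<notin> X \<longrightarrow> f x = 0}"
      by (auto simp: cfun.subspace_def)
    moreover have "delta ` X \<subseteq> {f. \<forall>x. x \<notin> X \<longrightarrow> f x = 0}" by (auto simp: delta_def)
    ultimately have "W \<subseteq> {f. \<forall>x. x \<notin> X \<longrightarrow> f x = 0}" unfolding W_def by (rule cfun.span_minimal[rotated])
    then show ?thesis using that by blast
  qed
  obtain B where B: "B \<subseteq> V" "cfun.independent B" "V \<subseteq> cfun.span B" "card B = cfun.dim V"
    using cfun.basis_exists[of V] by blast
  obtain D where D: "B \<subseteq> D" "D \<subseteq> W" "cfun.independent D" "W \<subseteq> cfun.span D"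
    using cfun.maximal_independent_subset_extend[of B W] B VW by blast
  have finD: "finite D" using cfun.independent_span_bound[OF finite_imageI[OF X] D(3)] D(2) unfolding W_def by blast
  let ?rep = "cfun.representation D"
  have RV: "R w \<in> V" if "w \<in> W" for w
  proof -
    have "R w = R (\<Sum>x\<in>X. (\<lambda>y. w x * delta x y))" using delta_expansion[OF X] W0[OF that] by simp
    also have "\<dots> = (\<Sum>x\<in>X. (\<lambda>y. w x * R (delta x) y))"
      by (simp add: Modules.module_hom.sum[OF R(1)] Modules.module_hom.scale[OF R(1)])
    also have "\<dots> \<in> V" using R(2) V(1) by (auto intro!: cfun.subspace_sum cfun.subspace_scale)
    finally show ?thesis .
  qed
  have repB: "?rep v = cfun.representation B v" if "v \<in> V" for v
    using cfun.representation_extend[OF D(3) _ D(1)] B(3) that by blast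
  \<comment> \<open>Since \<open>R\<close> maps into \<open>V\<close>, the span of \<open>B\<close>,
    a basis vector outside \<open>B\<close> has no diagonal coefficient.\<close>
  have "(\<Sum>b\<in>D. ?rep (R b) b) = (\<Sum>b\<in>B. ?rep (R b) b)"
  proof (rule sum.mono_neutral_right[OF finD D(1)], safe)
    fix b assume b: "b \<in> D" "b \<notin> B"
    then have "?rep (R b) = cfun.representation B (R b)" using repB[OF RV] D(2) by auto
    then show "?rep (R b) b = 0" using cfun.representation_ne_zero[of B "R b" b] b(2) by auto
  qed
  also have "\<dots> = (\<Sum>b\<in>B. \<kappa>)"
  proof (rule sum.cong[OF refl])
    fix b assume b: "b \<in> B"
    then have "?rep (\<lambda>x. \<kappa> * b x) = (\<lambda>d. \<kappa> * ?rep b d)"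
      using D(1) by (intro cfun.representation_scale[OF D(3)] cfun.span_base) auto
    moreover have "R b = (\<lambda>x. \<kappa> * b x)" using b B(1) Rv by blast
    ultimately show "?rep (R b) b = \<kappa>"
      using b D(1) cfun.representation_basis[OF D(3), of b] by auto
  qed
  also have "\<dots> = \<kappa> * of_nat (cfun.dim V)" by (simp add: B(4))
  finally have 1: "(\<Sum>b\<in>D. ?rep (R b) b) = \<kappa> * of_nat (cfun.dim V)" .
  have RD: "R (delta x) \<in> cfun.span D" if "x \<in> X" for x using R(2)[OF that] VW D(4) by auto
  \<comment> \<open>Change of basis: each \<open>b\<close> is written through the functions
    \<open>delta x\<close>, the sums are exchanged, and \<open>R (delta x)\<close> is reassembled
    from its coordinates in \<open>D\<close>.\<close>
  have "(\<Sum>b\<in>D. ?rep (R b) b) = (\<Sum>b\<in>D. \<Sum>x\<in>X. b x * ?rep (R (delta x)) b)"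
  proof (rule sum.cong[OF refl])
    fix b assume b: "b \<in> D"
    have "(\<Sum>x\<in>X. (\<lambda>y. b x * delta x y)) = b"
      by (rule delta_expansion[OF X], rule W0) (use b D(2) in auto)
    then have "R b = R (\<Sum>x\<in>X. (\<lambda>y. b x * delta x y))" by (rule arg_cong[OF sym])
    also have "\<dots> = (\<Sum>x\<in>X. (\<lambda>y. b x * R (delta x) y))"
      by (simp add: Modules.module_hom.sum[OF R(1)] Modules.module_hom.scale[OF R(1)])
    finally have Rb: "R b = \<dots>" .
    show "?rep (R b) b = (\<Sum>x\<in>X. b x * ?rep (R (delta x)) b)"
    proof -
      have "?rep (\<Sum>x\<in>X. (\<lambda>y. b x * R (delta x) y)) = (\<lambda>d. \<Sum>x\<in>X. ?rep (\<lambda>y. b x * R (delta x) y) d)"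
        by (rule cfun.representation_sum[OF D(3)], rule cfun.span_scale, rule RD)
      also have "\<dots> = (\<lambda>d. \<Sum>x\<in>X. b x * ?rep (R (delta x)) d)"
        by (intro ext sum.cong refl) (simp only: cfun.representation_scale[OF D(3) RD])
      finally show ?thesis unfolding Rb by (rule fun_cong)
    qed
  qed
  also have "\<dots> = (\<Sum>x\<in>X. \<Sum>b\<in>D. ?rep (R (delta x)) b * b x)"
    by (subst sum.swap) (intro sum.cong refl mult.commute)
  also have "\<dots> = (\<Sum>x\<in>X. R (delta x) x)"
  proof (rule sum.cong[OF refl])
    fix x assume x: "x \<in> X"
    have "(\<Sum>b\<in>D. (\<lambda>y. ?rep (R (delta x)) b * b y)) = R (delta x)"
      using cfun.sum_representation_eq[OF D(3) RD[OF x] finD] by simp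
    from fun_cong[OF this, of x] show "(\<Sum>b\<in>D. ?rep (R (delta x)) b * b x) = R (delta x) x"
      by (simp add: sum_fun_apply)
  qed
  finally show ?thesis using 1 by simp
qed

section \<open>Young tableaux and the Young symmetrizer\<close>

lemma offset_Suc: "k < length b \<Longrightarrow> offset b (Suc k) = offset b k + b ! k"
  by (simp add: offset_def take_Suc_conv_app_nth)

lemma offset_0 [simp]: "offset b 0 = 0" by (simp add: offset_def)

lemma offset_length [simp]: "offset b (length b) = sum_list b" by (simp add: offset_def)

lemma offset_mono: "j \<le> k \<Longrightarrow> offset b j \<le> offset b k"
proof (induction k rule: dec_induct)
  case (step k)
  have "offset b k \<le> offset b (Suc k)"
    by (cases "k < length b") (auto simp: offset_Suc, simp add: offset_def)
  then show ?case using step.IH by simp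
qed simp

lemma row_of_eqI:
  assumes "k < length b" "offset b k < i" "i \<le> offset b k + b ! k"
  shows "row_of b i = k"
  unfolding row_of_def offset_def[symmetric]
proof (rule Least_equality)
  show "i \<le> offset b (Suc k)" using assms by (simp add: offset_Suc)
  fix j assume "i \<le> offset b (Suc j)"
  then show "k \<le> j" using assms(2) offset_mono[of "Suc j" k b] by (meson leD le_less_trans not_less_eq_eq order_trans)
qed

lemma row_of_bounds:
  assumes "i \<in> {1..sum_list b}"
  shows "row_of b i < length b" "offset b (row_of b i) < i" "i \<le> offset b (row_of b i) + b ! row_of b i"
proof -
  have "b \<noteq> []" using assms by auto
  then have ex: "i \<le> offset b (Suc (length b - 1))" using assms by simp
  have le: "i \<le> offset b (Suc (row_of b i))"
    unfolding row_of_def offset_def[symmetric] by (rule LeastI) (rule ex)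
  have "row_of b i \<le> length b - 1"
    unfolding row_of_def offset_def[symmetric] by (rule Least_le) (rule ex)
  then show 1: "row_of b i < length b" using \<open>b \<noteq> []\<close> by (cases b) auto
  show "i \<le> offset b (row_of b i) + b ! row_of b i" using le 1 by (simp add: offset_Suc)
  show "offset b (row_of b i) < i"
  proof (cases "row_of b i")
    case 0 then show ?thesis using assms by simp
  next
    case (Suc j)
    then have "\<not> i \<le> offset b (Suc j)"
      using not_less_Least[of j "\<lambda>j. i \<le> offset b (Suc j)"]
      unfolding row_of_def offset_def[symmetric] by simp
    then show ?thesis using Suc by simp
  qed
qed

text \<open>Stated for lists of naturals in general, because \<open>row_of\<close> serves twice: for
  a partition it is the tableau row, for the composition \<open>b\<close> of sizes it is the index
  of the block containing \<open>i\<close>.\<close>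

lemma row_of_eq_iff:
  assumes "i \<in> {1..sum_list b}" "k < length b"
  shows "row_of b i = k \<longleftrightarrow> i \<in> block b k"
proof
  assume "row_of b i = k"
  with row_of_bounds(2,3)[OF assms(1)] show "i \<in> block b k" by (simp add: block_def)
next
  assume "i \<in> block b k"
  then show "row_of b i = k" by (intro row_of_eqI[OF assms(2)]) (auto simp: block_def)
qed

lemma block_subset: "k < length b \<Longrightarrow> block b k \<subseteq> {1..sum_list b}"
  using offset_mono[of "Suc k" "length b" b] by (auto simp: block_def offset_Suc)

lemma card_block: "card (block b k) = b ! k" by (simp add: block_def)

lemma block_eq: "k < length b \<Longrightarrow> block b k = {i \<in> {1..sum_list b}. row_of b i = k}"
  using block_subset row_of_eq_iff by blast

lemma cell_of:
  assumes "i < length mu" "j \<in> {1..mu ! i}"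
  shows "offset mu i + j \<in> {1..sum_list mu}" "row_of mu (offset mu i + j) = i"
    "col_of mu (offset mu i + j) = j"
proof -
  show "offset mu i + j \<in> {1..sum_list mu}"
    using assms block_subset[OF assms(1)] by (auto simp: block_def)
  show r: "row_of mu (offset mu i + j) = i" by (rule row_of_eqI) (use assms in auto)
  show "col_of mu (offset mu i + j) = j" unfolding col_of_def r by (simp add: offset_def)
qed

lemma of_cell:
  assumes "x \<in> {1..sum_list mu}"
  shows "col_of mu x \<in> {1..mu ! row_of mu x}" "x = offset mu (row_of mu x) + col_of mu x"
  using row_of_bounds[OF assms] by (auto simp: col_of_def offset_def)

text \<open>Of the entries of a column, at most as many lie in the first \<open>k\<close> rows after applying \<open>g\<close> as
  before, and the totals over all columns agree; hence the counts agree for every column.\<close>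

lemma col_of_le_row_length:
  assumes mu: "is_partition mu" and g: "g permutes {1..sum_list mu}"
    and inj: "\<And>x y. x \<in> {1..sum_list mu} \<Longrightarrow> y \<in> {1..sum_list mu} \<Longrightarrow>
      row_of mu (g x) = row_of mu (g y) \<Longrightarrow> col_of mu x = col_of mu y \<Longrightarrow> x = y"
    and x: "x \<in> {1..sum_list mu}"
  shows "col_of mu x \<in> {1..mu ! row_of mu (g x)}"
proof -
  define A where "A = {1..sum_list mu}"
  define C where "C j = {i. i < length mu \<and> j \<le> mu ! i}" for j
  define d where "d j k = card {y \<in> A. col_of mu y = j \<and> row_of mu y < k}" for j k
  define e where "e j k = card {y \<in> A. col_of mu y = j \<and> row_of mu (g y) < k}" for j k
  have fin: "finite A" unfolding A_def by simp
  have gA: "g y \<in> A" if "y \<in> A" for y using g that unfolding A_def by (metis permutes_in_image)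
  have colC: "bij_betw (row_of mu) {y \<in> A. col_of mu y = j} (C j)" if "1 \<le> j" for j
  proof (rule bij_betw_byWitness[where f' = "\<lambda>i. offset mu i + j"])
    show "\<forall>a\<in>{y \<in> A. col_of mu y = j}. offset mu (row_of mu a) + j = a"
      using of_cell(2) unfolding A_def by auto
    show "\<forall>a'\<in>C j. row_of mu (offset mu a' + j) = a'"
      using that by (auto simp: C_def cell_of)
    show "row_of mu ` {y \<in> A. col_of mu y = j} \<subseteq> C j"
      using of_cell(1) row_of_bounds(1) unfolding A_def C_def by fastforce
    show "(\<lambda>i. offset mu i + j) ` C j \<subseteq> {y \<in> A. col_of mu y = j}"
      using that cell_of unfolding A_def C_def by auto
  qed
  \<comment> \<open>The rows of length at least \<open>j\<close> come first because a partition is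
    weakly decreasing. Hence column \<open>j\<close> has height \<open>card (C j)\<close>, and
    \<open>d j k\<close> is the minimum of \<open>k\<close> and this height.\<close>
  have Cinit: "C j = {..<card (C j)}" for j
  proof -
    have down: "i' \<in> C j" if "i \<in> C j" "i' \<le> i" for i i'
    proof -
      have "mu ! i \<le> mu ! i'"
        using mu that unfolding is_partition_def C_def
        by (cases "i' = i") (auto simp: sorted_wrt_iff_nth_less)
      then show ?thesis using that unfolding C_def by auto
    qed
    have "finite (C j)" unfolding C_def by simp
    show ?thesis
    proof (cases "C j = {}")
      case False
      define M where "M = Max (C j)"
      have "C j = {..M}"
        using Max_ge[OF \<open>finite (C j)\<close>] down[OF Max_in[OF \<open>finite (C j)\<close> False]]
        unfolding M_def by auto
      then show ?thesis by (simp add: lessThan_Suc_atMost)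
    qed simp
  qed
  have dval: "d j k = min k (card (C j))" if "1 \<le> j" for j k
  proof -
    have "bij_betw (row_of mu) {y \<in> A. col_of mu y = j \<and> row_of mu y < k} (C j \<inter> {..<k})"
    proof (rule bij_betw_subset[OF colC[OF that]])
      show "row_of mu ` {y \<in> A. col_of mu y = j \<and> row_of mu y < k} = C j \<inter> {..<k}"
        using bij_betw_imp_surj_on[OF colC[OF that]] by auto
    qed auto
    then have "d j k = card (C j \<inter> {..<k})" unfolding d_def by (rule bij_betw_same_card)
    also have "\<dots> = card ({..<card (C j)} \<inter> {..<k})" using Cinit[of j] by simp
    also have "{..<card (C j)} \<inter> {..<k} = {..<min k (card (C j))}" by auto
    finally show ?thesis by simp
  qed
  have cardC: "card {y \<in> A. col_of mu y = j} = card (C j)" if "1 \<le> j" for j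
    using colC[OF that] by (rule bij_betw_same_card)
  \<comment> \<open>By \<open>inj\<close> the entries of one column go to distinct rows, which
    bounds \<open>e j k\<close> by \<open>k\<close>; the column height is a bound anyway.\<close>
  have ele: "e j k \<le> d j k" if "1 \<le> j" for j k
  proof -
    have "e j k \<le> card {y \<in> A. col_of mu y = j}"
      unfolding e_def by (rule card_mono) (use fin in auto)
    moreover have "e j k \<le> card {..<k}"
      unfolding e_def
    proof (rule card_inj_on_le)
      show "inj_on (\<lambda>y. row_of mu (g y)) {y \<in> A. col_of mu y = j \<and> row_of mu (g y) < k}"
        using inj unfolding A_def by (auto simp: inj_on_def)
    qed auto
    ultimately show ?thesis using dval[OF that] cardC[OF that] by simp
  qed
  have col1: "1 \<le> col_of mu y" if "y \<in> A" for y using of_cell(1) that unfolding A_def by fastforce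
  define J where "J = col_of mu ` A"
  have J: "finite J" "\<And>j. j \<in> J \<Longrightarrow> 1 \<le> j" unfolding J_def using fin col1 by auto
  have split: "card {y \<in> A. T y} = (\<Sum>j\<in>J. card {y \<in> A. col_of mu y = j \<and> T y})" for T
  proof -
    have "card {y \<in> A. T y} = card (\<Union>j\<in>J. {y \<in> A. col_of mu y = j \<and> T y})"
      by (rule arg_cong[of _ _ card]) (auto simp: J_def)
    also have "\<dots> = (\<Sum>j\<in>J. card {y \<in> A. col_of mu y = j \<and> T y})"
      by (rule card_UN_disjoint) (use J fin in auto)
    finally show ?thesis .
  qed
  \<comment> \<open>As \<open>g\<close> is a bijection, the sums of \<open>e\<close> and of
    \<open>d\<close> over the columns both count the entries in the first \<open>k\<close> rows. A
    termwise inequality between equal sums is an equality.\<close>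
  have eq: "e j k = d j k" if "j \<in> J" for j k
  proof -
    have "bij_betw g {y \<in> A. row_of mu (g y) < k} {y \<in> A. row_of mu y < k}"
    proof -
      have b: "bij_betw g A A" using g unfolding A_def by (rule permutes_imp_bij)
      show ?thesis
      proof (rule bij_betw_subset[OF b])
        show "g ` {y \<in> A. row_of mu (g y) < k} = {y \<in> A. row_of mu y < k}"
          using bij_betw_imp_surj_on[OF b] by auto
      qed auto
    qed
    then have "(\<Sum>j\<in>J. e j k) = (\<Sum>j\<in>J. d j k)"
      unfolding e_def d_def split[symmetric] by (rule bij_betw_same_card)
    then show ?thesis by (rule sum_mono_inv) (use ele J that in auto)
  qed
  define j where "j = col_of mu x"
  \<comment> \<open>With \<open>k\<close> the height of the column of \<open>x\<close>, equality
    says that \<open>g\<close> sends the whole column into the first \<open>k\<close> rows, and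
    these are the rows of length at least \<open>j\<close>.\<close>
  define k where "k = card (C j)"
  have jJ: "j \<in> J" unfolding j_def J_def A_def using x by (rule imageI)
  note j = jJ J(2)[OF jJ]
  have "card {y \<in> A. col_of mu y = j \<and> row_of mu (g y) < k} = card {y \<in> A. col_of mu y = j}"
    using eq[OF j(1), of k] dval[OF j(2), of k] cardC[OF j(2)] unfolding e_def k_def by simp
  then have "{y \<in> A. col_of mu y = j \<and> row_of mu (g y) < k} = {y \<in> A. col_of mu y = j}"
    by (intro card_subset_eq) (use fin in auto)
  moreover have "x \<in> {y \<in> A. col_of mu y = j}" using x unfolding A_def j_def by simp
  ultimately have "row_of mu (g x) < k" by blast
  then have "row_of mu (g x) \<in> C j" using Cinit[of j] unfolding k_def by blast
  then show ?thesis using j unfolding C_def j_def by simp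
qed

section \<open>Row group, column group and the symmetries of the Young symmetrizer\<close>

lemma row_group_eq:
  "row_group mu = {p. p permutes {1..sum_list mu} \<and> (\<forall>i\<in>{1..sum_list mu}. row_of mu (p i) = row_of mu i)}"
  by (simp add: row_group_def sym_group_carrier)

lemma col_group_eq:
  "col_group mu = {p. p permutes {1..sum_list mu} \<and> (\<forall>i\<in>{1..sum_list mu}. col_of mu (p i) = col_of mu i)}"
  by (simp add: col_group_def sym_group_carrier)

text \<open>Row and column groups are both the permutations preserving the fibres of a function,
  \<open>row_of\<close> or \<open>col_of\<close>; closure is proved once and specialised to
  both.\<close>

lemma fibre_permutations_comp:
  assumes "p \<in> {p. p permutes A \<and> (\<forall>i\<in>A. f (p i) = f i)}" "q \<in> {p. p permutes A \<and> (\<forall>i\<in>A. f (p i) = f i)}"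
  shows "p \<circ> q \<in> {p. p permutes A \<and> (\<forall>i\<in>A. f (p i) = f i)}"
  using assms permutes_compose[of q A p] permutes_in_image[of q A] by auto

lemma fibre_permutations_inv:
  assumes "p \<in> {p. p permutes A \<and> (\<forall>i\<in>A. f (p i) = f i)}"
  shows "inv' p \<in> {p. p permutes A \<and> (\<forall>i\<in>A. f (p i) = f i)}"
proof -
  have p: "p permutes A" "\<And>i. i \<in> A \<Longrightarrow> f (p i) = f i" using assms by auto
  have "f (inv' p i) = f i" if "i \<in> A" for i
    using p(2)[of "inv' p i"] permutes_in_image[OF permutes_inv[OF p(1)], of i] that
      permutes_inverses(1)[OF p(1), of i] by simp
  then show ?thesis using permutes_inv[OF p(1)] by simp
qed

lemmas row_group_comp = fibre_permutations_comp[where f = "row_of mu" and A = "{1..sum_list mu}" for mu,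
    folded row_group_eq]
lemmas row_group_inv = fibre_permutations_inv[where f = "row_of mu" and A = "{1..sum_list mu}" for mu,
    folded row_group_eq]
lemmas col_group_comp = fibre_permutations_comp[where f = "col_of mu" and A = "{1..sum_list mu}" for mu,
    folded col_group_eq]
lemmas col_group_inv = fibre_permutations_inv[where f = "col_of mu" and A = "{1..sum_list mu}" for mu,
    folded col_group_eq]

lemma row_group_permutes: "p \<in> row_group mu \<Longrightarrow> p permutes {1..sum_list mu}"
  by (simp add: row_group_def sym_group_carrier)

lemma col_group_permutes: "p \<in> col_group mu \<Longrightarrow> p permutes {1..sum_list mu}"
  by (simp add: col_group_def sym_group_carrier)

lemma id_in_groups [simp]: "id \<in> row_group mu" "id \<in> col_group mu"
  by (auto simp: row_group_def col_group_def sym_group_carrier permutes_id)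

lemma row_col_group_disjoint:
  assumes "p \<in> row_group mu" "p \<in> col_group mu"
  shows "p = id"
proof
  fix x
  show "p x = id x"
  proof (cases "x \<in> {1..sum_list mu}")
    case True
    then have px: "p x \<in> {1..sum_list mu}" using row_group_permutes[OF assms(1)] by (metis permutes_in_image)
    have "row_of mu (p x) = row_of mu x" "col_of mu (p x) = col_of mu x"
      using assms True unfolding row_group_def col_group_def by auto
    then show ?thesis using of_cell(2)[OF True] of_cell(2)[OF px] by simp
  next
    case False
    then show ?thesis using row_group_permutes[OF assms(1)] by (simp add: permutes_not_in)
  qed
qed

text \<open>The permutation \<open>inv' p' o p = q' o inv' q\<close> preserves rows and columns,
  hence every cell. So the coefficient of the Young symmetrizer at \<open>p o q\<close> is a single
  sign, without further summands.\<close>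

lemma row_col_decomposition_unique:
  assumes "p \<in> row_group mu" "q \<in> col_group mu" "p' \<in> row_group mu" "q' \<in> col_group mu"
    and eq: "p \<circ> q = p' \<circ> q'"
  shows "p = p'" "q = q'"
proof -
  note perm = row_group_permutes[OF assms(1)] col_group_permutes[OF assms(2)]
    row_group_permutes[OF assms(3)] col_group_permutes[OF assms(4)]
  have "inv' p' \<circ> p = inv' p' \<circ> (p \<circ> q) \<circ> inv' q"
    using perm by (simp add: fun_eq_iff permutes_inverses)
  also have "\<dots> = q' \<circ> inv' q"
    using perm unfolding eq by (simp add: fun_eq_iff permutes_inverses)
  finally have e: "inv' p' \<circ> p = q' \<circ> inv' q" .
  have "inv' p' \<circ> p \<in> row_group mu" using assms by (intro row_group_comp row_group_inv)
  moreover have "q' \<circ> inv' q \<in> col_group mu" using assms by (intro col_group_comp col_group_inv)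
  ultimately have "inv' p' \<circ> p = id" using e row_col_group_disjoint by metis
  then have "p' \<circ> (inv' p' \<circ> p) = p'" by simp
  then show p: "p = p'" using perm by (simp add: fun_eq_iff permutes_inverses)
  have "inv' p \<circ> (p \<circ> q) = inv' p \<circ> (p \<circ> q')" using eq p by simp
  then show "q = q'" using perm by (simp add: fun_eq_iff permutes_inverses)
qed

lemma young_symmetrizer_mult:
  assumes "p \<in> row_group mu" "q \<in> col_group mu"
  shows "young_symmetrizer mu (p \<circ> q) = of_int (sign q)"
proof -
  have "{(p', q'). p' \<in> row_group mu \<and> q' \<in> col_group mu \<and> p' \<circ> q' = p \<circ> q} = {(p, q)}"
    using row_col_decomposition_unique assms by blast
  then show ?thesis unfolding young_symmetrizer_def by simp
qed

lemma young_symmetrizer_eq_0: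
  assumes "\<And>p q. p \<in> row_group mu \<Longrightarrow> q \<in> col_group mu \<Longrightarrow> g \<noteq> p \<circ> q"
  shows "young_symmetrizer mu g = 0"
proof -
  have "{(p', q'). p' \<in> row_group mu \<and> q' \<in> col_group mu \<and> p' \<circ> q' = g} = {}"
    using assms by blast
  then show ?thesis unfolding young_symmetrizer_def by (simp only: sum.empty)
qed

lemma young_symmetrizer_row:
  assumes "p \<in> row_group mu"
  shows "young_symmetrizer mu (p \<circ> g) = young_symmetrizer mu g"
proof (cases "\<exists>p' q. p' \<in> row_group mu \<and> q \<in> col_group mu \<and> g = p' \<circ> q")
  case True
  then obtain p' q where g: "p' \<in> row_group mu" "q \<in> col_group mu" "g = p' \<circ> q" by blast
  then have "p \<circ> g = (p \<circ> p') \<circ> q" by (simp add: comp_assoc)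
  then show ?thesis
    using young_symmetrizer_mult[OF row_group_comp[OF assms g(1)] g(2)] young_symmetrizer_mult[OF g(1,2)] g(3)
    by simp
next
  case False
  have "p \<circ> g \<noteq> p' \<circ> q" if "p' \<in> row_group mu" "q \<in> col_group mu" for p' q
  proof
    assume "p \<circ> g = p' \<circ> q"
    then have "inv' p \<circ> (p \<circ> g) = inv' p \<circ> (p' \<circ> q)" by simp
    then have "g = (inv' p \<circ> p') \<circ> q"
      using row_group_permutes[OF assms] by (simp add: fun_eq_iff permutes_inverses)
    moreover have "inv' p \<circ> p' \<in> row_group mu" using assms that by (intro row_group_comp row_group_inv)
    ultimately show False using False that by blast
  qed
  then have "young_symmetrizer mu (p \<circ> g) = 0" by (rule young_symmetrizer_eq_0)
  moreover have "young_symmetrizer mu g = 0" by (rule young_symmetrizer_eq_0) (use False in blast)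
  ultimately show ?thesis by simp
qed

lemma permutes_permutation_atLeastAtMost: "p permutes {1..m::nat} \<Longrightarrow> permutation p"
  unfolding permutation_permutes by blast

lemma young_symmetrizer_col:
  assumes "q \<in> col_group mu"
  shows "young_symmetrizer mu (g \<circ> q) = of_int (sign q) * young_symmetrizer mu g"
proof (cases "\<exists>p' q'. p' \<in> row_group mu \<and> q' \<in> col_group mu \<and> g = p' \<circ> q'")
  case True
  then obtain p' q' where g: "p' \<in> row_group mu" "q' \<in> col_group mu" "g = p' \<circ> q'" by blast
  then have e: "g \<circ> q = p' \<circ> (q' \<circ> q)" by (simp add: comp_assoc)
  have "sign (q' \<circ> q) = sign q' * sign q"
    using col_group_permutes[OF g(2)] col_group_permutes[OF assms] permutes_permutation_atLeastAtMost
    by (blast intro: sign_compose)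
  then show ?thesis
    unfolding e young_symmetrizer_mult[OF g(1) col_group_comp[OF g(2) assms]]
    using young_symmetrizer_mult[OF g(1,2)] g(3) by simp
next
  case False
  have "g \<circ> q \<noteq> p' \<circ> q'" if "p' \<in> row_group mu" "q' \<in> col_group mu" for p' q'
  proof
    assume "g \<circ> q = p' \<circ> q'"
    then have "(g \<circ> q) \<circ> inv' q = p' \<circ> q' \<circ> inv' q" by simp
    then have "g = p' \<circ> (q' \<circ> inv' q)"
      using col_group_permutes[OF assms] by (simp add: fun_eq_iff permutes_inverses)
    moreover have "q' \<circ> inv' q \<in> col_group mu" using assms that by (intro col_group_comp col_group_inv)
    ultimately show False using False that by blast
  qed
  then have "young_symmetrizer mu (g \<circ> q) = 0" by (rule young_symmetrizer_eq_0)
  moreover have "young_symmetrizer mu g = 0" by (rule young_symmetrizer_eq_0) (use False in blast)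
  ultimately show ?thesis by simp
qed

text \<open>The column factor \<open>h\<close> moves \<open>x\<close> inside its column to the row
  of \<open>g x\<close>. The cell it needs exists by \<open>col_of_le_row_length\<close>,
  \<open>h\<close> is injective by \<open>inj\<close>, and the remaining factor
  \<open>g o inv' h\<close> preserves rows.\<close>

lemma row_col_factorization:
  assumes mu: "is_partition mu" and g: "g permutes {1..sum_list mu}"
    and inj: "\<And>x y. x \<in> {1..sum_list mu} \<Longrightarrow> y \<in> {1..sum_list mu} \<Longrightarrow>
      row_of mu (g x) = row_of mu (g y) \<Longrightarrow> col_of mu x = col_of mu y \<Longrightarrow> x = y"
  obtains p q where "p \<in> row_group mu" "q \<in> col_group mu" "g = p \<circ> q"
proof -
  define A where "A = {1..sum_list mu}"
  define h where "h x = (if x \<in> A then offset mu (row_of mu (g x)) + col_of mu x else x)" for x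
  have gA: "g x \<in> A" if "x \<in> A" for x using g that unfolding A_def by (metis permutes_in_image)
  have c: "h x \<in> A" "row_of mu (h x) = row_of mu (g x)" "col_of mu (h x) = col_of mu x" if "x \<in> A" for x
  proof -
    have "row_of mu (g x) < length mu" using gA[OF that] row_of_bounds(1) unfolding A_def by blast
    moreover have "col_of mu x \<in> {1..mu ! row_of mu (g x)}"
      using that unfolding A_def by (intro col_of_le_row_length[OF mu g inj])
    ultimately have "h x = offset mu (row_of mu (g x)) + col_of mu x"
      "offset mu (row_of mu (g x)) + col_of mu x \<in> A"
      "row_of mu (offset mu (row_of mu (g x)) + col_of mu x) = row_of mu (g x)"
      "col_of mu (offset mu (row_of mu (g x)) + col_of mu x) = col_of mu x"
      unfolding A_def using that by (auto simp only: cell_of h_def A_def if_True)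
    then show "h x \<in> A" "row_of mu (h x) = row_of mu (g x)" "col_of mu (h x) = col_of mu x"
      by (simp_all only:)
  qed
  have "inj_on h A"
  proof (rule inj_onI)
    fix x y assume "x \<in> A" "y \<in> A" "h x = h y"
    then show "x = y" using c(2,3)[of x] c(2,3)[of y] inj[of x y] unfolding A_def by simp
  qed
  moreover have "h ` A \<subseteq> A" using c(1) by blast
  ultimately have "bij_betw h A A"
    unfolding bij_betw_def by (simp add: A_def endo_inj_surj)
  then have h: "h permutes A" by (rule bij_imp_permutes) (simp add: h_def)
  have q: "h \<in> col_group mu"
    unfolding col_group_def sym_group_carrier using h c(3) unfolding A_def by auto
  have hi: "inv' h x \<in> A" if "x \<in> A" for x using h that by (metis permutes_in_image permutes_inv)
  have "row_of mu ((g \<circ> inv' h) x) = row_of mu x" if "x \<in> A" for x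
    using c(2)[OF hi[OF that]] permutes_inverses(1)[OF h] by simp
  then have p: "g \<circ> inv' h \<in> row_group mu"
    unfolding row_group_def sym_group_carrier
    using permutes_compose[OF permutes_inv[OF h]] g unfolding A_def by auto
  have "g = (g \<circ> inv' h) \<circ> h" using permutes_inverses[OF h] by (simp add: fun_eq_iff)
  then show thesis using that p q by blast
qed

lemma transpose_in_row_group:
  assumes "x \<in> {1..sum_list mu}" "y \<in> {1..sum_list mu}" "row_of mu x = row_of mu y"
  shows "Transposition.transpose x y \<in> row_group mu"
  using assms permutes_swap_id[OF assms(1,2)]
  by (auto simp: row_group_def sym_group_carrier Transposition.transpose_def)

lemma transpose_in_col_group:
  assumes "x \<in> {1..sum_list mu}" "y \<in> {1..sum_list mu}" "col_of mu x = col_of mu y"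
  shows "Transposition.transpose x y \<in> col_group mu"
  using assms permutes_swap_id[OF assms(1,2)]
  by (auto simp: col_group_def sym_group_carrier Transposition.transpose_def)

text \<open>If \<open>g\<close> sends two entries of one column to one row, the corresponding transposition can be
  absorbed on either side of \<open>g\<close>, which forces \<open>F g = - F g\<close>.\<close>

lemma young_symmetrizer_multiple:
  fixes F :: "(nat \<Rightarrow> nat) \<Rightarrow> complex"
  assumes mu: "is_partition mu"
    and F: "\<And>p g. p \<in> row_group mu \<Longrightarrow> g permutes {1..sum_list mu} \<Longrightarrow> F (p \<circ> g) = F g"
      "\<And>q g. q \<in> col_group mu \<Longrightarrow> g permutes {1..sum_list mu} \<Longrightarrow> F (g \<circ> q) = of_int (sign q) * F g"
    and g: "g permutes {1..sum_list mu}"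
  shows "F g = F id * young_symmetrizer mu g"
proof (cases "\<exists>p q. p \<in> row_group mu \<and> q \<in> col_group mu \<and> g = p \<circ> q")
  case True
  then obtain p q where pq: "p \<in> row_group mu" "q \<in> col_group mu" "g = p \<circ> q" by blast
  have "F g = F q" unfolding pq(3) using pq col_group_permutes by (intro F(1))
  also have "\<dots> = of_int (sign q) * F id" using F(2)[OF pq(2) permutes_id] by simp
  finally show ?thesis using young_symmetrizer_mult[OF pq(1,2)] pq(3) by simp
next
  case False
  have "\<exists>x\<in>{1..sum_list mu}. \<exists>y\<in>{1..sum_list mu}. row_of mu (g x) = row_of mu (g y) \<and>
      col_of mu x = col_of mu y \<and> x \<noteq> y"
  proof (rule ccontr)
    assume "\<not> ?thesis"
    then have "x = y" if "x \<in> {1..sum_list mu}" "y \<in> {1..sum_list mu}"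
      "row_of mu (g x) = row_of mu (g y)" "col_of mu x = col_of mu y" for x y
      using that by blast
    from row_col_factorization[OF mu g this] show False using False by blast
  qed
  then obtain x y where xy: "x \<in> {1..sum_list mu}" "y \<in> {1..sum_list mu}" "x \<noteq> y"
    "row_of mu (g x) = row_of mu (g y)" "col_of mu x = col_of mu y" by blast
  have gxy: "g x \<in> {1..sum_list mu}" "g y \<in> {1..sum_list mu}"
    using xy g by (metis permutes_in_image)+
  have e: "Transposition.transpose (g x) (g y) \<circ> g = g \<circ> Transposition.transpose x y"
    using permutes_inj[OF g] by (auto simp: fun_eq_iff Transposition.transpose_def inj_eq)
  have "F g = F (Transposition.transpose (g x) (g y) \<circ> g)"
    using F(1)[OF transpose_in_row_group[OF gxy xy(4)] g] by simp
  also have "\<dots> = - F g"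
    unfolding e F(2)[OF transpose_in_col_group[OF xy(1,2,5)] g] using xy(3) by (simp add: sign_swap_id)
  finally have "F g = 0" by simp
  moreover have "young_symmetrizer mu g = 0" by (rule young_symmetrizer_eq_0) (use False in blast)
  ultimately show ?thesis by simp
qed

section \<open>Specht modules\<close>

abbreviation Sym :: "nat \<Rightarrow> (nat \<Rightarrow> nat) set" where
  "Sym m \<equiv> {p. p permutes {1..m}}"

lemma carrier_sym_group: "carrier (sym_group m) = Sym m"
  by (simp add: sym_group_def)

lemma finite_Sym [simp]: "finite (Sym m)"
  by (simp add: finite_permutations)

lemma inv_comp_permutes:
  "u permutes A \<Longrightarrow> v permutes A \<Longrightarrow> inv' (u \<circ> v) = inv' v \<circ> inv' u"
  by (simp add: o_inv_distrib permutes_bij)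

lemma inv_comp_cancel: "u permutes A \<Longrightarrow> inv' u \<circ> (u \<circ> g) = g" "u permutes A \<Longrightarrow> u \<circ> (inv' u \<circ> g) = g"
  by (simp_all add: fun_eq_iff permutes_inverses)

lemma sum_permutations_comp_left:
  assumes "w permutes A"
  shows "(\<Sum>u | u permutes A. f u) = (\<Sum>u | u permutes A. f (w \<circ> u))"
  by (rule sum.reindex_bij_witness[where i = "\<lambda>u. w \<circ> u" and j = "\<lambda>u. inv' w \<circ> u"])
    (use assms permutes_inv[OF assms] in \<open>auto simp: inv_comp_cancel[OF assms] permutes_compose\<close>)

lemma convolve_apply:
  "convolve m f h g = (if g \<in> Sym m then \<Sum>u\<in>Sym m. f u * h (inv' u \<circ> g) else 0)"
  by (simp add: convolve_def carrier_sym_group)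

lemma convolve_assoc:
  "convolve m (convolve m f h) k = convolve m f (convolve m h k)"
proof
  fix g
  show "convolve m (convolve m f h) k g = convolve m f (convolve m h k) g"
  proof (cases "g \<in> Sym m")
    case True
    then have g: "g permutes {1..m}" by simp
    have "convolve m (convolve m f h) k g = (\<Sum>u\<in>Sym m. (\<Sum>v\<in>Sym m. f v * h (inv' v \<circ> u)) * k (inv' u \<circ> g))"
      using True by (simp add: convolve_apply)
    also have "\<dots> = (\<Sum>u\<in>Sym m. \<Sum>v\<in>Sym m. f v * (h (inv' v \<circ> u) * k (inv' u \<circ> g)))"
      by (simp add: sum_distrib_right mult.assoc)
    also have "\<dots> = (\<Sum>v\<in>Sym m. \<Sum>u\<in>Sym m. f v * (h (inv' v \<circ> u) * k (inv' u \<circ> g)))"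
      by (rule sum.swap)
    also have "\<dots> = (\<Sum>v\<in>Sym m. f v * (\<Sum>u\<in>Sym m. h u * k (inv' u \<circ> (inv' v \<circ> g))))"
    proof (rule sum.cong[OF refl])
      fix v assume "v \<in> Sym m"
      then have v: "v permutes {1..m}" by simp
      have "(\<Sum>u\<in>Sym m. f v * (h (inv' v \<circ> u) * k (inv' u \<circ> g)))
          = f v * (\<Sum>u\<in>Sym m. h (inv' v \<circ> u) * k (inv' u \<circ> g))"
        by (simp add: sum_distrib_left)
      also have "(\<Sum>u\<in>Sym m. h (inv' v \<circ> u) * k (inv' u \<circ> g))
          = (\<Sum>u\<in>Sym m. h (inv' v \<circ> (v \<circ> u)) * k (inv' (v \<circ> u) \<circ> g))"
        by (rule sum_permutations_comp_left[OF v])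
      also have "\<dots> = (\<Sum>u\<in>Sym m. h u * k (inv' u \<circ> (inv' v \<circ> g)))"
        by (intro sum.cong refl) (auto simp: inv_comp_cancel[OF v] inv_comp_permutes[OF v] comp_assoc)
      finally show "(\<Sum>u\<in>Sym m. f v * (h (inv' v \<circ> u) * k (inv' u \<circ> g)))
          = f v * (\<Sum>u\<in>Sym m. h u * k (inv' u \<circ> (inv' v \<circ> g)))" .
    qed
    also have "\<dots> = convolve m f (convolve m h k) g"
    proof -
      have "inv' v \<circ> g \<in> Sym m" if "v \<in> Sym m" for v
        using permutes_compose[OF g permutes_inv[of v]] that by simp
      then show ?thesis unfolding convolve_apply[of _ _ _ g] convolve_apply[of _ h] using True by simp
    qed
    finally show ?thesis .
  qed (simp add: convolve_apply)
qed

lemma convolve_linear: "cfun_linear (\<lambda>f. convolve m f h)"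
  by (intro Modules.module_hom.intro Modules.module_hom_axioms.intro cfun.module_axioms)
    (auto simp: fun_eq_iff convolve_apply distrib_right sum.distrib sum_distrib_left mult.assoc)

lemma convolve_smult_right: "convolve m f (\<lambda>x. c * h x) = (\<lambda>x. c * convolve m f h x)"
  by (auto simp: fun_eq_iff convolve_apply sum_distrib_left mult_ac)

lemma left_mult_linear: "cfun_linear (left_mult w)"
  by (intro Modules.module_hom.intro Modules.module_hom_axioms.intro cfun.module_axioms)
    (auto simp: fun_eq_iff left_mult_def)

text \<open>Multiplication on the left commutes with convolution on the right, which makes the
  Specht module invariant under \<open>left_mult\<close>.\<close>

lemma left_mult_convolve:
  assumes w: "w permutes {1..m}"
  shows "left_mult w (convolve m f h) = convolve m (left_mult w f) h"
proof
  fix g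
  have iff: "inv' w \<circ> g \<in> Sym m \<longleftrightarrow> g \<in> Sym m"
    using permutes_compose[of "inv' w \<circ> g" "{1..m}" w] permutes_compose[of g "{1..m}" "inv' w"]
      permutes_inv[OF w] w by (auto simp: inv_comp_cancel[OF w])
  show "left_mult w (convolve m f h) g = convolve m (left_mult w f) h g"
  proof (cases "g \<in> Sym m")
    case True
    then have "left_mult w (convolve m f h) g = (\<Sum>u\<in>Sym m. f u * h (inv' u \<circ> (inv' w \<circ> g)))"
      using iff by (simp add: left_mult_def convolve_apply)
    also have "\<dots> = (\<Sum>u\<in>Sym m. f (inv' w \<circ> (w \<circ> u)) * h (inv' (w \<circ> u) \<circ> g))"
      by (intro sum.cong refl) (auto simp: inv_comp_cancel[OF w] inv_comp_permutes[OF w] comp_assoc)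
    also have "\<dots> = (\<Sum>u\<in>Sym m. f (inv' w \<circ> u) * h (inv' u \<circ> g))"
      by (rule sum_permutations_comp_left[OF w, symmetric])
    finally show ?thesis using True by (simp add: left_mult_def convolve_apply)
  next
    case False
    then show ?thesis using iff by (simp add: left_mult_def convolve_apply)
  qed
qed

lemma left_mult_comp:
  assumes "u permutes A" "v permutes A"
  shows "left_mult (u \<circ> v) f = left_mult u (left_mult v f)"
  by (simp add: left_mult_def inv_comp_permutes[OF assms] comp_assoc)

text \<open>Convolution reads \<open>f\<close> only on \<open>Sym m\<close>, so truncating
  \<open>f\<close> to the group algebra does not change the product. As the range of a linear map,
  the module is easier to handle.\<close>

lemma specht_module_eq:
  "specht_module mu = range (\<lambda>f. convolve (sum_list mu) f (young_symmetrizer mu))"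
proof -
  have "convolve (sum_list mu) f h \<in> (\<lambda>f. convolve (sum_list mu) f h) ` group_algebra (sum_list mu)" for f h
  proof (rule image_eqI)
    show "convolve (sum_list mu) f h
        = convolve (sum_list mu) (\<lambda>g. if g \<in> Sym (sum_list mu) then f g else 0) h"
      by (auto simp: fun_eq_iff convolve_apply intro!: sum.cong)
  qed (simp add: group_algebra_def carrier_sym_group)
  then show ?thesis unfolding specht_module_def by blast
qed

lemma specht_module_subspace: "cfun.subspace (specht_module mu)"
proof -
  have "specht_module mu = (\<lambda>f. convolve (sum_list mu) f (young_symmetrizer mu)) ` cfun.span UNIV"
    unfolding specht_module_eq by simp
  also have "cfun.subspace \<dots>"
    unfolding Modules.module_hom.span_image[OF convolve_linear, symmetric] by (rule cfun.subspace_span)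
  finally show ?thesis .
qed

lemma specht_module_zero: "v \<in> specht_module mu \<Longrightarrow> g \<notin> Sym (sum_list mu) \<Longrightarrow> v g = 0"
  unfolding specht_module_eq by (auto simp: convolve_apply)

lemma specht_module_span: "specht_module mu \<subseteq> cfun.span (delta ` Sym (sum_list mu))"
  using span_delta[OF finite_Sym specht_module_zero] by auto

lemmas specht_module_props =
  specht_module_subspace specht_module_span finite_imageI[OF finite_Sym]

lemma specht_module_left_mult:
  "w permutes {1..sum_list mu} \<Longrightarrow> v \<in> specht_module mu \<Longrightarrow> left_mult w v \<in> specht_module mu"
  unfolding specht_module_eq using left_mult_convolve by fastforce

lemma specht_rep_carrier: "specht_rep mu w \<in> carrier_mat (specht_dim mu) (specht_dim mu)"
  unfolding specht_rep_def specht_dim_def by (rule matrix_on_carrier[OF specht_module_props])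

lemma specht_rep_id: "specht_rep mu id = 1\<^sub>m (specht_dim mu)"
  unfolding specht_rep_def specht_dim_def
  by (rule matrix_on_id[OF specht_module_props]) (simp add: left_mult_def)

lemma specht_rep_mult:
  assumes "u permutes {1..sum_list mu}" "v permutes {1..sum_list mu}"
  shows "specht_rep mu (u \<circ> v) = specht_rep mu u * specht_rep mu v"
proof -
  have "left_mult (u \<circ> v) = (\<lambda>f. left_mult u (left_mult v f))"
    by (rule ext) (rule left_mult_comp[OF assms])
  then show ?thesis
    unfolding specht_rep_def
    using matrix_on_mult[OF specht_module_props left_mult_linear, where S = "left_mult v" and w1 = u]
      specht_module_left_mult[OF assms(1)] specht_module_left_mult[OF assms(2)] by simp
qed

lemma young_symmetrizer_int: "young_symmetrizer mu g \<in> \<int>"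
  unfolding young_symmetrizer_def by (intro Ints_sum) auto

text \<open>The product \<open>c * c\<close> inherits row invariance from its left factor and column
  sign-equivariance from its right factor. By \<open>young_symmetrizer_multiple\<close> these two
  properties determine it up to its value at \<open>id\<close>.\<close>

lemma young_symmetrizer_square:
  assumes mu: "is_partition mu"
  defines "c \<equiv> young_symmetrizer mu" and "m \<equiv> sum_list mu"
  shows "convolve m c c = (\<lambda>g. convolve m c c id * c g)"
proof
  fix g
  let ?F = "convolve m c c"
  show "?F g = ?F id * c g"
  proof (cases "g \<in> Sym m")
    case True
    then have g: "g permutes {1..m}" by simp
    have 1: "?F (p \<circ> g) = ?F g" if "p \<in> row_group mu" "g permutes {1..m}" for p g
    proof -
      have p: "p permutes {1..m}" using row_group_permutes that(1) unfolding m_def by blast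
      have pg: "p \<circ> g \<in> Sym m" using permutes_compose[OF that(2) p] by simp
      have "?F (p \<circ> g) = (\<Sum>u\<in>Sym m. c u * c (inv' u \<circ> (p \<circ> g)))"
        unfolding convolve_apply using pg by (simp only: if_True)
      also have "\<dots> = (\<Sum>u\<in>Sym m. c (p \<circ> u) * c (inv' (p \<circ> u) \<circ> (p \<circ> g)))"
        by (rule sum_permutations_comp_left[OF p])
      also have "\<dots> = (\<Sum>u\<in>Sym m. c u * c (inv' u \<circ> g))"
      proof (intro sum.cong refl)
        fix u assume "u \<in> Sym m"
        then have u: "u permutes {1..m}" by simp
        have "inv' (p \<circ> u) \<circ> (p \<circ> g) = inv' u \<circ> g"
          unfolding inv_comp_permutes[OF p u] comp_assoc inv_comp_cancel(1)[OF p] ..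
        then show "c (p \<circ> u) * c (inv' (p \<circ> u) \<circ> (p \<circ> g)) = c u * c (inv' u \<circ> g)"
          using young_symmetrizer_row[OF that(1)] unfolding c_def by simp
      qed
      finally show ?thesis using that(2) by (simp add: convolve_apply)
    qed
    have 2: "?F (g \<circ> q) = of_int (sign q) * ?F g" if "q \<in> col_group mu" "g permutes {1..m}" for q g
    proof -
      have q: "q permutes {1..m}" using col_group_permutes that(1) unfolding m_def by blast
      have gq: "g \<circ> q \<in> Sym m" using permutes_compose[OF q that(2)] by simp
      have "?F (g \<circ> q) = (\<Sum>u\<in>Sym m. c u * c ((inv' u \<circ> g) \<circ> q))"
        unfolding convolve_apply using gq by (simp only: if_True comp_assoc)
      also have "\<dots> = of_int (sign q) * (\<Sum>u\<in>Sym m. c u * c (inv' u \<circ> g))"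
        using young_symmetrizer_col[OF that(1)] unfolding c_def
        by (simp add: sum_distrib_left mult_ac)
      finally show ?thesis using that(2) by (simp add: convolve_apply)
    qed
    show ?thesis
      using young_symmetrizer_multiple[OF mu, of ?F g] 1 2 g unfolding c_def m_def by blast
  next
    case False
    then have "g \<noteq> p \<circ> q" if "p \<in> row_group mu" "q \<in> col_group mu" for p q
      using permutes_compose[OF col_group_permutes[OF that(2)] row_group_permutes[OF that(1)]]
      unfolding m_def by auto
    then have "c g = 0" unfolding c_def by (rule young_symmetrizer_eq_0)
    then show ?thesis using False by (simp add: convolve_apply)
  qed
qed

text \<open>Right multiplication by the Young symmetrizer has trace \<open>m!\<close>, maps the group algebra onto
  the Specht module and acts there as an integer scalar.\<close>

lemma specht_dim_dvd_fact:
  assumes mu: "is_partition mu"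
  shows "specht_dim mu dvd fact (sum_list mu)"
proof -
  define m c where "m = sum_list mu" and "c = young_symmetrizer mu"
  define \<kappa> where "\<kappa> = convolve m c c id"
  \<comment> \<open>Integrality of this scalar turns the trace identity
    \<open>m! = kappa * dim\<close> into a divisibility.\<close>
  have "\<kappa> \<in> \<int>"
    unfolding \<kappa>_def convolve_apply c_def by (auto intro!: Ints_sum Ints_mult young_symmetrizer_int)
  then obtain k where k: "\<kappa> = of_int k" by (auto elim: Ints_cases)
  have "(\<Sum>g\<in>Sym m. convolve m (delta g) c g) = \<kappa> * of_nat (cfun.dim (specht_module mu))"
  proof (rule trace_of_quasi_projection[OF finite_Sym specht_module_subspace])
    show "v x = 0" if "v \<in> specht_module mu" "x \<notin> Sym m" for v x
      using specht_module_zero that unfolding m_def by blast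
    show "cfun_linear (\<lambda>f. convolve m f c)" by (rule convolve_linear)
    show "convolve m (delta x) c \<in> specht_module mu" for x
      unfolding specht_module_eq m_def c_def by (rule rangeI)
    show "convolve m v c = (\<lambda>x. \<kappa> * v x)" if v: "v \<in> specht_module mu" for v
    proof -
      obtain f where f: "v = convolve m f c" using v unfolding specht_module_eq m_def c_def by blast
      have "convolve m v c = convolve m f (convolve m c c)" unfolding f by (rule convolve_assoc)
      also have "convolve m c c = (\<lambda>g. \<kappa> * c g)"
        unfolding \<kappa>_def m_def c_def by (rule young_symmetrizer_square[OF mu])
      finally show ?thesis unfolding f convolve_smult_right .
    qed
  qed
  \<comment> \<open>The diagonal entry at \<open>g\<close> is the coefficient of \<open>c\<close> at
    \<open>id\<close>, which is 1; summing over the group gives the trace \<open>m!\<close>.\<close>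
  moreover have "convolve m (delta g) c g = 1" if "g \<in> Sym m" for g
  proof -
    have g: "g permutes {1..m}" using that by simp
    have "convolve m (delta g) c g = (\<Sum>u\<in>Sym m. if u = g then c (inv' u \<circ> g) else 0)"
      unfolding convolve_apply using that by (auto simp: delta_def intro!: sum.cong)
    also have "\<dots> = c (inv' g \<circ> g)" using sum.delta[OF finite_Sym[of m], of g] that by simp
    also have "\<dots> = c id" by (simp only: permutes_inv_o(2)[OF g])
    also have "\<dots> = 1" using young_symmetrizer_mult[of id mu id] unfolding c_def by simp
    finally show ?thesis .
  qed
  ultimately have "of_nat (card (Sym m)) = \<kappa> * of_nat (specht_dim mu)"
    unfolding specht_dim_def by simp
  then have "(of_int (int (fact m)) :: complex) = of_int (k * int (specht_dim mu))"
    using card_permutations[of "{1..m}" m] k by simp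
  then have "int (fact m) = k * int (specht_dim mu)" by (simp only: of_int_eq_iff)
  then have "int (specht_dim mu) dvd int (fact m)" by simp
  then show ?thesis unfolding m_def by (simp only: int_dvd_int_iff)
qed

lemma specht_char_conj:
  assumes u: "u permutes {1..sum_list mu}" and v: "v permutes {1..sum_list mu}"
  shows "specht_char mu (v \<circ> u \<circ> inv' v) = specht_char mu u"
proof -
  have iv: "inv' v permutes {1..sum_list mu}" by (rule permutes_inv[OF v])
  have "specht_char mu (v \<circ> u \<circ> inv' v) = mat_trace ((specht_rep mu v * specht_rep mu u) * specht_rep mu (inv' v))"
    unfolding specht_char_def specht_rep_mult[OF permutes_compose[OF u v] iv] specht_rep_mult[OF v u] ..
  also have "\<dots> = mat_trace (specht_rep mu (inv' v) * (specht_rep mu v * specht_rep mu u))"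
    by (rule mat_trace_mult_comm) (rule mult_carrier_mat specht_rep_carrier)+
  also have "specht_rep mu (inv' v) * (specht_rep mu v * specht_rep mu u)
      = specht_rep mu (inv' v \<circ> (v \<circ> u))"
    unfolding specht_rep_mult[OF iv permutes_compose[OF u v]] specht_rep_mult[OF v u] ..
  also have "inv' v \<circ> (v \<circ> u) = u" by (rule inv_comp_cancel[OF v])
  finally show ?thesis unfolding specht_char_def .
qed

lemma permutes_two_points:
  assumes "a \<in> A" "b \<in> A" "a \<noteq> b" "i \<in> A" "j \<in> A" "i \<noteq> j"
  obtains v where "v permutes A" "v a = i" "v b = j"
proof -
  let ?t = Transposition.transpose
  \<comment> \<open>The right factor acts first. It fixes \<open>a\<close>, because
    \<open>i \<noteq> j\<close> keeps its second point away from \<open>a\<close>, and it sends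
    \<open>b\<close> to the point that the left factor moves to \<open>j\<close>.\<close>
  define v where "v = ?t a i \<circ> ?t b (?t a i j)"
  have c: "?t a i j \<in> A" "?t a i j \<noteq> a" using assms by (auto simp: Transposition.transpose_def)
  have "v permutes A"
    unfolding v_def using assms c by (intro permutes_compose permutes_swap_id)
  moreover have "v a = i" "v b = j" using c(2) assms(3) by (auto simp: v_def)
  ultimately show thesis by (rule that)
qed

text \<open>All transpositions are conjugate, so the value at \<open>(1 2)\<close> in
  \<open>g_num\<close> can be used for a transposition of any two points of a block.\<close>

lemma specht_char_transpose:
  assumes "a \<in> {1..sum_list mu}" "b \<in> {1..sum_list mu}" "a \<noteq> b"
  shows "specht_char mu (Transposition.transpose a b) = specht_char mu (Transposition.transpose 1 2)"
proof -
  let ?A = "{1..sum_list mu}" and ?t = Transposition.transpose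
  have A: "1 \<in> ?A" "2 \<in> ?A" using assms by auto
  obtain v where v: "v permutes ?A" and v12: "v 1 = a" "v 2 = b"
    using permutes_two_points[OF A _ assms] by auto
  have "v \<circ> ?t 1 2 \<circ> inv' v = ?t a b"
  proof
    fix x
    have "v (?t 1 2 y) = ?t (v 1) (v 2) (v y)" for y
      using permutes_inj[OF v] by (auto simp: Transposition.transpose_def inj_eq)
    from this[of "inv' v x"] show "(v \<circ> ?t 1 2 \<circ> inv' v) x = ?t a b x"
      using permutes_inverses(1)[OF v] v12 by simp
  qed
  with specht_char_conj[OF permutes_swap_id[OF A] v] show ?thesis by simp
qed

section \<open>Induced representations\<close>

locale induction_data = group G for G (structure) +
  fixes H :: "'a set" and R :: "'a \<Rightarrow> complex mat" and d :: nat
  assumes fin: "finite (carrier G)" and sub: "subgroup H G"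
    and R_carrier: "h \<in> H \<Longrightarrow> R h \<in> carrier_mat d d"
    and R_mult: "h \<in> H \<Longrightarrow> h' \<in> H \<Longrightarrow> R (h \<otimes> h') = R h * R h'"
    and R_one: "R \<one> = 1\<^sub>m d"
begin

lemma H_carrier: "h \<in> H \<Longrightarrow> h \<in> carrier G"
  using subgroup.subset[OF sub] by blast

lemmas H_closed = subgroup.m_closed[OF sub] subgroup.m_inv_closed[OF sub] subgroup.one_closed[OF sub]

lemma cancel:
  "a \<in> carrier G \<Longrightarrow> g \<in> carrier G \<Longrightarrow> a \<otimes> (inv a \<otimes> g) = g"
  "a \<in> carrier G \<Longrightarrow> g \<in> carrier G \<Longrightarrow> inv a \<otimes> (a \<otimes> g) = g"
  by (simp_all add: m_assoc[symmetric])

lemma mem_l_coset_iff: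
  assumes "t \<in> carrier G" "g \<in> carrier G"
  shows "g \<in> t <# H \<longleftrightarrow> inv t \<otimes> g \<in> H"
proof
  assume "g \<in> t <# H"
  then obtain h where h: "h \<in> H" "g = t \<otimes> h" unfolding l_coset_def by blast
  then show "inv t \<otimes> g \<in> H" using assms H_carrier by (simp add: m_assoc[symmetric])
next
  assume h: "inv t \<otimes> g \<in> H"
  have "g = t \<otimes> (inv t \<otimes> g)" using assms by (simp add: m_assoc[symmetric])
  with h show "g \<in> t <# H" unfolding l_coset_def by blast
qed

lemma coset_rel_trans:
  assumes "a \<in> carrier G" "b \<in> carrier G" "c \<in> carrier G" "inv a \<otimes> b \<in> H" "inv b \<otimes> c \<in> H"
  shows "inv a \<otimes> c \<in> H"
proof -
  have "(inv a \<otimes> b) \<otimes> (inv b \<otimes> c) = inv a \<otimes> c"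
    using assms by (simp add: m_assoc cancel)
  then show ?thesis using H_closed(1)[OF assms(4,5)] by simp
qed

lemma coset_rel_sym:
  assumes "a \<in> carrier G" "b \<in> carrier G" "inv a \<otimes> b \<in> H"
  shows "inv b \<otimes> a \<in> H"
  using H_closed(2)[OF assms(3)] assms(1,2) by (simp add: inv_mult_group)

lemma left_transversal_exists: "\<exists>ts. left_transversal G H ts"
proof -
  \<comment> \<open>The predicate inside the choice depends on the coset of \<open>g\<close> alone,
    so \<open>r\<close> is constant on left cosets and its image is a transversal.\<close>
  define r where "r g = (SOME t. t \<in> carrier G \<and> inv t \<otimes> g \<in> H)" for g
  have r: "r g \<in> carrier G" "inv (r g) \<otimes> g \<in> H" if "g \<in> carrier G" for g
  proof -
    have "\<exists>t. t \<in> carrier G \<and> inv t \<otimes> g \<in> H"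
      by (rule exI[of _ g]) (use that H_closed(3) in simp)
    from someI_ex[OF this] show "r g \<in> carrier G" "inv (r g) \<otimes> g \<in> H" unfolding r_def by auto
  qed
  have r_eq: "r g = r g'" if "g \<in> carrier G" "g' \<in> carrier G" "inv g \<otimes> g' \<in> H" for g g'
  proof -
    have "t \<in> carrier G \<and> inv t \<otimes> g \<in> H \<longleftrightarrow> t \<in> carrier G \<and> inv t \<otimes> g' \<in> H" for t
      using coset_rel_trans[OF _ that(1,2) _ that(3), of t]
        coset_rel_trans[OF _ that(2,1) _ coset_rel_sym[OF that], of t] by iprover
    then show ?thesis unfolding r_def by (simp only:)
  qed
  obtain ts where ts: "set ts = r ` carrier G" "distinct ts"
    using finite_distinct_list[of "r ` carrier G"] fin by auto
  have "left_transversal G H ts"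
    unfolding left_transversal_def
  proof (intro conjI ballI)
    show "distinct ts" "set ts \<subseteq> carrier G" using ts r(1) by auto
    fix g assume g: "g \<in> carrier G"
    show "\<exists>!t. t \<in> set ts \<and> g \<in> t <# H"
    proof (rule ex1I[of _ "r g"])
      show "r g \<in> set ts \<and> g \<in> r g <# H" using g r[OF g] ts by (simp add: mem_l_coset_iff)
      fix t assume t: "t \<in> set ts \<and> g \<in> t <# H"
      then obtain g' where g': "g' \<in> carrier G" "t = r g'" using ts by auto
      then have "inv t \<otimes> g \<in> H" using t mem_l_coset_iff[OF r(1)[OF g'(1)] g] by simp
      moreover have "inv g' \<otimes> t \<in> H" using coset_rel_sym[OF r(1)[OF g'(1)] g'(1) r(2)[OF g'(1)]] g' by simp
      ultimately have "inv g' \<otimes> g \<in> H" using coset_rel_trans[of g' t g] g g' r(1) by simp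
      then show "t = r g" using r_eq[OF g'(1) g] g'(2) by simp
    qed
  qed
  then show ?thesis ..
qed

definition ts :: "'a list" where
  "ts = (SOME ts. left_transversal G H ts)"

lemma left_transversal_ts: "left_transversal G H ts"
  unfolding ts_def using left_transversal_exists by (rule someI_ex)

lemma ts_distinct: "distinct ts" and ts_carrier: "t \<in> set ts \<Longrightarrow> t \<in> carrier G"
  using left_transversal_ts unfolding left_transversal_def by auto

lemma ts_unique_ex: "g \<in> carrier G \<Longrightarrow> \<exists>!t. t \<in> set ts \<and> inv t \<otimes> g \<in> H"
proof -
  assume g: "g \<in> carrier G"
  then have "\<exists>!t. t \<in> set ts \<and> g \<in> t <# H"
    using left_transversal_ts unfolding left_transversal_def by blast
  moreover have "t \<in> set ts \<and> g \<in> t <# H \<longleftrightarrow> t \<in> set ts \<and> inv t \<otimes> g \<in> H" for t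
    using mem_l_coset_iff[OF ts_carrier g] by blast
  ultimately show ?thesis by simp
qed

text \<open>The representatives \<open>ts\<close> are an unspecified choice. A function constant on
  left cosets can nevertheless be summed over them, by summing over the whole group, where each
  coset appears \<open>card H\<close> times.\<close>

lemma transversal_sum:
  fixes \<phi> :: "'a \<Rightarrow> 'c::semiring_1"
  assumes "\<And>g h. g \<in> carrier G \<Longrightarrow> h \<in> H \<Longrightarrow> \<phi> (g \<otimes> h) = \<phi> g"
  shows "of_nat (card H) * (\<Sum>t\<in>set ts. \<phi> t) = (\<Sum>g\<in>carrier G. \<phi> g)"
proof -
  define rep where "rep g = (THE t. t \<in> set ts \<and> inv t \<otimes> g \<in> H)" for g
  have rep: "rep g \<in> set ts" "inv (rep g) \<otimes> g \<in> H" if "g \<in> carrier G" for g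
    using theI'[OF ts_unique_ex[OF that]] unfolding rep_def by auto
  have rep_eq: "rep g = t" if "g \<in> carrier G" "t \<in> set ts" "inv t \<otimes> g \<in> H" for g t
    unfolding rep_def by (rule the1_equality[OF ts_unique_ex[OF that(1)]]) (use that in blast)
  have "(\<Sum>g\<in>carrier G. \<phi> g) = (\<Sum>(t, h)\<in>set ts \<times> H. \<phi> t)"
  proof (rule sum.reindex_bij_witness[where i = "\<lambda>(t, h). t \<otimes> h" and j = "\<lambda>g. (rep g, inv (rep g) \<otimes> g)"])
    fix g assume g: "g \<in> carrier G"
    note rc = ts_carrier[OF rep(1)[OF g]]
    have e: "rep g \<otimes> (inv (rep g) \<otimes> g) = g" using g rc by (simp add: m_assoc[symmetric])
    show "(case (rep g, inv (rep g) \<otimes> g) of (t, h) \<Rightarrow> t \<otimes> h) = g" using e by simp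
    show "(rep g, inv (rep g) \<otimes> g) \<in> set ts \<times> H" using rep[OF g] by simp
    show "(case (rep g, inv (rep g) \<otimes> g) of (t, h) \<Rightarrow> \<phi> t) = \<phi> g"
      using assms[OF rc rep(2)[OF g]] e by simp
  next
    fix b assume "b \<in> set ts \<times> H"
    then obtain t h where b: "b = (t, h)" "t \<in> set ts" "h \<in> H" by blast
    note tc = ts_carrier[OF b(2)] and hc = H_carrier[OF b(3)]
    have e: "inv t \<otimes> (t \<otimes> h) = h" using tc hc by (simp add: m_assoc[symmetric])
    have "rep (t \<otimes> h) = t" by (rule rep_eq) (use e tc hc b in auto)
    then show "(rep (case b of (t, h) \<Rightarrow> t \<otimes> h), inv (rep (case b of (t, h) \<Rightarrow> t \<otimes> h)) \<otimes> (case b of (t, h) \<Rightarrow> t \<otimes> h)) = b"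
      using b e by simp
    show "(case b of (t, h) \<Rightarrow> t \<otimes> h) \<in> carrier G" using b tc hc by simp
  qed
  also have "\<dots> = of_nat (card H) * (\<Sum>t\<in>set ts. \<phi> t)"
    by (simp add: sum.cartesian_product[symmetric] sum_distrib_left)
  finally show ?thesis by simp
qed

abbreviation rho_ind :: "'a \<Rightarrow> complex mat" where
  "rho_ind \<equiv> induced_rep G H R"

definition conj_block :: "nat \<Rightarrow> 'a \<Rightarrow> nat \<Rightarrow> 'a" where
  "conj_block p g q = inv (ts ! p) \<otimes> g \<otimes> (ts ! q)"

lemma rho_ind_eq: "rho_ind g = mat (length ts * d) (length ts * d) (\<lambda>(i, j).
    if conj_block (i div d) g (j div d) \<in> H then R (conj_block (i div d) g (j div d)) $$ (i mod d, j mod d) else 0)"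
  unfolding induced_rep_def Let_def ts_def[symmetric] R_one conj_block_def index_one_mat ..

lemma rho_ind_carrier: "rho_ind g \<in> carrier_mat (length ts * d) (length ts * d)"
  unfolding rho_ind_eq by simp

lemma ts_nth_carrier: "p < length ts \<Longrightarrow> ts ! p \<in> carrier G"
  using ts_carrier by simp

text \<open>In block column \<open>q\<close> of \<open>rho_ind g'\<close> exactly one block is
  nonzero, at the index \<open>s\<close> of the coset of \<open>g' \<otimes> ts ! q\<close>. The sum
  over blocks collapses to this \<open>s\<close>, where multiplicativity of \<open>R\<close> on
  \<open>H\<close> applies.\<close>

lemma rho_ind_mult:
  assumes g: "g \<in> carrier G" "g' \<in> carrier G"
  shows "rho_ind (g \<otimes> g') = rho_ind g * rho_ind g'"
proof (rule eq_matI)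
  show "dim_row (rho_ind (g \<otimes> g')) = dim_row (rho_ind g * rho_ind g')"
    "dim_col (rho_ind (g \<otimes> g')) = dim_col (rho_ind g * rho_ind g')"
    by (simp_all add: rho_ind_eq)
  fix i j assume "i < dim_row (rho_ind g * rho_ind g')" "j < dim_col (rho_ind g * rho_ind g')"
  then have ij: "i < length ts * d" "j < length ts * d" by (simp_all add: rho_ind_eq)
  define p e q f where "p = i div d" and "e = i mod d" and "q = j div d" and "f = j mod d"
  have b: "p < length ts" "e < d" "q < length ts" "f < d"
    unfolding p_def e_def q_def f_def using div_mod_bounds[OF ij(1)] div_mod_bounds[OF ij(2)] by auto
  let ?c = conj_block
  define summand where "summand = (\<lambda>k l. (if ?c p g k \<in> H then R (?c p g k) $$ (e, l) else 0) *
      (if ?c k g' q \<in> H then R (?c k g' q) $$ (l, f) else 0))"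
  have "g' \<otimes> ts ! q \<in> carrier G" using g b ts_nth_carrier by simp
  from ts_unique_ex[OF this] obtain t where t: "t \<in> set ts" "inv t \<otimes> (g' \<otimes> ts ! q) \<in> H"
    and tu: "\<And>t'. t' \<in> set ts \<Longrightarrow> inv t' \<otimes> (g' \<otimes> ts ! q) \<in> H \<Longrightarrow> t' = t" by blast
  from t(1) obtain s where s: "s < length ts" "t = ts ! s" by (auto simp: in_set_conv_nth)
  have cq: "?c k g' q = inv (ts ! k) \<otimes> (g' \<otimes> ts ! q)" if "k < length ts" for k
    unfolding conj_block_def using g b that ts_nth_carrier by (simp add: m_assoc)
  have sH: "?c s g' q \<in> H" using t cq s by simp
  have notH: "?c k g' q \<notin> H" if "k < length ts" "k \<noteq> s" for k
    using tu[of "ts ! k"] cq[OF that(1)] that s ts_distinct by (auto simp: nth_eq_iff_index_eq)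
  have comp: "?c p (g \<otimes> g') q = ?c p g s \<otimes> ?c s g' q"
  proof -
    have "ts ! s \<otimes> (inv (ts ! s) \<otimes> (g' \<otimes> ts ! q)) = g' \<otimes> ts ! q"
      using s b g ts_nth_carrier by (simp add: m_assoc[symmetric])
    then show ?thesis
      unfolding conj_block_def using s b g ts_nth_carrier by (simp add: m_assoc)
  qed
  have iffH: "?c p (g \<otimes> g') q \<in> H \<longleftrightarrow> ?c p g s \<in> H"
  proof
    have c: "?c p g s \<in> carrier G" "?c s g' q \<in> carrier G"
      unfolding conj_block_def using s b g ts_nth_carrier by simp_all
    assume "?c p (g \<otimes> g') q \<in> H"
    then have "(?c p g s \<otimes> ?c s g' q) \<otimes> inv (?c s g' q) \<in> H"
      using comp sH H_closed by simp
    then show "?c p g s \<in> H" using c by (simp add: m_assoc)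
  next
    assume "?c p g s \<in> H" then show "?c p (g \<otimes> g') q \<in> H" using comp sH H_closed by simp
  qed
  have "(rho_ind g * rho_ind g') $$ (i, j)
     = (\<Sum>m<length ts * d. summand (m div d) (m mod d))"
    unfolding mat_mult_index[OF rho_ind_carrier rho_ind_carrier ij]
    unfolding summand_def p_def e_def q_def f_def
    by (rule sum.cong[OF refl]) (simp add: rho_ind_eq ij)
  also have "\<dots> = (\<Sum>k<length ts. \<Sum>l<d. summand k l)" by (rule sum.div_mod)
  also have "\<dots> = (\<Sum>k<length ts. if k = s then \<Sum>l<d. summand s l else 0)"
    unfolding summand_def using notH by (intro sum.cong refl) auto
  also have "\<dots> = (\<Sum>l<d. summand s l)" using s by simp
  also have "\<dots> = rho_ind (g \<otimes> g') $$ (i, j)"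
  proof (cases "?c p g s \<in> H")
    case True
    have "(\<Sum>l<d. summand s l) = (\<Sum>l<d. R (?c p g s) $$ (e, l) * R (?c s g' q) $$ (l, f))"
      unfolding summand_def using True sH by simp
    also have "\<dots> = (R (?c p g s) * R (?c s g' q)) $$ (e, f)"
      by (rule mat_mult_index[symmetric, OF R_carrier[OF True] R_carrier[OF sH] b(2,4)])
    also have "\<dots> = R (?c p (g \<otimes> g') q) $$ (e, f)" unfolding comp R_mult[OF True sH] ..
    finally show ?thesis using True iffH ij
      by (simp add: rho_ind_eq p_def[symmetric] q_def[symmetric] e_def[symmetric] f_def[symmetric])
  next
    case False
    then show ?thesis unfolding summand_def using iffH ij
      by (simp add: rho_ind_eq p_def[symmetric] q_def[symmetric])
  qed
  finally show "rho_ind (g \<otimes> g') $$ (i, j) = (rho_ind g * rho_ind g') $$ (i, j)" by simp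
qed

lemma ts_rel_iff:
  assumes "p < length ts" "q < length ts"
  shows "inv (ts ! p) \<otimes> ts ! q \<in> H \<longleftrightarrow> p = q"
proof
  assume "inv (ts ! p) \<otimes> ts ! q \<in> H"
  moreover have "inv (ts ! q) \<otimes> ts ! q \<in> H" using assms ts_nth_carrier H_closed by simp
  ultimately have "ts ! p = ts ! q"
    using ts_unique_ex[OF ts_nth_carrier[OF assms(2)]] assms nth_mem by blast
  then show "p = q" using ts_distinct assms by (simp add: nth_eq_iff_index_eq)
qed (use assms ts_nth_carrier H_closed in simp)

text \<open>Frobenius formula for the induced character: only diagonal blocks with
  \<open>conj_block p g p\<close> in \<open>H\<close> contribute.\<close>

lemma rho_ind_trace:
  "mat_trace (rho_ind g) = (\<Sum>t\<in>set ts. if inv t \<otimes> g \<otimes> t \<in> H then mat_trace (R (inv t \<otimes> g \<otimes> t)) else 0)"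
proof -
  have "mat_trace (rho_ind g) = (\<Sum>m<length ts * d. if conj_block (m div d) g (m div d) \<in> H
      then R (conj_block (m div d) g (m div d)) $$ (m mod d, m mod d) else 0)"
    unfolding mat_trace_def rho_ind_eq by simp
  also have "\<dots> = (\<Sum>p<length ts. \<Sum>e<d. if conj_block p g p \<in> H
      then R (conj_block p g p) $$ (e, e) else 0)"
    by (rule sum.div_mod)
  also have "\<dots> = (\<Sum>p<length ts. if conj_block p g p \<in> H then mat_trace (R (conj_block p g p)) else 0)"
    using R_carrier by (intro sum.cong refl) (auto simp: mat_trace_def)
  also have "\<dots> = (\<Sum>t\<in>set ts. if inv t \<otimes> g \<otimes> t \<in> H then mat_trace (R (inv t \<otimes> g \<otimes> t)) else 0)"
    using sum.reindex_bij_betw[OF bij_betw_nth[OF ts_distinct refl refl],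
        of "\<lambda>t. if inv t \<otimes> g \<otimes> t \<in> H then mat_trace (R (inv t \<otimes> g \<otimes> t)) else 0"]
    unfolding conj_block_def .
  finally show ?thesis .
qed

text \<open>Passing from \<open>t\<close> to \<open>t \<otimes> h\<close> conjugates the argument of
  \<open>R\<close> by \<open>h\<close>, which a trace does not see. The summand of the Frobenius
  formula is therefore constant on left cosets, as \<open>transversal_sum\<close> requires.\<close>

lemma conj_trace_invariant:
  assumes g: "g \<in> carrier G" and t: "t \<in> carrier G" and h: "h \<in> H"
  defines "\<theta> \<equiv> \<lambda>t. if inv t \<otimes> g \<otimes> t \<in> H then mat_trace (R (inv t \<otimes> g \<otimes> t)) else 0"
  shows "\<theta> (t \<otimes> h) = \<theta> t"
proof -
  define u where "u = inv t \<otimes> g \<otimes> t"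
  note hc = H_carrier[OF h]
  have u: "u \<in> carrier G" unfolding u_def using g t by simp
  have e: "inv (t \<otimes> h) \<otimes> g \<otimes> (t \<otimes> h) = inv h \<otimes> u \<otimes> h"
    unfolding u_def using g t hc by (simp add: inv_mult_group m_assoc)
  have e': "h \<otimes> (inv h \<otimes> u \<otimes> h) \<otimes> inv h = u"
    using u hc by (simp add: m_assoc cancel)
  have iff: "inv h \<otimes> u \<otimes> h \<in> H \<longleftrightarrow> u \<in> H"
  proof
    assume "inv h \<otimes> u \<otimes> h \<in> H"
    from H_closed(1)[OF H_closed(1)[OF h this] H_closed(2)[OF h]] show "u \<in> H" unfolding e' .
  qed (intro H_closed h)
  have "mat_trace (R (inv h \<otimes> u \<otimes> h)) = mat_trace (R u)" if uH: "u \<in> H"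
  proof -
    have ih: "inv h \<in> H" using h by (rule H_closed)
    have "mat_trace (R (inv h \<otimes> u \<otimes> h)) = mat_trace (R (inv h \<otimes> u) * R h)"
      using R_mult[OF H_closed(1)[OF ih uH] h] by simp
    also have "\<dots> = mat_trace (R h * R (inv h \<otimes> u))"
      by (rule mat_trace_mult_comm) (rule R_carrier h H_closed(1)[OF ih uH])+
    also have "R h * R (inv h \<otimes> u) = R (h \<otimes> (inv h \<otimes> u))"
      using R_mult[OF h H_closed(1)[OF ih uH]] by simp
    also have "h \<otimes> (inv h \<otimes> u) = u" using hc u by (rule cancel)
    finally show ?thesis .
  qed
  then show ?thesis unfolding \<theta>_def e u_def[symmetric] iff by simp
qed

text \<open>If all conjugates of \<open>g\<close> lie in \<open>H\<close>, then
  \<open>conj_block p g q\<close> is an element of \<open>H\<close> times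
  \<open>inv (ts ! p) \<otimes> ts ! q\<close>, so the off-diagonal blocks vanish. With scalar
  blocks the whole matrix is diagonal. Translations are of this kind.\<close>

lemma rho_ind_det_scalar:
  assumes g: "g \<in> carrier G"
    and sc: "\<And>t. t \<in> set ts \<Longrightarrow> inv t \<otimes> g \<otimes> t \<in> H \<and> R (inv t \<otimes> g \<otimes> t) = c t \<cdot>\<^sub>m 1\<^sub>m d"
  shows "det (rho_ind g) = (\<Prod>t\<in>set ts. c t) ^ d"
proof -
  have iffH: "conj_block p g q \<in> H \<longleftrightarrow> p = q" if pq: "p < length ts" "q < length ts" for p q
  proof -
    have c: "conj_block p g p \<in> H" using sc[OF nth_mem[OF pq(1)]] unfolding conj_block_def by simp
    have "conj_block p g q = conj_block p g p \<otimes> (inv (ts ! p) \<otimes> ts ! q)"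
    proof -
      have "ts ! p \<otimes> (inv (ts ! p) \<otimes> ts ! q) = ts ! q"
        using pq ts_nth_carrier by (simp add: m_assoc[symmetric])
      then show ?thesis unfolding conj_block_def using pq g ts_nth_carrier by (simp add: m_assoc)
    qed
    then have "conj_block p g q \<in> H \<longleftrightarrow> inv (ts ! p) \<otimes> ts ! q \<in> H"
      using c H_closed subgroup.mem_carrier[OF sub] pq ts_nth_carrier
      by (metis (no_types, lifting) inv_closed inv_solve_left m_closed)
    then show ?thesis using ts_rel_iff[OF pq] by simp
  qed
  have entry: "rho_ind g $$ (i, j) = (if i = j then c (ts ! (i div d)) else 0)"
    if ij: "i < length ts * d" "j < length ts * d" for i j
  proof -
    note b = div_mod_bounds[OF ij(1)] div_mod_bounds[OF ij(2)]
    have eq: "i = j \<longleftrightarrow> i div d = j div d \<and> i mod d = j mod d" by (metis div_mult_mod_eq)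
    show ?thesis
      using sc[OF nth_mem[OF b(1)]] b ij eq iffH[OF b(1,3)]
      by (auto simp: rho_ind_eq conj_block_def)
  qed
  have "upper_triangular (rho_ind g)"
    using entry rho_ind_carrier[of g] by (intro upper_triangularI) auto
  from det_upper_triangular[OF this rho_ind_carrier]
  have "det (rho_ind g) = (\<Prod>i<length ts * d. rho_ind g $$ (i, i))"
    using rho_ind_carrier[of g] by (simp add: diag_mat_def prod.list_conv_set_nth atLeast0LessThan)
  also have "\<dots> = (\<Prod>i<length ts * d. c (ts ! (i div d)))"
    by (intro prod.cong refl) (simp add: entry)
  also have "\<dots> = (\<Prod>p<length ts. \<Prod>e<d. c (ts ! p))"
    by (rule prod.div_mod)
  also have "\<dots> = (\<Prod>p<length ts. c (ts ! p)) ^ d"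
    by (simp add: prod_power_distrib)
  also have "(\<Prod>p<length ts. c (ts ! p)) = (\<Prod>t\<in>set ts. c t)"
    by (rule prod.reindex_bij_betw[OF bij_betw_nth[OF ts_distinct refl refl]])
  finally show ?thesis .
qed

lemma rho_ind_one: "rho_ind \<one> = 1\<^sub>m (length ts * d)"
proof (rule eq_matI)
  fix i j assume "i < dim_row (1\<^sub>m (length ts * d))" "j < dim_col (1\<^sub>m (length ts * d))"
  then have ij: "i < length ts * d" "j < length ts * d" by auto
  note b = div_mod_bounds[OF ij(1)] div_mod_bounds[OF ij(2)]
  have c: "conj_block (i div d) \<one> (j div d) = inv (ts ! (i div d)) \<otimes> ts ! (j div d)"
    unfolding conj_block_def using b ts_nth_carrier by simp
  have eq: "i = j \<longleftrightarrow> i div d = j div d \<and> i mod d = j mod d" by (metis div_mult_mod_eq)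
  show "rho_ind \<one> $$ (i, j) = 1\<^sub>m (length ts * d) $$ (i, j)"
  proof (cases "i div d = j div d")
    case True
    then have "conj_block (i div d) \<one> (j div d) = \<one>" using c b ts_nth_carrier by simp
    then show ?thesis using ij b eq True R_one H_closed by (simp add: rho_ind_eq)
  next
    case False
    then show ?thesis using ij b eq c ts_rel_iff[OF b(1,3)] by (simp add: rho_ind_eq)
  qed
qed (simp_all add: rho_ind_eq)

end

section \<open>Sums over permutations\<close>

text \<open>By transitivity the sum is the same for every point of \<open>A\<close>. Adding it up
  over all points, each permutation contributes the full sum of \<open>\<phi>\<close>.\<close>

lemma sum_permutations_point:
  fixes \<phi> :: "'a \<Rightarrow> complex"
  assumes A: "finite A" and i: "i \<in> A"
  shows "of_nat (card A) * (\<Sum>w | w permutes A. \<phi> (inv' w i)) = fact (card A) * (\<Sum>j\<in>A. \<phi> j)"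
proof -
  have indep: "(\<Sum>w | w permutes A. \<phi> (inv' w j)) = (\<Sum>w | w permutes A. \<phi> (inv' w i))" if "j \<in> A" for j
  proof -
    let ?t = "Transposition.transpose i j"
    have t: "?t permutes A" using i that by (rule permutes_swap_id)
    have "(\<Sum>w | w permutes A. \<phi> (inv' w j)) = (\<Sum>w | w permutes A. \<phi> (inv' (?t \<circ> w) j))"
      by (rule sum_permutations_comp_left[OF t])
    also have "\<dots> = (\<Sum>w | w permutes A. \<phi> (inv' w i))"
      by (intro sum.cong refl) (simp add: inv_comp_permutes[OF t])
    finally show ?thesis .
  qed
  have "of_nat (card A) * (\<Sum>w | w permutes A. \<phi> (inv' w i)) = (\<Sum>j\<in>A. \<Sum>w | w permutes A. \<phi> (inv' w j))"
    by (simp add: indep)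
  also have "\<dots> = (\<Sum>w | w permutes A. \<Sum>j\<in>A. \<phi> (inv' w j))" by (rule sum.swap)
  also have "\<dots> = (\<Sum>w | w permutes A. \<Sum>j\<in>A. \<phi> j)"
  proof (rule sum.cong[OF refl])
    fix w assume "w \<in> {w. w permutes A}"
    then have "inv' w permutes A" by (simp add: permutes_inv)
    from sum.permute[OF this, of \<phi>] show "(\<Sum>j\<in>A. \<phi> (inv' w j)) = (\<Sum>j\<in>A. \<phi> j)" by simp
  qed
  also have "\<dots> = fact (card A) * (\<Sum>j\<in>A. \<phi> j)"
    using card_permutations[OF refl A] by simp
  finally show ?thesis .
qed

text \<open>The same averaging over ordered pairs of distinct points, now by double transitivity;
  this is where the factor \<open>n (n - 1)\<close> comes from.\<close>

lemma sum_permutations_pair: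
  fixes \<psi> :: "'a \<Rightarrow> 'a \<Rightarrow> complex"
  assumes A: "finite A" and ab: "a \<in> A" "b \<in> A" "a \<noteq> b"
  shows "of_nat (card A) * of_nat (card A - 1) * (\<Sum>w | w permutes A. \<psi> (inv' w a) (inv' w b))
    = fact (card A) * (\<Sum>i\<in>A. \<Sum>j\<in>A - {i}. \<psi> i j)"
proof -
  have indep: "(\<Sum>w | w permutes A. \<psi> (inv' w i) (inv' w j)) = (\<Sum>w | w permutes A. \<psi> (inv' w a) (inv' w b))"
    if ij: "i \<in> A" "j \<in> A" "i \<noteq> j" for i j
  proof -
    obtain v where v: "v permutes A" "v a = i" "v b = j"
      using permutes_two_points[OF ab ij] by blast
    have "inv' v i = a" "inv' v j = b" using v permutes_inverses(2)[OF v(1)] by auto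
    then have e: "inv' (v \<circ> w) i = inv' w a" "inv' (v \<circ> w) j = inv' w b" if "w permutes A" for w
      using inv_comp_permutes[OF v(1) that] by simp_all
    have "(\<Sum>w | w permutes A. \<psi> (inv' w i) (inv' w j))
        = (\<Sum>w | w permutes A. \<psi> (inv' (v \<circ> w) i) (inv' (v \<circ> w) j))"
      by (rule sum_permutations_comp_left[OF v(1)])
    also have "\<dots> = (\<Sum>w | w permutes A. \<psi> (inv' w a) (inv' w b))"
      by (intro sum.cong refl) (simp only: e mem_Collect_eq)
    finally show ?thesis .
  qed
  let ?S = "\<Sum>w | w permutes A. \<psi> (inv' w a) (inv' w b)"
  have "of_nat (card A) * of_nat (card A - 1) * ?S
      = (\<Sum>i\<in>A. \<Sum>j\<in>A - {i}. ?S)"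
    using A by (simp add: card_Diff_singleton)
  also have "\<dots> = (\<Sum>i\<in>A. \<Sum>j\<in>A - {i}. \<Sum>w | w permutes A. \<psi> (inv' w i) (inv' w j))"
    by (rule sum.cong[OF refl], rule sum.cong[OF refl], rule indep[symmetric]) auto
  also have "\<dots> = (\<Sum>i\<in>A. \<Sum>w | w permutes A. \<Sum>j\<in>A - {i}. \<psi> (inv' w i) (inv' w j))"
    by (intro sum.cong refl sum.swap)
  also have "\<dots> = (\<Sum>w | w permutes A. \<Sum>i\<in>A. \<Sum>j\<in>A - {i}. \<psi> (inv' w i) (inv' w j))"
    by (rule sum.swap)
  also have "\<dots> = (\<Sum>w | w permutes A. \<Sum>i\<in>A. \<Sum>j\<in>A - {i}. \<psi> i j)"
  proof (rule sum.cong[OF refl])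
    fix w assume "w \<in> {w. w permutes A}"
    then have w: "inv' w permutes A" by (simp add: permutes_inv)
    have "(\<Sum>j\<in>A - {i}. \<psi> (inv' w i) (inv' w j)) = (\<Sum>j\<in>A - {inv' w i}. \<psi> (inv' w i) j)" for i
    proof (rule sum.reindex_bij_betw)
      show "bij_betw (inv' w) (A - {i}) (A - {inv' w i})"
        by (rule bij_betw_subset[OF permutes_imp_bij[OF w]])
          (use permutes_inj[OF w] permutes_image[OF w] in \<open>auto simp: image_set_diff\<close>)
    qed
    then have "(\<Sum>i\<in>A. \<Sum>j\<in>A - {i}. \<psi> (inv' w i) (inv' w j))
        = (\<Sum>i\<in>A. (\<lambda>i. \<Sum>j\<in>A - {i}. \<psi> i j) (inv' w i))" by simp
    also have "\<dots> = (\<Sum>i\<in>A. \<Sum>j\<in>A - {i}. \<psi> i j)"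
      using sum.permute[OF w, of "\<lambda>i. \<Sum>j\<in>A - {i}. \<psi> i j"] by (simp add: o_def)
    finally show "(\<Sum>i\<in>A. \<Sum>j\<in>A - {i}. \<psi> (inv' w i) (inv' w j)) = (\<Sum>i\<in>A. \<Sum>j\<in>A - {i}. \<psi> i j)" .
  qed
  also have "\<dots> = fact (card A) * (\<Sum>i\<in>A. \<Sum>j\<in>A - {i}. \<psi> i j)"
    using card_permutations[OF refl A] by simp
  finally show ?thesis .
qed

text \<open>Induction on the set of values: a fibre-preserving permutation splits uniquely into an
  arbitrary permutation of the fibre over \<open>v\<close> and a fibre-preserving one of the rest.
  Letting \<open>V\<close> exceed the image admits empty fibres, with factor \<open>0! = 1\<close>,
  as blocks of size 0 require.\<close>

lemma card_fibre_permutations: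
  assumes "finite V" "finite A" "f ` A \<subseteq> V"
  shows "card {p. p permutes A \<and> (\<forall>i\<in>A. f (p i) = f i)} = (\<Prod>v\<in>V. fact (card {i \<in> A. f i = v}))"
  using assms
proof (induction V arbitrary: A rule: finite_induct)
  case empty
  then show ?case by (simp add: permutes_empty)
next
  case (insert v V)
  define B C where "B = {i \<in> A. f i = v}" and "C = {i \<in> A. f i \<noteq> v}"
  let ?P = "\<lambda>A. {p. p permutes A \<and> (\<forall>i\<in>A. f (p i) = f i)}"
  have A: "A = B \<union> C" "B \<inter> C = {}" unfolding B_def C_def by auto
  have fin: "finite B" "finite C" using insert.prems unfolding B_def C_def by auto
  have "bij_betw (\<lambda>(p, q). p \<circ> q) ({p. p permutes B} \<times> ?P C) (?P A)"
  proof (rule bij_betwI[where g = "\<lambda>p. (restrict_id p B, restrict_id p C)"])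
    show "(\<lambda>(p, q). p \<circ> q) \<in> {p. p permutes B} \<times> ?P C \<rightarrow> ?P A"
    proof safe
      fix p q assume p: "p permutes B" and q: "q permutes C" "\<forall>i\<in>C. f (q i) = f i"
      show "p \<circ> q permutes A"
        using permutes_compose[OF permutes_subset[OF q(1), of A] permutes_subset[OF p, of A]] A by auto
      fix i assume "i \<in> A"
      then consider "i \<in> B" | "i \<in> C" using A by blast
      then show "f ((p \<circ> q) i) = f i"
      proof cases
        case 1
        then have "q i = i" using q(1) A(2) by (auto intro: permutes_not_in)
        moreover have "p i \<in> B" using p 1 by (simp add: permutes_in_image)
        ultimately show ?thesis using 1 unfolding B_def by simp
      next
        case 2
        then have "q i \<in> C" using q(1) by (simp add: permutes_in_image)
        then have "p (q i) = q i" using p A(2) by (auto intro: permutes_not_in)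
        then show ?thesis using q(2) 2 by simp
      qed
    qed
    show "(\<lambda>p. (restrict_id p B, restrict_id p C)) \<in> ?P A \<rightarrow> {p. p permutes B} \<times> ?P C"
    proof safe
      fix p assume p: "p permutes A" "\<forall>i\<in>A. f (p i) = f i"
      have "p ` B \<subseteq> B" "p ` C \<subseteq> C"
        using p permutes_in_image[OF p(1)] unfolding B_def C_def by auto
      then have "p ` B = B" "p ` C = C"
        using fin permutes_inj_on[OF p(1)] endo_inj_surj by blast+
      then have bij: "bij_betw p B B" "bij_betw p C C"
        using permutes_inj_on[OF p(1)] by (auto simp: bij_betw_def)
      show "restrict_id p B permutes B" "restrict_id p C permutes C"
        using bij by (auto intro: permutes_restrict_id)
      fix i assume "i \<in> C"
      then show "f (restrict_id p C i) = f i" using p(2) A by (simp add: restrict_id_def)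
    qed
    show "(\<lambda>p. (restrict_id p B, restrict_id p C)) ((\<lambda>(p, q). p \<circ> q) x) = x"
      if xP: "x \<in> {p. p permutes B} \<times> ?P C" for x
    proof -
      obtain p q where x: "x = (p, q)" "p permutes B" "q permutes C" using xP by auto
      have "restrict_id (p \<circ> q) B = p"
        using x A(2) permutes_not_in[OF x(2)] permutes_not_in[OF x(3)] by (fastforce simp: restrict_id_def)
      moreover have "restrict_id (p \<circ> q) C = q"
        using A(2) permutes_not_in[OF x(2)] permutes_not_in[OF x(3)] permutes_in_image[OF x(3)]
        by (fastforce simp: restrict_id_def)
      ultimately show ?thesis using x by simp
    qed
    show "(\<lambda>(p, q). p \<circ> q) ((\<lambda>p. (restrict_id p B, restrict_id p C)) p) = p" if "p \<in> ?P A" for p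
    proof -
      have p: "p permutes A" "\<And>i. i \<in> A \<Longrightarrow> f (p i) = f i" using that by auto
      show ?thesis
        using permutes_not_in[OF p(1)] permutes_in_image[OF p(1)] p(2)
        by (fastforce simp: restrict_id_def B_def C_def)
    qed
  qed
  from bij_betw_same_card[OF this]
  have "card (?P A) = fact (card B) * card (?P C)"
    using card_permutations[OF refl fin(1)] by (simp add: card_cartesian_product)
  also have "card (?P C) = (\<Prod>u\<in>V. fact (card {i \<in> C. f i = u}))"
    by (rule insert.IH) (use insert.prems fin in \<open>auto simp: C_def\<close>)
  also have "\<dots> = (\<Prod>u\<in>V. fact (card {i \<in> A. f i = u}))"
    using insert.hyps by (intro prod.cong refl arg_cong[of _ _ "\<lambda>S. fact (card S)"]) (auto simp: C_def)
  finally show ?case using insert.hyps unfolding B_def by simp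
qed

lemma card_row_group: "card (row_group b) = (\<Prod>k<length b. fact (b ! k))"
proof -
  have "card (row_group b) = (\<Prod>k<length b. fact (card {i \<in> {1..sum_list b}. row_of b i = k}))"
    unfolding row_group_eq by (rule card_fibre_permutations) (use row_of_bounds(1) in auto)
  also have "\<dots> = (\<Prod>k<length b. fact (b ! k))"
    by (intro prod.cong refl) (simp only: block_eq[symmetric] card_block lessThan_iff)
  finally show ?thesis .
qed

section \<open>The groups \<open>G(n,r)\<close>\<close>

lemma carrier_Gnr: "r > 0 \<Longrightarrow> carrier (Gnr n r) = ({1..n} \<rightarrow>\<^sub>E {0..<int r}) \<times> Sym n"
  by (simp add: Gnr_def Let_def carrier_integer_mod_group carrier_sym_group)

lemma mult_Gnr: "(x, w) \<otimes>\<^bsub>Gnr n r\<^esub> (y, v) = (\<lambda>i\<in>{1..n}. (x i + y (inv' w i)) mod int r, w \<circ> v)"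
  by (auto simp: Gnr_def Let_def sym_group_mult intro!: restrict_ext)

lemma one_Gnr: "\<one>\<^bsub>Gnr n r\<^esub> = (\<lambda>i\<in>{1..n}. 0, id)"
  by (simp add: Gnr_def Let_def sym_group_one)

lemma permutes_atLeastAtMost_mem: "w permutes {1..n} \<Longrightarrow> i \<in> {1..n} \<Longrightarrow> w i \<in> {1..n::nat}"
  by (simp only: permutes_in_image)

lemma group_Gnr:
  assumes r: "r > 0"
  shows "group (Gnr n r)"
proof (rule groupI)
  note [simp] = carrier_Gnr[OF r] mult_Gnr one_Gnr
  fix g assume "g \<in> carrier (Gnr n r)"
  then obtain x w where g: "g = (x, w)" "x \<in> {1..n} \<rightarrow>\<^sub>E {0..<int r}" "w permutes {1..n}" by auto
  have iw: "inv' w permutes {1..n}" using g(3) by (rule permutes_inv)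
  show "\<one>\<^bsub>Gnr n r\<^esub> \<otimes>\<^bsub>Gnr n r\<^esub> g = g"
    using g(2) unfolding g(1) by (auto simp: fun_eq_iff PiE_iff extensional_def)
  \<comment> \<open>The inverse of \<open>(x; w)\<close> has permutation \<open>inv' w\<close> and
    minus the vector \<open>x\<close> moved by \<open>inv' w\<close>, whose coordinate
    \<open>i\<close> is \<open>x (w i)\<close>.\<close>
  show "\<exists>h\<in>carrier (Gnr n r). h \<otimes>\<^bsub>Gnr n r\<^esub> g = \<one>\<^bsub>Gnr n r\<^esub>"
  proof (rule bexI[of _ "(\<lambda>i\<in>{1..n}. (- x (w i)) mod int r, inv' w)"])
    show "(\<lambda>i\<in>{1..n}. (- x (w i)) mod int r, inv' w) \<in> carrier (Gnr n r)"
      using iw r by auto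
    show "(\<lambda>i\<in>{1..n}. (- x (w i)) mod int r, inv' w) \<otimes>\<^bsub>Gnr n r\<^esub> g = \<one>\<^bsub>Gnr n r\<^esub>"
      unfolding g(1) mult_Gnr one_Gnr permutes_inv_inv[OF g(3)] permutes_inv_o(2)[OF g(3)]
      by (auto intro!: restrict_ext simp: mod_simps)
  qed
  fix g' assume "g' \<in> carrier (Gnr n r)"
  then obtain y v where g': "g' = (y, v)" "y \<in> {1..n} \<rightarrow>\<^sub>E {0..<int r}" "v permutes {1..n}" by auto
  show "g \<otimes>\<^bsub>Gnr n r\<^esub> g' \<in> carrier (Gnr n r)"
    using permutes_compose[OF g'(3) g(3)] r unfolding g(1) g'(1) by auto
  fix g'' assume "g'' \<in> carrier (Gnr n r)"
  then obtain z u where g'': "g'' = (z, u)" by (cases g'')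
  show "g \<otimes>\<^bsub>Gnr n r\<^esub> g' \<otimes>\<^bsub>Gnr n r\<^esub> g'' = g \<otimes>\<^bsub>Gnr n r\<^esub> (g' \<otimes>\<^bsub>Gnr n r\<^esub> g'')"
    unfolding g(1) g'(1) g'' mult_Gnr inv_comp_permutes[OF g(3) g'(3)]
    using permutes_atLeastAtMost_mem[OF iw]
    by (auto intro!: restrict_ext simp: mod_simps add.assoc comp_assoc simp del: atLeastAtMost_iff)
qed (auto simp: carrier_Gnr[OF r] one_Gnr r permutes_id)

lemma inv_Gnr:
  assumes r: "r > 0" and g: "(x, w) \<in> carrier (Gnr n r)"
  shows "inv\<^bsub>Gnr n r\<^esub> (x, w) = (\<lambda>i\<in>{1..n}. (- x (w i)) mod int r, inv' w)"
proof (rule group.inv_equality[OF group_Gnr[OF r]])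
  have w: "w permutes {1..n}" using g by (simp add: carrier_Gnr[OF r])
  show "(\<lambda>i\<in>{1..n}. (- x (w i)) mod int r, inv' w) \<otimes>\<^bsub>Gnr n r\<^esub> (x, w) = \<one>\<^bsub>Gnr n r\<^esub>"
    unfolding mult_Gnr one_Gnr permutes_inv_inv[OF w] permutes_inv_o(2)[OF w]
    by (auto intro!: restrict_ext simp: mod_simps)
  show "(\<lambda>i\<in>{1..n}. (- x (w i)) mod int r, inv' w) \<in> carrier (Gnr n r)"
    using permutes_inv[OF w] r by (auto simp: carrier_Gnr[OF r])
qed fact

text \<open>Preserving each block as a set is the same as preserving the block index
  \<open>row_of b\<close>. So the permutation part is the row group of \<open>b\<close>, and the
  results on row groups apply to compositions as well.\<close>

lemma young_subgroup_eq:
  assumes r: "r > 0"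
  shows "young_subgroup b r = ({1..sum_list b} \<rightarrow>\<^sub>E {0..<int r}) \<times> row_group b"
proof -
  have "(\<forall>k<length b. w ` block b k = block b k) \<longleftrightarrow> (\<forall>i\<in>{1..sum_list b}. row_of b (w i) = row_of b i)"
    if w: "w permutes {1..sum_list b}" for w
  proof (intro iffI ballI allI impI)
    fix i assume *: "\<forall>k<length b. w ` block b k = block b k" and i: "i \<in> {1..sum_list b}"
    define k where "k = row_of b i"
    have k: "k < length b" unfolding k_def by (rule row_of_bounds[OF i])
    have "i \<in> block b k" using row_of_eq_iff[OF i k] k_def by simp
    then have "w i \<in> block b k" using * k by blast
    then have "row_of b (w i) = k" using row_of_eq_iff[OF permutes_atLeastAtMost_mem[OF w i] k] by simp
    then show "row_of b (w i) = row_of b i" unfolding k_def .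
  next
    fix k assume *: "\<forall>i\<in>{1..sum_list b}. row_of b (w i) = row_of b i" and k: "k < length b"
    have "w ` block b k \<subseteq> block b k"
    proof
      fix j assume "j \<in> w ` block b k"
      then obtain i where i: "i \<in> block b k" "j = w i" by blast
      then have iA: "i \<in> {1..sum_list b}" using block_subset[OF k] by blast
      have "row_of b (w i) = k" using * iA row_of_eq_iff[OF iA k] i(1) by simp
      then show "j \<in> block b k" using row_of_eq_iff[OF permutes_atLeastAtMost_mem[OF w iA] k] i(2) by simp
    qed
    then show "w ` block b k = block b k"
      using permutes_inj_on[OF w] by (intro endo_inj_surj) (auto simp: block_def)
  qed
  then show ?thesis
    unfolding young_subgroup_def row_group_eq carrier_Gnr[OF r] by auto
qed

lemma young_subgroup_subgroup:
  assumes r: "r > 0"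
  shows "subgroup (young_subgroup b r) (Gnr (sum_list b) r)"
proof (rule group.subgroupI[OF group_Gnr[OF r]])
  let ?n = "sum_list b"
  show sub: "young_subgroup b r \<subseteq> carrier (Gnr ?n r)"
    unfolding young_subgroup_eq[OF r] carrier_Gnr[OF r] using row_group_permutes by auto
  have "(\<lambda>i\<in>{1..?n}. 0, id) \<in> young_subgroup b r" unfolding young_subgroup_eq[OF r] using r by auto
  then show "young_subgroup b r \<noteq> {}" by blast
  fix g assume g: "g \<in> young_subgroup b r"
  obtain x w where xw: "g = (x, w)" by (cases g)
  have w: "w \<in> row_group b" using g xw by (simp add: young_subgroup_eq[OF r])
  show "inv\<^bsub>Gnr ?n r\<^esub> g \<in> young_subgroup b r"
    using sub g r row_group_inv[OF w] unfolding xw by (subst inv_Gnr[OF r]) (auto simp: young_subgroup_eq[OF r])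
  fix g' assume g': "g' \<in> young_subgroup b r"
  obtain y v where yv: "g' = (y, v)" by (cases g')
  have v: "v \<in> row_group b" using g' yv by (simp add: young_subgroup_eq[OF r])
  show "g \<otimes>\<^bsub>Gnr ?n r\<^esub> g' \<in> young_subgroup b r"
    using row_group_comp[OF w v] r unfolding xw yv mult_Gnr by (auto simp: young_subgroup_eq[OF r])
qed

text \<open>The permutation part of \<open>block_component b k\<close>, kept apart because it does
  not depend on the translation.\<close>

definition block_perm :: "nat list \<Rightarrow> nat \<Rightarrow> (nat \<Rightarrow> nat) \<Rightarrow> nat \<Rightarrow> nat" where
  "block_perm b k w = (\<lambda>i. if i \<in> {1..b ! k} then w (offset b k + i) - offset b k else i)"

lemma row_group_block:
  assumes "w \<in> row_group b" "k < length b" "j \<in> block b k"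
  shows "w j \<in> block b k"
proof -
  have j: "j \<in> {1..sum_list b}" using assms block_subset by blast
  have "row_of b (w j) = k"
    using assms row_of_eq_iff[OF j assms(2)] j unfolding row_group_eq by auto
  then show ?thesis
    using row_of_eq_iff[OF permutes_atLeastAtMost_mem[OF row_group_permutes[OF assms(1)] j] assms(2)] by simp
qed

lemma block_perm_shift:
  assumes "w \<in> row_group b" "k < length b" "i \<in> {1..b ! k}"
  shows "block_perm b k w i \<in> {1..b ! k}" "offset b k + block_perm b k w i = w (offset b k + i)"
proof -
  have "offset b k + i \<in> block b k" using assms(3) by (simp add: block_def)
  then have w: "w (offset b k + i) \<in> block b k" by (rule row_group_block[OF assms(1,2)])
  have e: "block_perm b k w i = w (offset b k + i) - offset b k"
    unfolding block_perm_def using assms(3) by (simp only: if_True)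
  show "block_perm b k w i \<in> {1..b ! k}" "offset b k + block_perm b k w i = w (offset b k + i)"
    using w unfolding e block_def atLeastAtMost_iff by linarith+
qed

lemma block_perm_comp:
  assumes "w \<in> row_group b" "v \<in> row_group b" "k < length b"
  shows "block_perm b k (w \<circ> v) = block_perm b k w \<circ> block_perm b k v"
proof
  fix i
  show "block_perm b k (w \<circ> v) i = (block_perm b k w \<circ> block_perm b k v) i"
  proof (cases "i \<in> {1..b ! k}")
    case True
    then show ?thesis
      using block_perm_shift[OF assms(2,3) True] by (simp add: block_perm_def[of b k w] block_perm_def[of b k "w \<circ> v"])
  qed (simp add: block_perm_def del: atLeastAtMost_iff)
qed

lemma block_perm_permutes:
  assumes "w \<in> row_group b" "k < length b"
  shows "block_perm b k w permutes {1..b ! k}"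
proof -
  have "inj_on (block_perm b k w) {1..b ! k}"
  proof (rule inj_onI)
    fix i j assume ij: "i \<in> {1..b ! k}" "j \<in> {1..b ! k}" "block_perm b k w i = block_perm b k w j"
    have "w (offset b k + i) = w (offset b k + j)"
      unfolding block_perm_shift(2)[OF assms ij(1), symmetric] block_perm_shift(2)[OF assms ij(2), symmetric]
      by (simp only: ij(3))
    from injD[OF permutes_inj[OF row_group_permutes[OF assms(1)]] this] show "i = j" by simp
  qed
  moreover have "block_perm b k w ` {1..b ! k} \<subseteq> {1..b ! k}" using block_perm_shift(1)[OF assms] by blast
  ultimately have "bij_betw (block_perm b k w) {1..b ! k} {1..b ! k}"
    unfolding bij_betw_def by (simp add: endo_inj_surj)
  then show ?thesis by (rule bij_imp_permutes) (simp add: block_perm_def del: atLeastAtMost_iff)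
qed

lemma block_perm_id: "block_perm b k id = id"
  by (auto simp: block_perm_def)

lemma block_component_eq:
  "block_component b k (x, w) = (\<lambda>i\<in>{1..b ! k}. x (offset b k + i), block_perm b k w)"
  by (simp add: block_component_def block_perm_def)

lemma sum_block: "(\<Sum>i=1..b ! k. f (offset b k + i)) = (\<Sum>j\<in>block b k. f j)"
  unfolding block_def by (rule sum.reindex_bij_witness[where i = "\<lambda>j. j - offset b k" and j = "\<lambda>i. offset b k + i"]) auto

section \<open>The determinant of an irreducible representation\<close>

lemma powi_prod:
  fixes z :: complex
  assumes "z \<noteq> 0" "finite A"
  shows "(\<Prod>k\<in>A. z powi f k) = z powi (\<Sum>k\<in>A. f k)"
  using assms(2,1) by (induction A rule: finite_induct) (auto simp: power_int_add)

lemma powi_cong: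
  fixes z :: complex
  assumes "z ^ r = 1" "r > 0" "[a = c] (mod int r)"
  shows "z powi a = z powi c"
proof -
  have z: "z \<noteq> 0" using assms by (auto simp: power_0_left)
  obtain m where "a = c + int r * m" using assms(3) by (metis cong_iff_lin cong_sym)
  then have "z powi a = z powi c * (z powi int r) powi m"
    using z by (simp add: power_int_add power_int_mult)
  also have "z powi int r = 1" using assms by (simp add: power_int_of_nat)
  finally show ?thesis by simp
qed

lemma sum_blocks:
  "(\<Sum>k<length b. \<Sum>j\<in>block b k. h k j) = (\<Sum>j\<in>{1..sum_list b}. h (row_of b j) j)"
proof -
  have "(\<Sum>k<length b. \<Sum>j\<in>block b k. h k j)
      = (\<Sum>k<length b. \<Sum>j | j \<in> {1..sum_list b} \<and> row_of b j = k. h (row_of b j) j)"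
    by (intro sum.cong) (auto simp: block_eq)
  also have "\<dots> = (\<Sum>j\<in>{1..sum_list b}. h (row_of b j) j)"
    by (rule sum.group) (use row_of_bounds(1) in auto)
  finally show ?thesis .
qed

lemma prod_fact_dvd_fact: "prod_list (map fact bs) dvd (fact (sum_list bs) :: nat)"
proof (induction bs)
  case (Cons a bs)
  have "fact a * prod_list (map fact bs) dvd (fact a * fact (sum_list bs) :: nat)"
    using Cons by (intro mult_dvd_mono) auto
  also have "\<dots> dvd fact (a + sum_list bs)" by (rule fact_fact_dvd_fact)
  finally show ?case by simp
qed simp

lemma prod_list_nth: "prod_list (map f bs) = (\<Prod>k<length bs. f (bs ! k))"
  by (simp add: prod.list_conv_set_nth atLeast0LessThan)

text \<open>Multiplying by the factorials of \<open>b\<close> removes the exact division; what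
  remains is \<open>(N - j)!\<close>, for \<open>N\<close> the sum of \<open>b\<close>, times a
  falling factorial of \<open>b ! k\<close>. The case \<open>j = 1\<close> concerns the hypothesis
  on multinomials, \<open>j = 2\<close> the second sum in \<open>y\<close>.\<close>

lemma multinomial_minus:
  fixes b :: "nat list"
  assumes k: "k < length b" and j: "j \<le> sum_list b"
  shows "multinomial (sum_list b - j) ((map int b)[k := int (b ! k) - int j]) * (\<Prod>l<length b. fact (b ! l))
    = (if j \<le> b ! k then fact (sum_list b - j) * (fact (b ! k) div fact (b ! k - j)) else 0)"
proof (cases "j \<le> b ! k")
  case True
  define c where "c = b[k := b ! k - j]"
  have c: "(map int b)[k := int (b ! k) - int j] = map int c"
    unfolding c_def using True k by (simp add: map_update of_nat_diff)
  have sc: "sum_list c = sum_list b - j"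
    unfolding c_def using True k by (simp add: sum_list_update)
  have m: "multinomial (sum_list b - j) (map int c) = fact (sum_list c) div prod_list (map fact c)"
    unfolding multinomial_def sc by (auto simp: o_def)
  have p: "prod_list (map fact c) * (fact (b ! k) div fact (b ! k - j)) = (\<Prod>l<length b. fact (b ! l) :: nat)"
  proof -
    have "prod_list (map fact c) = (\<Prod>l<length b. fact (c ! l) :: nat)"
      unfolding prod_list_nth by (simp add: c_def)
    also have "\<dots> = fact (b ! k - j) * (\<Prod>l\<in>{..<length b} - {k}. fact (b ! l))"
      using k by (subst prod.remove[of _ k]) (auto simp: c_def)
    finally have "prod_list (map fact c) = fact (b ! k - j) * (\<Prod>l\<in>{..<length b} - {k}. fact (b ! l) :: nat)" .
    moreover have "fact (b ! k - j) * (fact (b ! k) div fact (b ! k - j)) = (fact (b ! k) :: nat)"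
      by (intro dvd_mult_div_cancel fact_dvd) simp
    moreover have "(\<Prod>l<length b. fact (b ! l) :: nat) = fact (b ! k) * (\<Prod>l\<in>{..<length b} - {k}. fact (b ! l))"
      using k by (intro prod.remove) auto
    moreover have "x * Q * D = (x * D) * Q" for x Q D :: nat by (simp only: ac_simps)
    ultimately show ?thesis by (simp only:)
  qed
  have "fact (sum_list c) div prod_list (map fact c) * prod_list (map fact c) = (fact (sum_list c) :: nat)"
    by (rule dvd_div_mult_self[OF prod_fact_dvd_fact])
  then show ?thesis
    unfolding c m p[symmetric] using True sc by (simp add: mult.assoc[symmetric])
next
  case False
  then have "int (b ! k) - int j \<in> set ((map int b)[k := int (b ! k) - int j])" "int (b ! k) - int j < 0"
    using k by (auto intro: set_update_memI)
  then show ?thesis using False unfolding multinomial_def by auto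
qed

locale wreath_rep =
  fixes r :: nat and \<zeta> :: complex and lam :: "nat list list"
  assumes r: "r > 0" and zeta: "\<zeta> ^ r = 1" and len: "length lam = r"
begin

definition b :: "nat list" where "b = sizes lam"
definition n :: nat where "n = sum_list b"
definition f :: "nat \<Rightarrow> nat" where "f k = specht_dim (lam ! k)"
definition d :: nat where "d = prod_list (map f [0..<r])"
definition R :: "gelem \<Rightarrow> complex mat" where
  "R h = kronecker_list (map (\<lambda>k. twisted_rep \<zeta> (lam ! k) k (block_component b k h)) [0..<r])"

lemma length_b: "length b = r" by (simp add: b_def sizes_def len)

lemma b_nth: "k < r \<Longrightarrow> b ! k = sum_list (lam ! k)" by (simp add: b_def sizes_def len)

lemma zeta_nz: "\<zeta> \<noteq> 0" using zeta r by (auto simp: power_0_left)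

lemma d_eq: "d = (\<Prod>k<r. f k)"
  unfolding d_def by (simp add: prod_list_nth)

text \<open>The scalar by which the translation part acts on the \<open>k\<close>-th tensor
  factor.\<close>

definition coef :: "nat \<Rightarrow> (nat \<Rightarrow> int) \<Rightarrow> complex" where
  "coef k x = (\<zeta> powi (\<Sum>j\<in>block b k. x j)) ^ k"

lemma R_eq: "R (x, w) = kronecker_list (map (\<lambda>k. coef k x \<cdot>\<^sub>m specht_rep (lam ! k) (block_perm b k w)) [0..<r])"
  unfolding R_def
proof (intro arg_cong[of _ _ kronecker_list] map_cong refl)
  fix k assume "k \<in> set [0..<r]"
  then have k: "k < r" by simp
  have "(\<Sum>i=1..b ! k. (\<lambda>i\<in>{1..b ! k}. x (offset b k + i)) i) = (\<Sum>i=1..b ! k. x (offset b k + i))"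
    by (rule sum.cong) auto
  also have "\<dots> = (\<Sum>j\<in>block b k. x j)" by (rule sum_block)
  finally show "twisted_rep \<zeta> (lam ! k) k (block_component b k (x, w))
      = coef k x \<cdot>\<^sub>m specht_rep (lam ! k) (block_perm b k w)"
    unfolding twisted_rep_def block_component_eq zeta_char_def coef_def b_nth[OF k, symmetric] by simp
qed

lemma R_carrier: "R h \<in> carrier_mat d d"
  by (cases h) (auto simp: R_eq d_def f_def intro!: kronecker_list_carrier smult_carrier_mat specht_rep_carrier)

lemma block_sub: "k < r \<Longrightarrow> block b k \<subseteq> {1..n}"
  unfolding n_def using block_subset length_b by simp

lemma R_mult:
  assumes "h \<in> young_subgroup b r" "h' \<in> young_subgroup b r"
  shows "R (h \<otimes>\<^bsub>Gnr n r\<^esub> h') = R h * R h'"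
proof -
  obtain x w where h: "h = (x, w)" by (cases h)
  obtain y v where h': "h' = (y, v)" by (cases h')
  have w: "w \<in> row_group b" and v: "v \<in> row_group b"
    using assms unfolding h h' young_subgroup_eq[OF r] by auto
  have wp: "w permutes {1..n}" using row_group_permutes[OF w] unfolding n_def .
  let ?z = "\<lambda>i\<in>{1..n}. (x i + y (inv' w i)) mod int r"
  have step: "coef k ?z \<cdot>\<^sub>m specht_rep (lam ! k) (block_perm b k (w \<circ> v))
     = (coef k x \<cdot>\<^sub>m specht_rep (lam ! k) (block_perm b k w)) * (coef k y \<cdot>\<^sub>m specht_rep (lam ! k) (block_perm b k v))"
    if "k \<in> set [0..<r]" for k
  proof -
    have k: "k < r" "k < length b" using that length_b by auto
    \<comment> \<open>Since \<open>w\<close> maps the block to itself, moving the coordinates of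
      \<open>y\<close> by \<open>w\<close> does not change their sum over the block.\<close>
    have "(\<Sum>j\<in>block b k. y (inv' w j)) = (\<Sum>j\<in>block b k. y j)"
      by (rule sum.reindex_bij_witness[where i = w and j = "inv' w"])
        (use row_group_block[OF w k(2)] row_group_block[OF row_group_inv[OF w] k(2)] permutes_inverses[OF wp] in auto)
    moreover have "[(\<Sum>j\<in>block b k. ?z j) = (\<Sum>j\<in>block b k. x j + y (inv' w j))] (mod int r)"
      by (rule cong_sum) (use block_sub[OF k(1)] in \<open>auto simp: cong_def\<close>)
    ultimately have "\<zeta> powi (\<Sum>j\<in>block b k. ?z j) = \<zeta> powi ((\<Sum>j\<in>block b k. x j) + (\<Sum>j\<in>block b k. y j))"
      by (intro powi_cong[OF zeta r]) (simp add: sum.distrib)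
    then have c: "coef k ?z = coef k x * coef k y"
      unfolding coef_def using zeta_nz by (simp add: power_int_add power_mult_distrib)
    have "specht_rep (lam ! k) (block_perm b k (w \<circ> v))
        = specht_rep (lam ! k) (block_perm b k w) * specht_rep (lam ! k) (block_perm b k v)"
      unfolding block_perm_comp[OF w v k(2)]
      using block_perm_permutes[OF w k(2)] block_perm_permutes[OF v k(2)] b_nth[OF k(1)]
      by (intro specht_rep_mult) simp_all
    then show ?thesis unfolding c
      by (simp add: mult_smult_distrib[of _ "f k" "f k" _ "f k"] mult_smult_assoc_mat[of _ "f k" "f k" _ "f k"]
          specht_rep_carrier f_def smult_smult_mat mult.commute)
  qed
  have "R (h \<otimes>\<^bsub>Gnr n r\<^esub> h') = kronecker_list (map (\<lambda>k. (coef k x \<cdot>\<^sub>m specht_rep (lam ! k) (block_perm b k w))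
      * (coef k y \<cdot>\<^sub>m specht_rep (lam ! k) (block_perm b k v))) [0..<r])"
    unfolding h h' mult_Gnr R_eq using step by (intro arg_cong[of _ _ kronecker_list] map_cong refl)
  also have "\<dots> = R h * R h'"
    unfolding h h' R_eq
    by (rule kronecker_list_mult[symmetric, where d = f]) (simp_all add: f_def specht_rep_carrier)
  finally show ?thesis .
qed

lemma R_translation: "R (x, id) = (\<Prod>k<r. coef k x) \<cdot>\<^sub>m 1\<^sub>m d"
  unfolding R_eq block_perm_id specht_rep_id d_def f_def kronecker_list_smult_one
  by (simp add: prod_list_nth)

lemma coef_0: "coef k (\<lambda>i\<in>{1..n}. 0) = 1" if "k < r"
proof -
  have "(\<Sum>j\<in>block b k. (\<lambda>i\<in>{1..n}. 0) j) = (0::int)"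
    by (rule sum.neutral) (use block_sub[OF that] in auto)
  then show ?thesis unfolding coef_def by simp
qed

lemma R_one: "R \<one>\<^bsub>Gnr n r\<^esub> = 1\<^sub>m d"
proof -
  have "(\<Prod>k<r. coef k (\<lambda>i\<in>{1..n}. 0)) = 1" using coef_0 by (intro prod.neutral) blast
  then show ?thesis unfolding one_Gnr R_translation by (simp only: one_smult_mat)
qed

lemma finite_carrier: "finite (carrier (Gnr n r))"
  unfolding carrier_Gnr[OF r] by (intro finite_cartesian_product finite_PiE finite_Sym) auto

sublocale induction_data "Gnr n r" "young_subgroup b r" R d
  by (intro induction_data.intro induction_data_axioms.intro group_Gnr r finite_carrier R_carrier R_mult R_one
      young_subgroup_subgroup[OF r, of b, folded n_def])

lemma rho_eq: "rho \<zeta> lam = rho_ind"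
  unfolding rho_def Let_def R_def b_def n_def len ..

text \<open>The order of \<open>row_group b\<close>, hence \<open>n! / P\<close> is the number of
  cosets (see \<open>P_length_ts\<close>).\<close>

definition P :: nat where "P = (\<Prod>k<r. fact (b ! k))"

lemma P_pos: "P > 0" unfolding P_def by (simp add: prod_pos)

text \<open>The subgroup contains all translations, so its cosets correspond to those of
  \<open>row_group b\<close> in \<open>S_n\<close>; the number \<open>card Z\<close> of translations
  cancels from both sides.\<close>

lemma sum_over_transversal:
  fixes \<phi> :: "(nat \<Rightarrow> nat) \<Rightarrow> complex"
  assumes "\<And>w h. w permutes {1..n} \<Longrightarrow> h \<in> row_group b \<Longrightarrow> \<phi> (w \<circ> h) = \<phi> w"
  shows "of_nat P * (\<Sum>t\<in>set ts. \<phi> (snd t)) = (\<Sum>w\<in>Sym n. \<phi> w)"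
proof -
  define Z where "Z = {1..n} \<rightarrow>\<^sub>E {0..<int r}"
  have Z: "finite Z" "Z \<noteq> {}" unfolding Z_def using r by (auto intro!: finite_PiE simp: PiE_eq_empty_iff)
  have H: "young_subgroup b r = Z \<times> row_group b" unfolding young_subgroup_eq[OF r] Z_def n_def ..
  have G: "carrier (Gnr n r) = Z \<times> Sym n" unfolding carrier_Gnr[OF r] Z_def ..
  have "of_nat (card (young_subgroup b r)) * (\<Sum>t\<in>set ts. \<phi> (snd t)) = (\<Sum>g\<in>carrier (Gnr n r). \<phi> (snd g))"
  proof (rule transversal_sum)
    fix g h assume "g \<in> carrier (Gnr n r)" "h \<in> young_subgroup b r"
    then show "\<phi> (snd (g \<otimes>\<^bsub>Gnr n r\<^esub> h)) = \<phi> (snd g)"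
      unfolding G H using assms by (cases g; cases h) (simp add: mult_Gnr)
  qed
  also have "(\<Sum>g\<in>carrier (Gnr n r). \<phi> (snd g)) = (\<Sum>(x, w)\<in>Z \<times> Sym n. \<phi> w)"
    unfolding G by (intro sum.cong) auto
  also have "\<dots> = of_nat (card Z) * (\<Sum>w\<in>Sym n. \<phi> w)"
    by (simp add: sum.cartesian_product[symmetric])
  also have "card (young_subgroup b r) = card Z * P"
    unfolding H P_def card_cartesian_product card_row_group length_b ..
  finally show ?thesis using Z by simp
qed

text \<open>Conjugating a translation by a representative permutes its coordinates, and
  \<open>R\<close> is scalar on the result. Coordinate \<open>i\<close> falls into the block with
  index \<open>row_of b (inv' w i)\<close> and is twisted by that power of \<open>\<zeta>\<close>.
  \<open>X\<close> is the sum of these indices over the representatives, and the power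
  \<open>d\<close> comes from the block size.\<close>

lemma det_translation:
  assumes n: "n \<ge> 1"
  obtains X :: nat where "n * P * X = fact n * (\<Sum>k<r. k * b ! k)"
    "\<And>x. x \<in> {1..n} \<rightarrow>\<^sub>E {0..<int r} \<Longrightarrow>
      det (rho_ind (x, id)) = \<zeta> powi (int (d * X) * (\<Sum>i=1..n. x i))"
proof -
  define X where "X i = (\<Sum>t\<in>set ts. row_of b (inv' (snd t) i))" for i
  have X: "n * P * X i = fact n * (\<Sum>k<r. k * b ! k)" if i: "i \<in> {1..n}" for i
  proof -
    have "of_nat P * (\<Sum>t\<in>set ts. of_nat (row_of b (inv' (snd t) i)))
        = (\<Sum>w\<in>Sym n. of_nat (row_of b (inv' w i)) :: complex)"
    proof (rule sum_over_transversal[where \<phi> = "\<lambda>w. of_nat (row_of b (inv' w i))"])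
      fix w h assume w: "w permutes {1..n}" and h: "h \<in> row_group b"
      have "h permutes {1..n}" using row_group_permutes[OF h] unfolding n_def .
      then have "inv' (w \<circ> h) i = inv' h (inv' w i)" using inv_comp_permutes[OF w] by simp
      moreover have "inv' w i \<in> {1..sum_list b}"
        using permutes_atLeastAtMost_mem[OF permutes_inv[OF w] i] unfolding n_def .
      ultimately show "complex_of_nat (row_of b (inv' (w \<circ> h) i)) = of_nat (row_of b (inv' w i))"
        using row_group_inv[OF h] unfolding row_group_eq by (simp only: mem_Collect_eq)
    qed
    then have "of_nat (n * P * X i) = of_nat n * (\<Sum>w\<in>Sym n. of_nat (row_of b (inv' w i)) :: complex)"
      unfolding X_def by simp
    also have "\<dots> = fact n * (\<Sum>j\<in>{1..n}. of_nat (row_of b j))"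
      using sum_permutations_point[OF _ i, of "\<lambda>j. of_nat (row_of b j)"] by simp
    also have "(\<Sum>j\<in>{1..n}. of_nat (row_of b j) :: complex) = of_nat (\<Sum>k<r. k * b ! k)"
      using sum_blocks[where b = b and h = "\<lambda>k j. of_nat k :: complex"] unfolding length_b n_def
      by (simp add: card_block mult.commute)
    finally have "complex_of_nat (n * P * X i) = of_nat (fact n * (\<Sum>k<r. k * b ! k))"
      by (simp only: of_nat_mult of_nat_fact)
    then show ?thesis by (simp only: of_nat_eq_iff)
  qed
  \<comment> \<open>The formula for \<open>X i\<close> does not involve \<open>i\<close>, so the
    determinant depends on the translation only through the sum of its coordinates.\<close>
  have Xi: "X i = X 1" if i: "i \<in> {1..n}" for i
  proof -
    have "n * P * X i = n * P * X 1" using X[OF i] X[of 1] n by simp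
    then show ?thesis using n P_pos by simp
  qed
  show thesis
  proof (rule that)
    show "n * P * X 1 = fact n * (\<Sum>k<r. k * b ! k)" using X[of 1] n by simp
    fix x :: "nat \<Rightarrow> int" assume x: "x \<in> {1..n} \<rightarrow>\<^sub>E {0..<int r}"
    define c :: "gelem \<Rightarrow> complex" where
      "c t = \<zeta> powi (\<Sum>i\<in>{1..n}. int (row_of b (inv' (snd t) i)) * x i)" for t
    have "det (rho_ind (x, id)) = (\<Prod>t\<in>set ts. c t) ^ d"
    proof (rule rho_ind_det_scalar)
      show "(x, id) \<in> carrier (Gnr n r)" using x by (simp add: carrier_Gnr[OF r] permutes_id)
      fix t assume t: "t \<in> set ts"
      obtain y w where yw: "t = (y, w)" by (cases t)
      have tc: "(y, w) \<in> carrier (Gnr n r)" using ts_carrier[OF t] yw by simp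
      then have w: "w permutes {1..n}" by (simp add: carrier_Gnr[OF r])
      define z where "z = (\<lambda>i\<in>{1..n}. x (w i))"
      have wi: "w i \<in> {1..n}" "inv' w i \<in> {1..n}" if "i \<in> {1..n}" for i
        using permutes_atLeastAtMost_mem[OF w that] permutes_atLeastAtMost_mem[OF permutes_inv[OF w] that] by auto
      \<comment> \<open>The translation part \<open>y\<close> of the representative cancels, because
        translations commute.\<close>
      have conj: "inv\<^bsub>Gnr n r\<^esub> t \<otimes>\<^bsub>Gnr n r\<^esub> (x, id) \<otimes>\<^bsub>Gnr n r\<^esub> t = (z, id)"
      proof -
        have "((- y (w i) mod int r + x (w i)) mod int r + y (w i)) mod int r = x (w i)" if "i \<in> {1..n}" for i
        proof -
          have "((- y (w i) mod int r + x (w i)) mod int r + y (w i)) mod int r = x (w i) mod int r"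
            by (simp add: mod_simps)
          also have "\<dots> = x (w i)" using x wi(1)[OF that] by (auto simp: PiE_iff)
          finally show ?thesis .
        qed
        then show ?thesis
          unfolding yw inv_Gnr[OF r tc] mult_Gnr permutes_inv_inv[OF w] z_def
          by (auto simp: permutes_inv_o(2)[OF w] permutes_inv_inv[OF w] intro!: restrict_ext)
      qed
      have z: "z \<in> {1..n} \<rightarrow>\<^sub>E {0..<int r}"
        unfolding z_def using x wi(1) by (auto simp: PiE_iff)
      have "(\<Prod>k<r. coef k z) = (\<Prod>k<r. \<zeta> powi (\<Sum>j\<in>block b k. int k * z j))"
      proof (rule prod.cong[OF refl])
        fix k
        have "\<zeta> powi (\<Sum>j\<in>block b k. int k * z j) = \<zeta> powi ((\<Sum>j\<in>block b k. z j) * int k)"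
          by (simp add: sum_distrib_left mult.commute)
        also have "\<dots> = coef k z" unfolding coef_def by (simp add: power_int_mult power_int_of_nat)
        finally show "coef k z = \<zeta> powi (\<Sum>j\<in>block b k. int k * z j)" ..
      qed
      also have "\<dots> = \<zeta> powi (\<Sum>k<r. \<Sum>j\<in>block b k. int k * z j)"
        by (rule powi_prod[OF zeta_nz]) simp
      also have "(\<Sum>k<r. \<Sum>j\<in>block b k. int k * z j) = (\<Sum>j\<in>{1..n}. int (row_of b j) * z j)"
        using sum_blocks[where b = b and h = "\<lambda>k j. int k * z j"] unfolding length_b n_def .
      also have "\<dots> = (\<Sum>j\<in>{1..n}. int (row_of b j) * x (w j))"
        unfolding z_def by (rule sum.cong) auto
      also have "\<dots> = (\<Sum>i\<in>{1..n}. int (row_of b (inv' w i)) * x i)"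
        by (rule sum.reindex_bij_witness[where i = "inv' w" and j = w])
          (use wi permutes_inverses[OF w] in auto)
      finally have "(\<Prod>k<r. coef k z) = c t" unfolding c_def yw by simp
      then have "R (z, id) = c t \<cdot>\<^sub>m 1\<^sub>m d" unfolding R_translation by simp
      moreover have "(z, id) \<in> young_subgroup b r"
        using z by (simp add: young_subgroup_eq[OF r] n_def)
      ultimately show "inv\<^bsub>Gnr n r\<^esub> t \<otimes>\<^bsub>Gnr n r\<^esub> (x, id) \<otimes>\<^bsub>Gnr n r\<^esub> t \<in> young_subgroup b r \<and>
          R (inv\<^bsub>Gnr n r\<^esub> t \<otimes>\<^bsub>Gnr n r\<^esub> (x, id) \<otimes>\<^bsub>Gnr n r\<^esub> t) = c t \<cdot>\<^sub>m 1\<^sub>m d"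
        unfolding conj by blast
    qed
    also have "(\<Prod>t\<in>set ts. c t) = \<zeta> powi (\<Sum>t\<in>set ts. \<Sum>i\<in>{1..n}. int (row_of b (inv' (snd t) i)) * x i)"
      unfolding c_def by (rule powi_prod[OF zeta_nz]) simp
    also have "(\<Sum>t\<in>set ts. \<Sum>i\<in>{1..n}. int (row_of b (inv' (snd t) i)) * x i) = (\<Sum>i\<in>{1..n}. int (X i) * x i)"
      unfolding X_def by (subst sum.swap) (simp add: sum_distrib_right)
    also have "\<dots> = int (X 1) * (\<Sum>i\<in>{1..n}. x i)"
      unfolding sum_distrib_left by (rule sum.cong[OF refl], drule Xi) simp
    also have "(\<zeta> powi (int (X 1) * (\<Sum>i\<in>{1..n}. x i))) ^ d = \<zeta> powi (int (d * X 1) * (\<Sum>i=1..n. x i))"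
    proof -
      have "(\<zeta> powi m) ^ d = \<zeta> powi (m * int d)" for m by (simp only: power_int_mult power_int_of_nat)
      moreover have "int (X 1) * (\<Sum>i\<in>{1..n}. x i) * int d = int (d * X 1) * (\<Sum>i=1..n. x i)"
        by (simp only: of_nat_mult ac_simps)
      ultimately show ?thesis by (simp only:)
    qed
    finally show "det (rho_ind (x, id)) = \<zeta> powi (int (d * X 1) * (\<Sum>i=1..n. x i))" .
  qed
qed

section \<open>The copy of the symmetric group inside \<open>G(n,r)\<close> and the trace of a
  transposition\<close>

definition shift0 :: "nat \<Rightarrow> int" where "shift0 = (\<lambda>i\<in>{1..n}. 0)"

lemma shift0_carrier: "w permutes {1..n} \<Longrightarrow> (shift0, w) \<in> carrier (Gnr n r)"
  using r by (simp add: carrier_Gnr[OF r] shift0_def)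

lemma shift0_mult:
  "u permutes {1..n} \<Longrightarrow> (shift0, u) \<otimes>\<^bsub>Gnr n r\<^esub> (shift0, v) = (shift0, u \<circ> v)"
  using permutes_atLeastAtMost_mem[OF permutes_inv[of u]] unfolding mult_Gnr shift0_def
  by (auto intro!: restrict_ext)

lemma shift0_inv:
  "w permutes {1..n} \<Longrightarrow> inv\<^bsub>Gnr n r\<^esub> (shift0, w) = (shift0, inv' w)"
  using permutes_atLeastAtMost_mem[of w] unfolding inv_Gnr[OF r shift0_carrier] unfolding shift0_def
  by (auto intro!: restrict_ext)

lemma R_shift0_trace:
  "mat_trace (R (shift0, u)) = (\<Prod>k<r. specht_char (lam ! k) (block_perm b k u))"
proof -
  have "mat_trace (R (shift0, u)) = (\<Prod>k\<leftarrow>[0..<r]. mat_trace (coef k shift0 \<cdot>\<^sub>m specht_rep (lam ! k) (block_perm b k u)))"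
    unfolding R_eq by (rule mat_trace_kronecker_list[where d = f]) (simp add: f_def specht_rep_carrier)
  also have "\<dots> = (\<Prod>k<r. mat_trace (coef k shift0 \<cdot>\<^sub>m specht_rep (lam ! k) (block_perm b k u)))"
    by (simp add: prod_list_nth)
  also have "\<dots> = (\<Prod>k<r. specht_char (lam ! k) (block_perm b k u))"
    by (rule prod.cong) (simp_all add: coef_0[folded shift0_def] one_smult_mat specht_char_def)
  finally show ?thesis .
qed

text \<open>The trace of \<open>R\<close> at a transposition of two points of block
  \<open>k\<close>: the other tensor factors see the identity.\<close>

definition \<psi> :: "nat \<Rightarrow> complex" where
  "\<psi> k = specht_char (lam ! k) (Transposition.transpose 1 2) * (\<Prod>l\<in>{..<r} - {k}. of_nat (f l))"

lemma transpose_row_group_iff: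
  assumes "i \<in> {1..n}" "j \<in> {1..n}"
  shows "Transposition.transpose i j \<in> row_group b \<longleftrightarrow> row_of b i = row_of b j"
proof
  assume "Transposition.transpose i j \<in> row_group b"
  then have "row_of b (Transposition.transpose i j i) = row_of b i"
    using assms unfolding row_group_eq n_def by blast
  then show "row_of b i = row_of b j" by simp
qed (use assms in \<open>auto intro!: transpose_in_row_group simp: n_def\<close>)

lemma prod_specht_char_transpose:
  assumes i: "i \<in> {1..n}" and j: "j \<in> {1..n}" and ij: "i \<noteq> j" and row: "row_of b i = row_of b j"
  shows "(\<Prod>k<r. specht_char (lam ! k) (block_perm b k (Transposition.transpose i j))) = \<psi> (row_of b i)"
proof -
  let ?t = "Transposition.transpose i j" and ?k = "row_of b i"
  have k: "?k < r" using row_of_bounds(1)[of i b] i unfolding n_def length_b by simp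
  have t: "?t \<in> row_group b" using transpose_row_group_iff[OF i j] row by simp
  have other: "specht_char (lam ! l) (block_perm b l ?t) = of_nat (f l)" if l: "l < r" "l \<noteq> ?k" for l
  proof -
    have "block_perm b l ?t = id"
    proof
      fix m
      have "?t (offset b l + m) = offset b l + m" if m: "m \<in> {1..b ! l}"
      proof -
        have "row_of b (offset b l + m) = l"
          using cell_of(2)[of l b m] m l length_b by simp
        then show ?thesis using l(2) row by (intro transpose_apply_other) auto
      qed
      then show "block_perm b l ?t m = id m" by (simp add: block_perm_def)
    qed
    then show ?thesis
      by (simp add: specht_char_def specht_rep_id mat_trace_one f_def)
  qed
  have main: "specht_char (lam ! ?k) (block_perm b ?k ?t) = specht_char (lam ! ?k) (Transposition.transpose 1 2)"
  proof -
    define i' j' where "i' = i - offset b ?k" and "j' = j - offset b ?k"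
    have blk: "i \<in> block b ?k" "j \<in> block b ?k"
      using row_of_eq_iff[of i b ?k] row_of_eq_iff[of j b ?k] i j k row length_b unfolding n_def by auto
    then have ij': "i = offset b ?k + i'" "j = offset b ?k + j'" "i' \<in> {1..b ! ?k}" "j' \<in> {1..b ! ?k}"
      unfolding i'_def j'_def block_def by auto
    have "i' \<noteq> j'" using ij ij' by auto
    have "block_perm b ?k ?t = Transposition.transpose i' j'"
    proof
      fix m
      show "block_perm b ?k ?t m = Transposition.transpose i' j' m"
      proof (cases "m \<in> {1..b ! ?k}")
        case True
        define K where "K = ?k"
        have "Transposition.transpose (offset b K + i') (offset b K + j') (offset b K + m) - offset b K
            = Transposition.transpose i' j' m"
          by (simp add: Transposition.transpose_def)
        then show ?thesis using True unfolding block_perm_def K_def ij'(1,2)[symmetric] by (simp only: if_True)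
      next
        case False
        then have "i' \<noteq> m" "j' \<noteq> m" using ij' by auto
        then show ?thesis using False unfolding block_perm_def by (simp only: if_False transpose_apply_other)
      qed
    qed
    then show ?thesis
      using specht_char_transpose[of i' "lam ! ?k" j'] ij' \<open>i' \<noteq> j'\<close> b_nth[OF k] by simp
  qed
  have "(\<Prod>l<r. specht_char (lam ! l) (block_perm b l ?t))
      = specht_char (lam ! ?k) (block_perm b ?k ?t) * (\<Prod>l\<in>{..<r} - {?k}. specht_char (lam ! l) (block_perm b l ?t))"
    using k by (intro prod.remove) auto
  also have "(\<Prod>l\<in>{..<r} - {?k}. specht_char (lam ! l) (block_perm b l ?t)) = (\<Prod>l\<in>{..<r} - {?k}. of_nat (f l))"
    by (rule prod.cong) (use other in auto)
  finally show ?thesis unfolding main \<psi>_def .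
qed

text \<open>The Frobenius formula with the sum over cosets replaced by one over \<open>S_n\<close>.
  Conjugating by \<open>w\<close> yields the transposition of the preimages of \<open>a\<close> and
  \<open>c\<close>, which lies in the subgroup exactly when both are in one block.\<close>

lemma trace_transposition:
  assumes a: "a \<in> {1..n}" and c: "c \<in> {1..n}" and ac: "a \<noteq> c"
  shows "of_nat P * mat_trace (rho_ind (shift0, Transposition.transpose a c))
    = (\<Sum>w\<in>Sym n. if row_of b (inv' w a) = row_of b (inv' w c) then \<psi> (row_of b (inv' w a)) else 0)"
proof -
  let ?s = "(shift0, Transposition.transpose a c)"
  have sp: "Transposition.transpose a c permutes {1..n}" using a c by (rule permutes_swap_id)
  have s: "?s \<in> carrier (Gnr n r)" using sp by (rule shift0_carrier)
  define \<theta> where "\<theta> t = (if inv\<^bsub>Gnr n r\<^esub> t \<otimes>\<^bsub>Gnr n r\<^esub> ?s \<otimes>\<^bsub>Gnr n r\<^esub> t \<in> young_subgroup b r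
      then mat_trace (R (inv\<^bsub>Gnr n r\<^esub> t \<otimes>\<^bsub>Gnr n r\<^esub> ?s \<otimes>\<^bsub>Gnr n r\<^esub> t)) else 0)" for t
  have inv\<theta>: "\<theta> (t \<otimes>\<^bsub>Gnr n r\<^esub> h) = \<theta> t" if "t \<in> carrier (Gnr n r)" "h \<in> young_subgroup b r" for t h
    unfolding \<theta>_def by (rule conj_trace_invariant[OF s that])
  have \<theta>w: "\<theta> (shift0, w) = (if row_of b (inv' w a) = row_of b (inv' w c) then \<psi> (row_of b (inv' w a)) else 0)"
    if w: "w permutes {1..n}" for w
  proof -
    let ?i = "inv' w a" and ?j = "inv' w c"
    have iw: "inv' w permutes {1..n}" using w by (rule permutes_inv)
    have i: "?i \<in> {1..n}" "?j \<in> {1..n}" using permutes_atLeastAtMost_mem[OF iw] a c by auto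
    have ij: "?i \<noteq> ?j" using ac permutes_inj[OF iw] by (auto dest: injD)
    have e: "inv' w \<circ> Transposition.transpose a c \<circ> w = Transposition.transpose ?i ?j"
    proof
      fix x
      have "inv' w (Transposition.transpose a c y) = Transposition.transpose ?i ?j (inv' w y)" for y
        using permutes_inj[OF iw] by (auto simp: Transposition.transpose_def inj_eq)
      from this[of "w x"] show "(inv' w \<circ> Transposition.transpose a c \<circ> w) x = Transposition.transpose ?i ?j x"
        using permutes_inverses(2)[OF w] by simp
    qed
    have conj: "inv\<^bsub>Gnr n r\<^esub> (shift0, w) \<otimes>\<^bsub>Gnr n r\<^esub> ?s \<otimes>\<^bsub>Gnr n r\<^esub> (shift0, w) = (shift0, Transposition.transpose ?i ?j)"
      unfolding shift0_inv[OF w] shift0_mult[OF iw] shift0_mult[OF permutes_compose[OF sp iw]] e ..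
    have "(shift0, Transposition.transpose ?i ?j) \<in> young_subgroup b r \<longleftrightarrow> row_of b ?i = row_of b ?j"
      unfolding young_subgroup_eq[OF r] using transpose_row_group_iff[OF i] r by (simp add: shift0_def n_def)
    then show ?thesis
      unfolding \<theta>_def conj R_shift0_trace using prod_specht_char_transpose[OF i ij] by simp
  qed
  \<comment> \<open>Every \<open>(y; w)\<close> equals \<open>(0; w)\<close> times a translation,
    and translations lie in the subgroup, so \<open>\<theta>\<close> depends on \<open>w\<close>
    alone.\<close>
  have \<theta>t: "\<theta> t = \<theta> (shift0, snd t)" if "t \<in> carrier (Gnr n r)" for t
  proof -
    obtain y w where t: "t = (y, w)" by (cases t)
    have w: "w permutes {1..n}" and y: "y \<in> {1..n} \<rightarrow>\<^sub>E {0..<int r}"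
      using that unfolding t carrier_Gnr[OF r] by auto
    define h where "h = (\<lambda>i\<in>{1..n}. y (w i), id :: nat \<Rightarrow> nat)"
    have "h \<in> young_subgroup b r"
      unfolding h_def young_subgroup_eq[OF r] using y permutes_atLeastAtMost_mem[OF w]
      by (auto simp: n_def PiE_iff)
    moreover have "(shift0, w) \<otimes>\<^bsub>Gnr n r\<^esub> h = t"
    proof -
      have "(shift0 i + (\<lambda>i\<in>{1..n}. y (w i)) (inv' w i)) mod int r = y i" if i: "i \<in> {1..n}" for i
      proof -
        have "inv' w i \<in> {1..n}" using permutes_atLeastAtMost_mem[OF permutes_inv[OF w] i] .
        then have "(shift0 i + (\<lambda>i\<in>{1..n}. y (w i)) (inv' w i)) mod int r = y i mod int r"
          using permutes_inverses(1)[OF w] i by (simp add: shift0_def)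
        also have "\<dots> = y i" using y i by (auto simp: PiE_iff)
        finally show ?thesis .
      qed
      then have "(\<lambda>i\<in>{1..n}. (shift0 i + (\<lambda>i\<in>{1..n}. y (w i)) (inv' w i)) mod int r) = y"
        using y by (auto simp: fun_eq_iff PiE_iff extensional_def restrict_def)
      then show ?thesis unfolding h_def t mult_Gnr by simp
    qed
    ultimately show ?thesis using inv\<theta>[OF shift0_carrier[OF w]] unfolding t by fastforce
  qed
  have "mat_trace (rho_ind ?s) = (\<Sum>t\<in>set ts. \<theta> t)" unfolding rho_ind_trace \<theta>_def ..
  also have "\<dots> = (\<Sum>t\<in>set ts. \<theta> (shift0, snd t))"
    by (rule sum.cong[OF refl]) (use \<theta>t ts_carrier in blast)
  finally have "of_nat P * mat_trace (rho_ind ?s) = of_nat P * (\<Sum>t\<in>set ts. \<theta> (shift0, snd t))" by simp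
  also have "\<dots> = (\<Sum>w\<in>Sym n. \<theta> (shift0, w))"
  proof (rule sum_over_transversal[where \<phi> = "\<lambda>w. \<theta> (shift0, w)"])
    fix w h assume w: "w permutes {1..n}" and h: "h \<in> row_group b"
    have "(shift0, h) \<in> young_subgroup b r"
      unfolding young_subgroup_eq[OF r] using h r by (simp add: shift0_def n_def)
    from inv\<theta>[OF shift0_carrier[OF w] this] show "\<theta> (shift0, w \<circ> h) = \<theta> (shift0, w)"
      unfolding shift0_mult[OF w] .
  qed
  also have "\<dots> = (\<Sum>w\<in>Sym n. if row_of b (inv' w a) = row_of b (inv' w c) then \<psi> (row_of b (inv' w a)) else 0)"
    by (rule sum.cong[OF refl], rule \<theta>w) simp
  finally show ?thesis .
qed

lemma P_length_ts: "P * length ts = fact n"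
proof -
  have "of_nat P * (\<Sum>t\<in>set ts. 1) = (\<Sum>w\<in>Sym n. 1 :: complex)" by (rule sum_over_transversal) simp
  then have "complex_of_nat (P * length ts) = of_nat (fact n)"
    using card_permutations[of "{1..n}" n] distinct_card[OF ts_distinct] by simp
  then show ?thesis by (simp only: of_nat_eq_iff)
qed

end

lemma two_sum_pairs:
  fixes c :: "nat \<Rightarrow> 'z::comm_ring_1"
  shows "2 * (\<Sum>j<m. \<Sum>i<j. c i * c j) = (\<Sum>k<m. c k) * (\<Sum>k<m. c k) - (\<Sum>k<m. c k * c k)"
proof (induction m)
  case (Suc m)
  have "(\<Sum>i<m. c i * c m) = (\<Sum>k<m. c k) * c m" by (simp add: sum_distrib_right)
  with Suc show ?case by (simp add: algebra_simps)
qed simp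

context wreath_rep
begin

text \<open>A point of block \<open>k\<close> has the \<open>b ! k - 1\<close> other points of the
  block as partners. For an empty block the factor \<open>b ! k\<close> makes the truncated
  subtraction harmless.\<close>

lemma sum_pairs_rows:
  "(\<Sum>i\<in>{1..n}. \<Sum>j\<in>{1..n} - {i}. if row_of b i = row_of b j then \<psi> (row_of b i) else 0)
    = (\<Sum>k<r. of_nat (b ! k) * of_nat (b ! k - 1) * \<psi> k)"
proof -
  have inner: "(\<Sum>j\<in>{1..n} - {i}. if row_of b i = row_of b j then \<psi> (row_of b i) else 0)
      = of_nat (b ! row_of b i - 1) * \<psi> (row_of b i)" if i: "i \<in> {1..n}" for i
  proof -
    let ?k = "row_of b i"
    have k: "?k < length b" using row_of_bounds(1) i unfolding n_def by blast
    have iB: "i \<in> block b ?k" using row_of_eq_iff[of i b ?k] i k unfolding n_def by simp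
    have "{j \<in> {1..n} - {i}. ?k = row_of b j} = block b ?k - {i}"
      unfolding block_eq[OF k] n_def by (auto simp: eq_commute[of "row_of b i"] simp del: atLeastAtMost_iff)
    then have "(\<Sum>j\<in>{1..n} - {i}. if ?k = row_of b j then \<psi> ?k else 0) = (\<Sum>j\<in>block b ?k - {i}. \<psi> ?k)"
      using sum.inter_filter[of "{1..n} - {i}" "\<lambda>j. \<psi> ?k" "\<lambda>j. ?k = row_of b j"] by simp
    also have "\<dots> = of_nat (b ! ?k - 1) * \<psi> ?k"
      using iB by (simp add: card_Diff_singleton card_block)
    finally show ?thesis .
  qed
  have "(\<Sum>i\<in>{1..n}. \<Sum>j\<in>{1..n} - {i}. if row_of b i = row_of b j then \<psi> (row_of b i) else 0)
      = (\<Sum>i\<in>{1..n}. of_nat (b ! row_of b i - 1) * \<psi> (row_of b i))"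
    by (rule sum.cong[OF refl]) (rule inner)
  also have "\<dots> = (\<Sum>k<r. \<Sum>j\<in>block b k. of_nat (b ! k - 1) * \<psi> k)"
    using sum_blocks[where b = b and h = "\<lambda>k j. of_nat (b ! k - 1) * \<psi> k"] unfolding length_b n_def by simp
  also have "\<dots> = (\<Sum>k<r. of_nat (b ! k) * of_nat (b ! k - 1) * \<psi> k)"
    by (simp add: card_block mult.assoc)
  finally show ?thesis .
qed

lemma sum_lists: "n = (\<Sum>k<r. b ! k)"
  unfolding n_def by (simp add: sum_list_sum_nth atLeast0LessThan length_b)

text \<open>Twice the multiplicity of the eigenvalue \<open>-1\<close> of a transposition is its dimension minus its
  trace, which is computed by counting the cosets it fixes.\<close>

lemma y_num_trace:
  assumes n: "n \<ge> 2" and a: "a \<in> {1..n}" and c: "c \<in> {1..n}" and ac: "a \<noteq> c"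
  shows "of_nat (length ts * d) - mat_trace (rho_ind (shift0, Transposition.transpose a c)) = 2 * y_num lam"
proof -
  let ?T = "mat_trace (rho_ind (shift0, Transposition.transpose a c))"
  let ?B = "\<lambda>k. of_nat (b ! k) :: complex"
  let ?M = "\<lambda>k. of_nat (multinomial (n - 2) ((map int b)[k := int (b ! k) - 2])) :: complex"
  have P0: "complex_of_nat P \<noteq> 0" using P_pos by simp
  have fact_n: "fact n = of_nat n * of_nat (n - 1) * (fact (n - 2) :: complex)"
  proof -
    define m where "m = n - 2"
    have m: "n = Suc (Suc m)" using n unfolding m_def by simp
    have "n - 2 = m" "n - 1 = Suc m" using m by simp_all
    then show ?thesis unfolding m by (simp only: fact_Suc mult.assoc)
  qed
  have n0: "of_nat n * of_nat (n - 1) \<noteq> (0 :: complex)" using n by simp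
  have "of_nat n * of_nat (n - 1) * (of_nat P * ?T)
      = fact n * (\<Sum>k<r. ?B k * of_nat (b ! k - 1) * \<psi> k)"
    unfolding trace_transposition[OF a c ac]
    using sum_permutations_pair[OF _ a c ac,
        of "\<lambda>i j. if row_of b i = row_of b j then \<psi> (row_of b i) else 0"]
    unfolding sum_pairs_rows by simp
  \<comment> \<open>The factor \<open>n (n - 1)\<close> counting ordered pairs cancels against
    \<open>n!\<close> and leaves the \<open>(n - 2)!\<close> that occurs in
    \<open>y\<close>.\<close>
  then have PT: "of_nat P * ?T = fact (n - 2) * (\<Sum>k<r. ?B k * of_nat (b ! k - 1) * \<psi> k)"
    using n0 unfolding fact_n by (simp add: mult.assoc)
  have PN: "of_nat P * of_nat (length ts * d) = fact n * (of_nat d :: complex)"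
    using arg_cong[OF P_length_ts, of complex_of_nat] by (simp add: mult.assoc[symmetric])
  have M: "?M k * of_nat P = fact (n - 2) * (?B k * of_nat (b ! k - 1))" if k: "k < r" for k
  proof -
    have "multinomial (n - 2) ((map int b)[k := int (b ! k) - int 2]) * P
        = (if 2 \<le> b ! k then fact (n - 2) * (fact (b ! k) div fact (b ! k - 2)) else 0)"
      unfolding n_def P_def using multinomial_minus[of k b 2] k length_b n n_def by simp
    also have "\<dots> = fact (n - 2) * (b ! k * (b ! k - 1))"
    proof (cases "2 \<le> b ! k")
      case True
      define m where "m = b ! k - 2"
      have m: "b ! k = Suc (Suc m)" using True unfolding m_def by simp
      have "fact (Suc (Suc m)) = (Suc (Suc m) * Suc m) * fact m" by (simp only: fact_Suc mult.assoc of_nat_id)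
      then have "fact (Suc (Suc m)) div fact m = Suc (Suc m) * Suc m"
        by (simp only: nonzero_mult_div_cancel_right[OF fact_nonzero])
      moreover have "Suc (Suc m) - 2 = m" "Suc (Suc m) - 1 = Suc m" "2 \<le> Suc (Suc m)" by simp_all
      ultimately show ?thesis unfolding m by (simp only: if_True)
    next
      case False
      then have "b ! k = 0 \<or> b ! k = 1" by auto
      then show ?thesis using False by auto
    qed
    finally have "of_nat (multinomial (n - 2) ((map int b)[k := int (b ! k) - int 2]) * P)
      = (of_nat (fact (n - 2) * (b ! k * (b ! k - 1))) :: complex)" by (rule arg_cong)
    then show ?thesis by (simp only: of_nat_mult of_nat_fact of_nat_numeral)
  qed
  \<comment> \<open>The factor \<open>b_k (b_k - 1)\<close> covers blocks of size 0 and 1, where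
    \<open>g_num\<close> has its default value 0 and both sides vanish.\<close>
  have g: "?B k * of_nat (b ! k - 1) * (2 * (g_num (lam ! k) * (\<Prod>j\<in>{..<r} - {k}. of_nat (f j))))
      = ?B k * of_nat (b ! k - 1) * (of_nat d - \<psi> k)" if k: "k < r" for k
  proof (cases "b ! k \<ge> 2")
    case True
    have dk: "of_nat d = of_nat (f k) * (\<Prod>j\<in>{..<r} - {k}. of_nat (f j) :: complex)"
    proof -
      have "of_nat d = (\<Prod>j<r. of_nat (f j) :: complex)" unfolding d_eq by simp
      also have "\<dots> = of_nat (f k) * (\<Prod>j\<in>{..<r} - {k}. of_nat (f j))"
        using k by (intro prod.remove) auto
      finally show ?thesis .
    qed
    have "2 * g_num (lam ! k) = of_nat (f k) - specht_char (lam ! k) (Transposition.transpose 1 2)"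
      using True unfolding g_num_def f_def b_nth[OF k] by simp
    then have "2 * (g_num (lam ! k) * (\<Prod>j\<in>{..<r} - {k}. of_nat (f j))) = of_nat d - \<psi> k"
      unfolding dk \<psi>_def by (simp add: mult.assoc[symmetric] left_diff_distrib)
    then show ?thesis by simp
  next
    case False
    then have "b ! k = 0 \<or> b ! k = 1" by auto
    then show ?thesis by auto
  qed
  define S where "S = (\<Sum>j<r. \<Sum>i<j. ?B i * ?B j)"
  define Q where "Q = (\<Sum>k<r. ?B k * of_nat (b ! k - 1) * (of_nat d - \<psi> k))"
  have y: "y_num lam = of_nat d * (fact (n - 2) / of_nat P) * S
      + (\<Sum>k<r. g_num (lam ! k) * (\<Prod>j\<in>{..<r} - {k}. of_nat (f j)) * ?M k)"
    unfolding y_num_def Let_def b_def[symmetric] n_def[symmetric] len S_def P_def d_eq f_def using n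
    by simp
  have "of_nat P * (2 * y_num lam) = fact (n - 2) * (of_nat d * (2 * S))
      + (\<Sum>k<r. 2 * (g_num (lam ! k) * (\<Prod>j\<in>{..<r} - {k}. of_nat (f j))) * (?M k * of_nat P))"
    unfolding y using P0 by (simp add: distrib_left sum_distrib_left sum_distrib_right mult_ac)
  also have "(\<Sum>k<r. 2 * (g_num (lam ! k) * (\<Prod>j\<in>{..<r} - {k}. of_nat (f j))) * (?M k * of_nat P))
      = fact (n - 2) * Q"
    unfolding Q_def sum_distrib_left
  proof (rule sum.cong[OF refl])
    fix k assume "k \<in> {..<r}"
    then have k: "k < r" by simp
    show "2 * (g_num (lam ! k) * (\<Prod>j\<in>{..<r} - {k}. of_nat (f j))) * (?M k * of_nat P)
        = fact (n - 2) * (?B k * of_nat (b ! k - 1) * (of_nat d - \<psi> k))"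
      unfolding M[OF k] g[OF k, symmetric] by (simp add: mult_ac)
  qed
  finally have Y: "of_nat P * (2 * y_num lam) = fact (n - 2) * (of_nat d * (2 * S) + Q)"
    by (simp add: distrib_left)
  have BB: "?B k * of_nat (b ! k - 1) = ?B k * ?B k - ?B k" for k
    by (cases "b ! k") (auto simp: algebra_simps)
  have "2 * S = of_nat n * of_nat n - (\<Sum>k<r. ?B k * ?B k)"
    unfolding S_def two_sum_pairs sum_lists by simp
  moreover have "(\<Sum>k<r. ?B k * of_nat (b ! k - 1)) = (\<Sum>k<r. ?B k * ?B k) - of_nat n"
    unfolding BB sum_subtractf sum_lists by simp
  moreover have "of_nat n * of_nat (n - 1) = of_nat n * of_nat n - (of_nat n :: complex)"
    using n by (simp add: of_nat_diff algebra_simps)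
  \<comment> \<open>Ordered pairs of distinct points lie either in two different blocks or in one;
    together they number \<open>n (n - 1)\<close>.\<close>
  ultimately have S: "2 * S + (\<Sum>k<r. ?B k * of_nat (b ! k - 1)) = of_nat n * of_nat (n - 1)"
    by simp
  have Q: "Q = of_nat d * (\<Sum>k<r. ?B k * of_nat (b ! k - 1)) - (\<Sum>k<r. ?B k * of_nat (b ! k - 1) * \<psi> k)"
    unfolding Q_def by (simp add: right_diff_distrib sum_subtractf sum_distrib_left mult_ac)
  have "of_nat d * (2 * S) + Q
      = of_nat d * (2 * S + (\<Sum>k<r. ?B k * of_nat (b ! k - 1))) - (\<Sum>k<r. ?B k * of_nat (b ! k - 1) * \<psi> k)"
    unfolding Q by (simp add: distrib_left)
  then have "fact (n - 2) * (of_nat d * (2 * S) + Q)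
      = fact n * of_nat d - fact (n - 2) * (\<Sum>k<r. ?B k * of_nat (b ! k - 1) * \<psi> k)"
    unfolding S fact_n by (simp add: right_diff_distrib mult_ac)
  then have "of_nat P * (of_nat (length ts * d) - ?T) = of_nat P * (2 * y_num lam)"
    unfolding Y right_diff_distrib PT PN by simp
  then show ?thesis using P0 by simp
qed

text \<open>The square of the representing matrix is the identity, so \<open>K\<close> is the
  multiplicity of the eigenvalue \<open>-1\<close>. Comparison with the trace identifies it with
  \<open>y\<close>, which is thereby a natural number.\<close>

lemma det_transposition:
  assumes n: "n \<ge> 2" and a: "a \<in> {1..n}" and c: "c \<in> {1..n}" and ac: "a \<noteq> c"
  obtains K where "y_num lam = of_nat K" "det (rho_ind (shift0, Transposition.transpose a c)) = (-1) ^ K"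
proof -
  let ?t = "Transposition.transpose a c"
  have t: "?t permutes {1..n}" using a c by (rule permutes_swap_id)
  have one: "(shift0, id) = \<one>\<^bsub>Gnr n r\<^esub>" unfolding one_Gnr shift0_def ..
  have "rho_ind (shift0, ?t) * rho_ind (shift0, ?t) = rho_ind ((shift0, ?t) \<otimes>\<^bsub>Gnr n r\<^esub> (shift0, ?t))"
    by (rule rho_ind_mult[symmetric]) (rule shift0_carrier[OF t])+
  also have "(shift0, ?t) \<otimes>\<^bsub>Gnr n r\<^esub> (shift0, ?t) = \<one>\<^bsub>Gnr n r\<^esub>"
    unfolding shift0_mult[OF t] by (simp add: one)
  finally have "rho_ind (shift0, ?t) * rho_ind (shift0, ?t) = 1\<^sub>m (length ts * d)"
    unfolding rho_ind_one .
  from involution_trace_det[OF rho_ind_carrier this] obtain K where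
    K: "mat_trace (rho_ind (shift0, ?t)) = of_nat (length ts * d) - 2 * of_nat K"
      "det (rho_ind (shift0, ?t)) = (-1) ^ K" by blast
  have "2 * y_num lam = 2 * of_nat K" using y_num_trace[OF n a c ac] K(1) by simp
  with that K(2) show thesis by simp
qed

lemma det_mult: "g \<in> carrier (Gnr n r) \<Longrightarrow> h \<in> carrier (Gnr n r) \<Longrightarrow>
    det (rho_ind (g \<otimes>\<^bsub>Gnr n r\<^esub> h)) = det (rho_ind g) * det (rho_ind h)"
  by (simp add: rho_ind_mult det_mult[OF rho_ind_carrier rho_ind_carrier])

text \<open>The exponent is fixed by \<open>y\<close>, hence common to all transpositions, and
  products of transpositions reach every permutation. For \<open>n < 2\<close> only the identity is
  left and \<open>y = 0\<close>.\<close>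

lemma det_permutation:
  obtains K where "y_num lam = of_nat K"
    "\<And>w. w permutes {1..n} \<Longrightarrow> det (rho_ind (shift0, w)) = of_int (sign w) ^ K"
proof -
  have det1: "det (rho_ind (shift0, id)) = 1"
    using rho_ind_one unfolding one_Gnr shift0_def by simp
  show thesis
  proof (cases "n \<ge> 2")
    case False
    have wid: "w = id" if "w permutes {1..n}" for w
    proof
      fix i
      show "w i = id i"
        using permutes_not_in[OF that, of i] permutes_atLeastAtMost_mem[OF that, of i] False
        by (cases "i \<in> {1..n}") auto
    qed
    then have "det (rho_ind (shift0, w)) = of_int (sign w) ^ 0" if "w permutes {1..n}" for w
      using det1 unfolding wid[OF that] by simp
    moreover have "y_num lam = of_nat 0"
      using False unfolding y_num_def Let_def b_def[symmetric] n_def[symmetric] by simp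
    ultimately show thesis using that by blast
  next
    case True
    then obtain K where K: "y_num lam = of_nat K"
      using det_transposition[of 1 2] by auto
    have tr: "det (rho_ind (shift0, Transposition.transpose a c)) = (-1) ^ K"
      if ac: "a \<in> {1..n}" "c \<in> {1..n}" "a \<noteq> c" for a c
    proof -
      obtain K' where "y_num lam = of_nat K'" "det (rho_ind (shift0, Transposition.transpose a c)) = (-1) ^ K'"
        using det_transposition[OF True ac] by blast
      then show ?thesis using K by simp
    qed
    have "det (rho_ind (shift0, w)) = of_int (sign w) ^ K" if w: "w permutes {1..n}" for w
      using w finite_atLeastAtMost
    proof (induction rule: permutes_induct)
      case id
      then show ?case by (simp only: det1 sign_id of_int_1 power_one)
    next
      case (swap a c p)
      have t: "Transposition.transpose a c permutes {1..n}" using swap(1,2) by (rule permutes_swap_id)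
      have "det (rho_ind (shift0, Transposition.transpose a c \<circ> p))
          = (-1) ^ K * of_int (sign p) ^ K"
        unfolding shift0_mult[OF t, symmetric]
        using det_mult[OF shift0_carrier[OF t] shift0_carrier[OF swap(4)]] tr[OF swap(1,2,3)] swap(5) by simp
      moreover have "sign (Transposition.transpose a c \<circ> p) = - sign p"
      proof -
        have "permutation p" using swap(4) by (rule permutes_permutation_atLeastAtMost)
        then show ?thesis using swap(3) by (simp add: sign_compose permutation_swap_id sign_swap_id)
      qed
      ultimately show ?case by (simp only: power_mult_distrib[symmetric] of_int_minus mult_minus1)
    qed
    with K show thesis by (rule that)
  qed
qed

text \<open>Each element factors as a translation times a permutation, and the two determinants are
  already known.\<close>

lemma det_rho:
  assumes n: "n \<ge> 1"
  obtains X K :: nat where "n * P * X = fact n * (\<Sum>k<r. k * b ! k)" "y_num lam = of_nat K"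
    "\<And>x w. (x, w) \<in> carrier (Gnr n r) \<Longrightarrow>
      det (rho \<zeta> lam (x, w)) = \<zeta> powi (int (d * X) * (\<Sum>i=1..n. x i)) * of_int (sign w) ^ K"
proof -
  obtain X where X: "n * P * X = fact n * (\<Sum>k<r. k * b ! k)"
    "\<And>x. x \<in> {1..n} \<rightarrow>\<^sub>E {0..<int r} \<Longrightarrow>
      det (rho_ind (x, id)) = \<zeta> powi (int (d * X) * (\<Sum>i=1..n. x i))"
    using det_translation[OF n] by blast
  obtain K where K: "y_num lam = of_nat K"
    "\<And>w. w permutes {1..n} \<Longrightarrow> det (rho_ind (shift0, w)) = of_int (sign w) ^ K"
    using det_permutation by blast
  show thesis
  proof (rule that[OF X(1) K(1)])
    fix x w assume xw: "(x, w) \<in> carrier (Gnr n r)"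
    then have x: "x \<in> {1..n} \<rightarrow>\<^sub>E {0..<int r}" and w: "w permutes {1..n}"
      by (auto simp: carrier_Gnr[OF r])
    have xid: "(x, id) \<in> carrier (Gnr n r)" using x by (simp add: carrier_Gnr[OF r] permutes_id)
    have "(x, id) \<otimes>\<^bsub>Gnr n r\<^esub> (shift0, w) = (x, w)"
    proof -
      have "(\<lambda>i\<in>{1..n}. (x i + shift0 (inv' id i)) mod int r) = x"
        using x by (auto simp: fun_eq_iff PiE_iff extensional_def shift0_def)
      then show ?thesis unfolding mult_Gnr by simp
    qed
    then show "det (rho \<zeta> lam (x, w)) = \<zeta> powi (int (d * X) * (\<Sum>i=1..n. x i)) * of_int (sign w) ^ K"
      unfolding rho_eq using det_mult[OF xid shift0_carrier[OF w]] X(2)[OF x] K(2)[OF w] by simp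
  qed
qed

end

section \<open>Counting the determinants\<close>

lemma finite_Pnr: "finite (Pnr n r)"
proof -
  define M where "M = {mu :: nat list. set mu \<subseteq> {..n} \<and> length mu \<le> n}"
  have "length mu \<le> sum_list mu" if "0 \<notin> set mu" for mu :: "nat list"
    using that by (induction mu) auto
  then have "mu \<in> M" if "is_partition mu" "sum_list mu \<le> n" for mu
    using that member_le_sum_list[of _ mu] unfolding M_def is_partition_def
    by (auto intro: order_trans)
  moreover have "sum_list mu \<le> n" if "lam \<in> Pnr n r" "mu \<in> set lam" for lam mu
    using that member_le_sum_list[of "sum_list mu" "map sum_list lam"] unfolding Pnr_def by auto
  ultimately have sub: "Pnr n r \<subseteq> {lam. set lam \<subseteq> M \<and> length lam = r}"
    unfolding Pnr_def by blast
  have "finite M" unfolding M_def by (rule finite_lists_length_le) simp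
  from finite_subset[OF sub finite_lists_length_eq[OF this]] show ?thesis .
qed

lemma primitive_root_power_eq_iff:
  assumes "primitive_root_unity r \<zeta>"
  shows "\<zeta> ^ i = \<zeta> ^ j \<longleftrightarrow> [i = j] (mod r)"
proof -
  have r: "r > 0" and z: "\<zeta> ^ r = 1" and prim: "\<And>k. 0 < k \<Longrightarrow> k < r \<Longrightarrow> \<zeta> ^ k \<noteq> 1"
    using assms unfolding primitive_root_unity_def by auto
  have z0: "\<zeta> \<noteq> 0" using z r by (auto simp: power_0_left)
  have red: "\<zeta> ^ i = \<zeta> ^ (i mod r)" for i
  proof -
    have "\<zeta> ^ i = \<zeta> ^ (r * (i div r) + i mod r)" by simp
    also have "\<dots> = \<zeta> ^ (i mod r)" unfolding power_add power_mult z by simp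
    finally show ?thesis .
  qed
  have inj: "i = j" if "i < r" "j < r" "\<zeta> ^ i = \<zeta> ^ j" "i \<le> j" for i j
  proof -
    have "\<zeta> ^ i * \<zeta> ^ (j - i) = \<zeta> ^ i" using that(3,4) power_add[of \<zeta> i "j - i"] by simp
    then have "\<zeta> ^ (j - i) = 1" using z0 by simp
    moreover have "j - i < r" using that(2) by simp
    ultimately have "\<not> 0 < j - i" using prim by blast
    then show ?thesis using that(4) by simp
  qed
  have "\<zeta> ^ i = \<zeta> ^ j \<longleftrightarrow> i mod r = j mod r"
    using red[of i] red[of j] inj[of "i mod r" "j mod r"] inj[of "j mod r" "i mod r"] r
    by (metis linorder_le_cases mod_less_divisor)
  then show ?thesis unfolding cong_def .
qed

lemma is_even_of_nat: "is_even (of_nat K) \<longleftrightarrow> even K"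
proof -
  have "(of_nat K :: complex) = of_int k \<longleftrightarrow> k = int K" for k
    by (metis of_int_eq_iff of_int_of_nat_eq)
  then show ?thesis unfolding is_even_def by auto
qed

lemma is_odd_of_nat: "is_odd (of_nat K) \<longleftrightarrow> odd K"
proof -
  have "(of_nat K :: complex) = of_int k \<longleftrightarrow> k = int K" for k
    by (metis of_int_eq_iff of_int_of_nat_eq)
  then show ?thesis unfolding is_odd_def by auto
qed

text \<open>The equation for the exponent with denominators cleared, so that it lives in the
  naturals. Apart from \<open>E\<close>, only the weighted sum depends on the order of the
  components.\<close>

definition det_exponent_eq :: "nat \<Rightarrow> nat list list \<Rightarrow> nat \<Rightarrow> bool" where
  "det_exponent_eq n lam E \<longleftrightarrow> n * prod_list (map fact (sizes lam)) * E
     = prod_list (map specht_dim lam) * fact n * (\<Sum>k<length lam. k * sizes lam ! k)"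

text \<open>Two test elements decide which character the determinant is: a unit translation fixes
  the exponent modulo \<open>r\<close>, a transposition fixes the parity of
  \<open>y\<close>.\<close>

lemma det_rho_character:
  assumes prim: "primitive_root_unity r \<zeta>" and r2: "r \<ge> 2" and n: "n \<ge> 1" and lam: "lam \<in> Pnr n r"
  shows "\<exists>E. det_exponent_eq n lam E \<and>
    (\<forall>s. (\<forall>g\<in>carrier (Gnr n r). det (rho \<zeta> lam g) = zeta_char \<zeta> n g ^ s)
        \<longleftrightarrow> [E = s] (mod r) \<and> is_even (y_num lam)) \<and>
    (n \<noteq> 1 \<longrightarrow> (\<forall>s. (\<forall>g\<in>carrier (Gnr n r). det (rho \<zeta> lam g) = zeta_char \<zeta> n g ^ s * sgn_char g)
        \<longleftrightarrow> [E = s] (mod r) \<and> is_odd (y_num lam)))"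
proof -
  have r: "r > 0" using r2 by simp
  interpret W: wreath_rep r \<zeta> lam
    using lam prim by unfold_locales (auto simp: Pnr_def primitive_root_unity_def)
  have Wn: "W.n = n" unfolding W.n_def W.b_def sizes_def using lam by (simp add: Pnr_def)
  obtain X K where X: "n * W.P * X = fact n * (\<Sum>k<r. k * W.b ! k)" and K: "y_num lam = of_nat K"
    and det: "\<And>x w. (x, w) \<in> carrier (Gnr n r) \<Longrightarrow>
      det (rho \<zeta> lam (x, w)) = \<zeta> powi (int (W.d * X) * (\<Sum>i=1..n. x i)) * of_int (sign w) ^ K"
    using W.det_rho unfolding Wn using n by blast
  define E where "E = W.d * X"
  have P: "W.P = prod_list (map fact (sizes lam))"
    unfolding W.P_def prod_list_nth W.b_def[symmetric] W.length_b ..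
  have d: "W.d = prod_list (map specht_dim lam)"
    unfolding W.d_eq W.f_def prod_list_nth W.len ..
  have "n * W.P * E = W.d * (n * W.P * X)" unfolding E_def by (simp only: ac_simps)
  also have "\<dots> = W.d * fact n * (\<Sum>k<r. k * sizes lam ! k)"
    unfolding X W.b_def by (simp only: mult.assoc)
  finally have eqE: "det_exponent_eq n lam E"
    unfolding det_exponent_eq_def P d W.len .
  have zc: "zeta_char \<zeta> n (x, w) ^ s = \<zeta> powi (int s * (\<Sum>i=1..n. x i))" for x w s
  proof -
    have "\<zeta> powi (int s * m) = (\<zeta> powi m) ^ s" for m
      by (simp only: power_int_mult power_int_of_nat mult.commute[of "int s"])
    then show ?thesis unfolding zeta_char_def by simp
  qed
  have cg: "\<zeta> powi (int E * m) = \<zeta> powi (int s * m)" if "[E = s] (mod r)" for s m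
    by (rule powi_cong[OF W.zeta r]) (use that in \<open>simp add: cong_int_iff cong_mult\<close>)
  \<comment> \<open>Its coordinate sum is 1, so the determinant there is \<open>\<zeta>\<close> to
    the power \<open>E\<close>, and primitivity recovers \<open>E\<close> modulo \<open>r\<close>.
    From \<open>r \<ge> 2\<close> the entry 1 is a reduced residue.\<close>
  define e1 where "e1 = (\<lambda>i\<in>{1..n}. if i = 1 then 1 else 0 :: int)"
  have e1: "(e1, id) \<in> carrier (Gnr n r)" using r2 by (auto simp: carrier_Gnr[OF r] e1_def permutes_id)
  have "(\<Sum>i=1..n. e1 i) = (\<Sum>i=1..n. if i = 1 then 1 else 0)" by (rule sum.cong) (auto simp: e1_def)
  then have se1: "(\<Sum>i=1..n. e1 i) = 1" using n by simp
  have Es: "[E = s] (mod r)" if "det (rho \<zeta> lam (e1, id)) = zeta_char \<zeta> n (e1, id) ^ s" for s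
  proof -
    have "\<zeta> powi int E = \<zeta> powi int s"
      using that unfolding det[OF e1] zc se1 E_def by simp
    then show ?thesis using primitive_root_power_eq_iff[OF prim] by (simp add: power_int_of_nat)
  qed
  have sign_id: "sgn_char (x, id) = 1" for x by (simp add: sgn_char_def)
  define z where "z = (\<lambda>i\<in>{1..n}. 0 :: int)"
  define t where "t = Transposition.transpose (1::nat) 2"
  have sz: "(\<Sum>i=1..n. z i) = 0" unfolding z_def by (rule sum.neutral) auto
  have st: "sign t = -1" unfolding t_def by (simp add: sign_swap_id)
  have zt: "(z, t) \<in> carrier (Gnr n r)" if "n \<noteq> 1"
  proof -
    have "t permutes {1..n}" unfolding t_def by (rule permutes_swap_id) (use that n in auto)
    then show ?thesis using r by (simp add: carrier_Gnr[OF r] z_def)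
  qed
  have dt: "det (rho \<zeta> lam (z, t)) = (-1) ^ K" "zeta_char \<zeta> n (z, t) ^ s = 1" if "n \<noteq> 1" for s
    using det[OF zt[OF that]] unfolding zc sz st by simp_all
  \<comment> \<open>With a single point there is no transposition to test; evenness then comes from
    the convention \<open>y = 0\<close>.\<close>
  have K0: "K = 0" if "n = 1"
  proof -
    have "y_num lam = 0" using that Wn unfolding y_num_def Let_def W.b_def[symmetric] W.n_def[symmetric] by simp
    then show ?thesis using K by simp
  qed
  have plus: "(\<forall>g\<in>carrier (Gnr n r). det (rho \<zeta> lam g) = zeta_char \<zeta> n g ^ s)
        \<longleftrightarrow> [E = s] (mod r) \<and> is_even (y_num lam)" for s
  proof
    assume *: "\<forall>g\<in>carrier (Gnr n r). det (rho \<zeta> lam g) = zeta_char \<zeta> n g ^ s"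
    have "even K"
    proof (cases "n = 1")
      case False
      then have "(-1 :: complex) ^ K = 1" using bspec[OF * zt[OF False]] dt[OF False] by simp
      then show ?thesis by (metis minus_one_power_iff one_neq_neg_one)
    qed (simp add: K0)
    then show "[E = s] (mod r) \<and> is_even (y_num lam)" using Es bspec[OF * e1] unfolding K is_even_of_nat by blast
  next
    assume *: "[E = s] (mod r) \<and> is_even (y_num lam)"
    then have "even K" unfolding K is_even_of_nat by blast
    then have "(of_int (sign w) :: complex) ^ K = 1" for w :: "nat \<Rightarrow> nat"
      by (cases w rule: sign_cases) simp_all
    then show "\<forall>g\<in>carrier (Gnr n r). det (rho \<zeta> lam g) = zeta_char \<zeta> n g ^ s"
      using det cg[of s] * unfolding zc[symmetric] by (auto simp: zc E_def[symmetric])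
  qed
  have minus: "(\<forall>g\<in>carrier (Gnr n r). det (rho \<zeta> lam g) = zeta_char \<zeta> n g ^ s * sgn_char g)
        \<longleftrightarrow> [E = s] (mod r) \<and> is_odd (y_num lam)" if n1: "n \<noteq> 1" for s
  proof
    assume *: "\<forall>g\<in>carrier (Gnr n r). det (rho \<zeta> lam g) = zeta_char \<zeta> n g ^ s * sgn_char g"
    have "sgn_char (z, t) = -1" unfolding sgn_char_def by (simp add: st)
    then have "(-1 :: complex) ^ K = -1" using bspec[OF * zt[OF n1]] dt[OF n1] by simp
    then have "odd K" by (metis minus_one_power_iff one_neq_neg_one)
    moreover have "[E = s] (mod r)" using Es[of s] bspec[OF * e1] unfolding sign_id by simp
    ultimately show "[E = s] (mod r) \<and> is_odd (y_num lam)" unfolding K is_odd_of_nat by blast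
  next
    assume *: "[E = s] (mod r) \<and> is_odd (y_num lam)"
    then have "odd K" unfolding K is_odd_of_nat by blast
    then have "(of_int (sign w) :: complex) ^ K = of_int (sign w)" for w :: "nat \<Rightarrow> nat"
      by (cases w rule: sign_cases) simp_all
    then show "\<forall>g\<in>carrier (Gnr n r). det (rho \<zeta> lam g) = zeta_char \<zeta> n g ^ s * sgn_char g"
      using det cg[of s] * by (auto simp: zc E_def[symmetric] sgn_char_def)
  qed
  show ?thesis using eqE plus minus by blast
qed

lemma prod_list_mset_cong:
  fixes g :: "'a \<Rightarrow> 'b::comm_monoid_mult"
  assumes "mset xs = mset ys" shows "prod_list (map g xs) = prod_list (map g ys)"
  using assms by (metis mset_map prod_mset_prod_list)

lemma sum_list_mset_cong:
  fixes g :: "'a \<Rightarrow> 'b::comm_monoid_add"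
  assumes "mset xs = mset ys" shows "sum_list (map g xs) = sum_list (map g ys)"
  using assms by (metis mset_map sum_mset_sum_list)

lemma specht_dim_pos: "is_partition mu \<Longrightarrow> specht_dim mu > 0"
  using specht_dim_dvd_fact[of mu] by (metis dvd_0_left fact_nonzero gr0I)

lemma sum_list_nth: "sum_list (map g xs) = (\<Sum>k<length xs. g (xs ! k))"
  by (simp add: sum_list_sum_nth atLeast0LessThan)

text \<open>A formula for \<open>y\<close> in which the components of \<open>lam\<close> enter symmetrically.\<close>

lemma y_num_symmetric:
  assumes part: "\<And>mu. mu \<in> set lam \<Longrightarrow> is_partition mu"
  defines "n \<equiv> sum_list (map sum_list lam)"
    and "D \<equiv> (prod_list (map (\<lambda>mu. of_nat (specht_dim mu)) lam) :: complex)"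
    and "P \<equiv> (prod_list (map (\<lambda>mu. fact (sum_list mu)) lam) :: complex)"
  shows "y_num lam = (if n \<ge> 2 then
      D * (fact (n - 2) / P) * ((of_nat n * of_nat n - sum_list (map (\<lambda>mu. of_nat (sum_list mu) * of_nat (sum_list mu)) lam)) / 2)
      + sum_list (map (\<lambda>mu. g_num mu * (D / of_nat (specht_dim mu)) *
          (of_nat (if 2 \<le> sum_list mu then fact (n - 2) * (fact (sum_list mu) div fact (sum_list mu - 2)) else 0) / P)) lam)
    else 0)"
proof (cases "n \<ge> 2")
  case True
  let ?b = "sizes lam" and ?r = "length lam"
  have b: "?b ! k = sum_list (lam ! k)" if "k < ?r" for k using that by (simp add: sizes_def)
  have lb: "length ?b = ?r" by (simp add: sizes_def)
  have n: "n = sum_list ?b" unfolding n_def sizes_def ..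
  have P: "P = of_nat (\<Prod>k<?r. fact (?b ! k))" "P = (\<Prod>k<?r. fact (?b ! k))"
    unfolding P_def prod_list_nth by (simp_all add: b)
  have P0: "P \<noteq> 0" unfolding P(2) by simp
  have D: "D = (\<Prod>k<?r. of_nat (specht_dim (lam ! k)))" unfolding D_def prod_list_nth ..
  have S: "(\<Sum>j<?r. \<Sum>i<j. of_nat (?b ! i * ?b ! j) :: complex)
      = (of_nat n * of_nat n - sum_list (map (\<lambda>mu. of_nat (sum_list mu) * of_nat (sum_list mu)) lam)) / 2"
  proof -
    have "(\<Sum>k<?r. of_nat (?b ! k) :: complex) = of_nat n"
      unfolding n sum_list_sum_nth lb by (simp add: atLeast0LessThan)
    moreover have "(\<Sum>k<?r. of_nat (?b ! k) * of_nat (?b ! k) :: complex)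
        = sum_list (map (\<lambda>mu. of_nat (sum_list mu) * of_nat (sum_list mu)) lam)"
      unfolding sum_list_nth by (simp add: b)
    ultimately show ?thesis
      using two_sum_pairs[of "\<lambda>k. of_nat (?b ! k) :: complex" ?r] by (simp add: field_simps)
  qed
  have "(\<Sum>k<?r. g_num (lam ! k) * (\<Prod>j\<in>{..<?r} - {k}. of_nat (specht_dim (lam ! j)))
            * of_nat (multinomial (n - 2) ((map int ?b)[k := int (?b ! k) - 2])))
      = sum_list (map (\<lambda>mu. g_num mu * (D / of_nat (specht_dim mu)) *
          (of_nat (if 2 \<le> sum_list mu then fact (n - 2) * (fact (sum_list mu) div fact (sum_list mu - 2)) else 0) / P)) lam)"
    unfolding sum_list_nth
  proof (rule sum.cong[OF refl])
    fix k assume "k \<in> {..<?r}"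
    then have k: "k < ?r" by simp
    have "D = of_nat (specht_dim (lam ! k)) * (\<Prod>j\<in>{..<?r} - {k}. of_nat (specht_dim (lam ! j)))"
      unfolding D using k by (intro prod.remove) auto
    \<comment> \<open>Division by a dimension is legitimate: as a divisor of a factorial it is
      nonzero.\<close>
    then have 1: "(\<Prod>j\<in>{..<?r} - {k}. of_nat (specht_dim (lam ! j))) = D / of_nat (specht_dim (lam ! k))"
      using specht_dim_pos[OF part[OF nth_mem[OF k]]] by simp
    have "multinomial (n - 2) ((map int ?b)[k := int (?b ! k) - int 2]) * (\<Prod>l<?r. fact (?b ! l))
        = (if 2 \<le> ?b ! k then fact (n - 2) * (fact (?b ! k) div fact (?b ! k - 2)) else 0)"
      using multinomial_minus[of k ?b 2] k lb True n by simp
    from arg_cong[OF this, of "of_nat :: nat \<Rightarrow> complex"]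
    have "of_nat (multinomial (n - 2) ((map int ?b)[k := int (?b ! k) - int 2])) * P
        = of_nat (if 2 \<le> ?b ! k then fact (n - 2) * (fact (?b ! k) div fact (?b ! k - 2)) else 0)"
      unfolding P(1) of_nat_mult .
    then have 2: "of_nat (multinomial (n - 2) ((map int ?b)[k := int (?b ! k) - 2]))
        = of_nat (if 2 \<le> sum_list (lam ! k) then fact (n - 2) * (fact (sum_list (lam ! k)) div fact (sum_list (lam ! k) - 2)) else 0) / P"
      unfolding b[OF k, symmetric] by (simp only: nonzero_eq_divide_eq[OF P0] of_nat_numeral)
    show "g_num (lam ! k) * (\<Prod>j\<in>{..<?r} - {k}. of_nat (specht_dim (lam ! j)))
            * of_nat (multinomial (n - 2) ((map int ?b)[k := int (?b ! k) - 2]))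
        = g_num (lam ! k) * (D / of_nat (specht_dim (lam ! k))) *
          (of_nat (if 2 \<le> sum_list (lam ! k) then fact (n - 2) * (fact (sum_list (lam ! k)) div fact (sum_list (lam ! k) - 2)) else 0) / P)"
      unfolding 1 2 ..
  qed
  then show ?thesis
    unfolding y_num_def Let_def n[symmetric] S D[symmetric] P(2)[symmetric] using True by simp
next
  case False
  then show ?thesis unfolding y_num_def Let_def n_def sizes_def by simp
qed

lemma y_num_mset_cong:
  assumes "mset lam = mset lam'" "\<And>mu. mu \<in> set lam \<Longrightarrow> is_partition mu"
  shows "y_num lam = y_num lam'"
proof -
  have "set lam' = set lam" using assms(1) by (metis mset_eq_setD)
  then have part': "is_partition mu" if "mu \<in> set lam'" for mu using that assms(2) by simp
  show ?thesis
    by (simp only: y_num_symmetric[OF assms(2)] y_num_symmetric[OF part']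
      sum_list_mset_cong[OF assms(1)] prod_list_mset_cong[OF assms(1)])
qed

section \<open>Cyclic rotations and residues of the weighted sum\<close>

lemma mset_rotate1: "mset (rotate1 xs) = mset xs"
  by (cases xs) auto

lemma mset_rotate: "mset (rotate j xs) = mset xs"
  by (induction j) (simp_all add: mset_rotate1)

text \<open>Every entry but the first moves one place down, and the first jumps from place 0 to the
  last; the net change is minus the total plus the length times the first entry. Writing
  \<open>hd (b @ [0])\<close> covers the empty list.\<close>

lemma weighted_sum_rotate1:
  fixes b :: "nat list"
  shows "(\<Sum>k<length b. k * rotate1 b ! k) + sum_list b = (\<Sum>k<length b. k * b ! k) + length b * hd (b @ [0])"
proof (cases b)
  case (Cons c cs)
  let ?m = "length cs"
  have "(\<Sum>k<length b. k * rotate1 b ! k) = (\<Sum>k<?m. k * cs ! k) + ?m * c"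
    unfolding Cons by (simp add: nth_append)
  moreover have "(\<Sum>k<length b. k * b ! k) = (\<Sum>k<?m. k * cs ! k) + (\<Sum>k<?m. cs ! k)"
    unfolding Cons by (simp add: sum.lessThan_Suc_shift sum.distrib del: sum.lessThan_Suc)
  moreover have "sum_list b = c + (\<Sum>k<?m. cs ! k)"
    unfolding Cons by (simp add: sum_list_sum_nth[of cs] atLeast0LessThan)
  ultimately show ?thesis unfolding Cons by simp
qed simp

text \<open>Each rotation lowers the weighted sum by the total; the term stands on the left to avoid
  subtraction of naturals.\<close>

lemma weighted_sum_rotate:
  fixes b :: "nat list"
  shows "[(\<Sum>k<length b. k * rotate j b ! k) + j * sum_list b = (\<Sum>k<length b. k * b ! k)] (mod length b)"
proof (induction j)
  case (Suc j)
  let ?W = "\<lambda>b. \<Sum>k<length b. k * b ! k"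
  have "sum_list (rotate j b) = sum_list b"
    by (metis mset_rotate sum_mset_sum_list)
  then have "?W (rotate (Suc j) b) + Suc j * sum_list b = ?W (rotate j b) + j * sum_list b + length b * hd (rotate j b @ [0])"
    using weighted_sum_rotate1[of "rotate j b"] by simp
  also have "[\<dots> = ?W (rotate j b) + j * sum_list b] (mod length b)"
    by (simp add: cong_def)
  also have "[?W (rotate j b) + j * sum_list b = ?W b] (mod length b)" using Suc by simp
  finally show ?case by simp
qed simp

lemma prime_not_dvd_prod_list:
  assumes "prime (p::nat)" "\<And>x. x \<in> set xs \<Longrightarrow> \<not> p dvd x"
  shows "\<not> p dvd prod_list xs"
  using assms(2) by (induction xs) (use assms(1) in \<open>auto simp: prime_dvd_mult_iff\<close>)

text \<open>If \<open>n > r\<close>, all the multinomial coefficients are divisible by \<open>r\<close>.\<close>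

lemma multinomials_incongruent_imp_less:
  assumes r: "prime r" and n: "sum_list a = n" and ndvd: "\<not> r dvd n" and len: "length a = r"
    and small: "\<forall>k<r. a ! k < r"
    and incong: "\<not> (\<forall>k<r. \<forall>l<r.
          [multinomial (n - 1) ((map int a)[k := int (a ! k) - 1])
           = multinomial (n - 1) ((map int a)[l := int (a ! l) - 1])] (mod r))"
  shows "n < r"
proof (rule ccontr)
  assume "\<not> n < r"
  moreover have "n \<noteq> r" using ndvd by auto
  ultimately have rn: "r \<le> n - 1" "n \<ge> 1" by auto
  have "r dvd multinomial (n - 1) ((map int a)[k := int (a ! k) - 1])" if k: "k < r" for k
  proof -
    \<comment> \<open>Here \<open>n > r\<close>, as \<open>n = r\<close> is excluded by
      \<open>\<not> r dvd n\<close>. The numerator is thus divisible by \<open>r\<close>, while the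
      factorials of the entries of \<open>a\<close>, all below \<open>r\<close>, are prime to it. A
      negative lower entry gives 0, again divisible.\<close>
    have "r dvd fact (n - 1)" using rn r by (simp add: prime_dvd_fact_iff)
    moreover have "multinomial (n - 1) ((map int a)[k := int (a ! k) - 1]) * (\<Prod>l<r. fact (a ! l))
        = (if 1 \<le> a ! k then fact (n - 1) * (fact (a ! k) div fact (a ! k - 1)) else 0)"
      using multinomial_minus[of k a 1] k len n rn by simp
    ultimately have "r dvd multinomial (n - 1) ((map int a)[k := int (a ! k) - 1]) * (\<Prod>l<r. fact (a ! l))"
      by simp
    moreover have "\<not> r dvd (\<Prod>l<r. fact (a ! l))"
      using small r by (auto simp: prime_dvd_prod_iff prime_dvd_fact_iff)
    ultimately show ?thesis using r by (simp add: prime_dvd_mult_iff)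
  qed
  then have "[multinomial (n - 1) ((map int a)[k := int (a ! k) - 1])
           = multinomial (n - 1) ((map int a)[l := int (a ! l) - 1])] (mod r)" if "k < r" "l < r" for k l
    using that by (simp add: cong_def)
  then show False using incong by blast
qed

lemma Pnr_mset:
  assumes "lam \<in> Pnr n r" "mset lam' = mset lam"
  shows "lam' \<in> Pnr n r"
  using assms sum_list_mset_cong[OF assms(2), of sum_list] mset_eq_setD[OF assms(2)] mset_eq_length[OF assms(2)]
  unfolding Pnr_def by simp

lemma y_num_Pnr_mset: "lam \<in> Pnr n r \<Longrightarrow> mset lam' = mset lam \<Longrightarrow> y_num lam' = y_num lam"
  using y_num_mset_cong[of lam lam'] unfolding Pnr_def by simp

text \<open>Permuting the components of \<open>lam\<close> along with the sizes is injective and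
  keeps \<open>y\<close>. An inequality suffices, since the roles of \<open>a\<close> and
  \<open>a'\<close> can be exchanged.\<close>

lemma card_sizes_rearranged_le:
  assumes ab: "mset a' = mset a"
  shows "card {lam \<in> Pnr n r. sizes lam = a \<and> p (y_num lam)} \<le> card {lam \<in> Pnr n r. sizes lam = a' \<and> p (y_num lam)}"
proof -
  obtain \<pi> where \<pi>: "\<pi> permutes {..<length a}" "permute_list \<pi> a = a'"
    using mset_eq_permutation[OF ab] by blast
  have len: "length lam = length a" if "sizes lam = a" for lam using that by (auto simp: sizes_def)
  show ?thesis
  proof (rule card_inj_on_le[where f = "permute_list \<pi>"])
    show "finite {lam \<in> Pnr n r. sizes lam = a' \<and> p (y_num lam)}" using finite_Pnr by simp
    show "inj_on (permute_list \<pi>) {lam \<in> Pnr n r. sizes lam = a \<and> p (y_num lam)}"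
    proof (rule inj_onI, safe)
      fix lam lam' :: "nat list list"
      assume a: "a = sizes lam" "sizes lam' = sizes lam" and eq: "permute_list \<pi> lam = permute_list \<pi> lam'"
      have l: "length lam = length a" "length lam' = length a" using a len by auto
      have "permute_list (inv' \<pi>) (permute_list \<pi> lam) = lam" if "length lam = length a" for lam :: "nat list list"
        using permute_list_compose[of "inv' \<pi>" lam \<pi>] \<pi>(1) that permutes_inv[OF \<pi>(1)]
        by (metis permute_list_compose permute_list_id permutes_inv_o(1))
      then show "lam = lam'" using eq l by metis
    qed
    show "permute_list \<pi> ` {lam \<in> Pnr n r. sizes lam = a \<and> p (y_num lam)}
        \<subseteq> {lam \<in> Pnr n r. sizes lam = a' \<and> p (y_num lam)}"
    proof safe
      fix lam assume lam: "lam \<in> Pnr n r" "a = sizes lam" "p (y_num lam)"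
      have m: "mset (permute_list \<pi> lam) = mset lam"
        using \<pi>(1) lam(2) by (intro mset_permute_list) (simp add: sizes_def)
      show "permute_list \<pi> lam \<in> Pnr n r" by (rule Pnr_mset[OF lam(1) m])
      show "p (y_num (permute_list \<pi> lam))" using y_num_Pnr_mset[OF lam(1) m] lam(3) by simp
      have "map sum_list (permute_list \<pi> lam) = permute_list \<pi> (map sum_list lam)"
        using \<pi>(1) lam(2) by (intro permute_list_map[symmetric]) (simp add: sizes_def)
      then show "sizes (permute_list \<pi> lam) = a'" using \<pi>(2) lam(2) by (simp add: sizes_def)
    qed
  qed
qed

lemma card_all_rearrangements:
  "card {lam \<in> Pnr n r. mset (sizes lam) = mset a \<and> p (y_num lam)}
    = card (permutations_of_multiset (mset a)) * card {lam \<in> Pnr n r. sizes lam = a \<and> p (y_num lam)}"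
proof -
  let ?X = "\<lambda>a. {lam \<in> Pnr n r. sizes lam = a \<and> p (y_num lam)}"
  have "{lam \<in> Pnr n r. mset (sizes lam) = mset a \<and> p (y_num lam)} = (\<Union>c\<in>permutations_of_multiset (mset a). ?X c)"
    by (auto simp: permutations_of_multiset_def)
  also have "card \<dots> = (\<Sum>c\<in>permutations_of_multiset (mset a). card (?X c))"
    by (rule card_UN_disjoint) (auto simp: finite_Pnr)
  also have "\<dots> = (\<Sum>c\<in>permutations_of_multiset (mset a). card (?X a))"
  proof (rule sum.cong[OF refl])
    fix c assume "c \<in> permutations_of_multiset (mset a)"
    then have "mset c = mset a" by (simp add: permutations_of_multiset_def)
    from card_sizes_rearranged_le[OF this, of n r p] card_sizes_rearranged_le[OF this[symmetric], of n r p]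
    show "card (?X c) = card (?X a)" by simp
  qed
  finally show ?thesis by simp
qed

text \<open>Rotating by \<open>j\<close> shifts \<open>n P E\<close> by \<open>-j v\<close> modulo
  \<open>r\<close>, where \<open>v\<close> is prime to \<open>r\<close>. So the exponents of the
  \<open>r\<close> rotations are pairwise incongruent and meet each residue class once.\<close>

lemma rotation_residues:
  assumes r: "prime r" and n: "1 \<le> n" "n < r" and lam: "lam \<in> Pnr n r"
    and E: "\<And>j. det_exponent_eq n (rotate j lam) (E j)"
  shows "card {j \<in> {..<r}. [E j = s] (mod r)} = 1"
proof -
  have r0: "r > 0" using r by (simp add: prime_gt_0_nat)
  have len: "length lam = r" and sum: "sum_list (sizes lam) = n" and part: "\<And>mu. mu \<in> set lam \<Longrightarrow> is_partition mu"
    using lam unfolding Pnr_def sizes_def by auto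
  define P where "P = (prod_list (map fact (sizes lam)) :: nat)"
  define d where "d = prod_list (map specht_dim lam)"
  have small: "sum_list mu < r" if "mu \<in> set lam" for mu
  proof -
    have "sum_list mu \<le> sum_list (sizes lam)" unfolding sizes_def using that by (intro member_le_sum_list) auto
    then show ?thesis using sum n by simp
  qed
  have fact_small: "\<not> r dvd fact m" if "m < r" for m using that r by (simp add: prime_dvd_fact_iff)
  have P: "\<not> r dvd P" unfolding P_def
    by (rule prime_not_dvd_prod_list[OF r]) (use small fact_small in \<open>auto simp: sizes_def\<close>)
  have d: "\<not> r dvd d" unfolding d_def
  proof (rule prime_not_dvd_prod_list[OF r])
    fix x assume "x \<in> set (map specht_dim lam)"
    then obtain mu where mu: "mu \<in> set lam" "x = specht_dim mu" by auto
    have "x dvd fact (sum_list mu)" unfolding mu(2) by (rule specht_dim_dvd_fact[OF part[OF mu(1)]])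
    then show "\<not> r dvd x" using fact_small[OF small[OF mu(1)]] dvd_trans by blast
  qed
  have rn: "\<not> r dvd n" using n by (auto dest: dvd_imp_le)
  \<comment> \<open>Modulo \<open>r\<close>, one rotation lowers \<open>d * fact n * W j\<close> by
    this amount, because the weighted sum drops by \<open>n\<close>.\<close>
  define v where "v = d * fact n * n"
  have v: "coprime v r"
    using d rn fact_small[OF n(2)] r unfolding v_def
    by (metis coprime_commute prime_dvd_mult_iff prime_imp_coprime)
  define W where "W j = (\<Sum>k<r. k * rotate j (sizes lam) ! k)" for j
  have Ej: "n * P * E j = d * fact n * W j" for j
  proof -
    have "mset (rotate j lam) = mset lam" by (rule mset_rotate)
    note pc = prod_list_mset_cong[OF this]
    have "prod_list (map fact (sizes (rotate j lam))) = P"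
      unfolding P_def sizes_def map_map by (rule pc)
    moreover have "prod_list (map specht_dim (rotate j lam)) = d" unfolding d_def by (rule pc)
    moreover have "sizes (rotate j lam) = rotate j (sizes lam)" by (simp add: sizes_def rotate_map)
    ultimately show ?thesis using E[of j] unfolding det_exponent_eq_def W_def by (simp only: length_rotate len)
  qed
  have step: "[n * P * E j + j * v = d * fact n * W 0] (mod r)" for j
  proof -
    have "length (sizes lam) = r" by (simp add: sizes_def len)
    then have "[W j + j * n = W 0] (mod r)"
      using weighted_sum_rotate[of j "sizes lam"] sum unfolding W_def by simp
    from cong_scalar_left[OF this, of "d * fact n"] show ?thesis
      unfolding Ej v_def by (simp add: algebra_simps)
  qed
  \<comment> \<open>Equal residues of \<open>E i\<close> and \<open>E j\<close>, inserted into
    \<open>step\<close>, give \<open>j * v = i * v\<close> modulo \<open>r\<close>, and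
    \<open>v\<close> cancels. Being injective on \<open>r\<close> residues, the map is also
    onto.\<close>
  have inj: "inj_on (\<lambda>j. E j mod r) {..<r}"
  proof (rule inj_onI)
    fix i j assume ij: "i \<in> {..<r}" "j \<in> {..<r}" "E i mod r = E j mod r"
    then have "[n * P * E i = n * P * E j] (mod r)" by (intro cong_scalar_left) (simp add: cong_def)
    then have "[n * P * E i + j * v = n * P * E j + j * v] (mod r)" by (rule cong_add) simp
    also have "[n * P * E j + j * v = d * fact n * W 0] (mod r)" by (rule step)
    also have "[d * fact n * W 0 = n * P * E i + i * v] (mod r)" using step by (rule cong_sym)
    finally have "[j * v = i * v] (mod r)" by (simp add: cong_add_lcancel_nat)
    then have "[j = i] (mod r)" using cong_mult_rcancel_nat[OF v] by simp
    then show "i = j" using ij by (simp add: cong_def)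
  qed
  have "(\<lambda>j. E j mod r) ` {..<r} = {..<r}"
    using inj r0 by (intro endo_inj_surj) auto
  then have "s mod r \<in> (\<lambda>j. E j mod r) ` {..<r}" using r0 by simp
  then obtain j where j: "j < r" "E j mod r = s mod r" by auto
  have "{j \<in> {..<r}. [E j = s] (mod r)} = {j}"
  proof (intro equalityI subsetI)
    fix i assume "i \<in> {j \<in> {..<r}. [E j = s] (mod r)}"
    then have "i \<in> {..<r}" "E i mod r = E j mod r" using j(2) by (simp_all add: cong_def)
    then show "i \<in> {j}" using inj_onD[OF inj, of i j] j(1) by simp
  qed (use j in \<open>simp add: cong_def\<close>)
  then show ?thesis by simp
qed

text \<open>Double counting of pairs of a rotation \<open>j < r\<close> and an element of
  \<open>T\<close>. Rotations permute \<open>T\<close>, so every \<open>j\<close> contributes the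
  same count; for a fixed \<open>lam\<close>, exactly one \<open>j\<close> yields the residue
  \<open>s\<close>.\<close>

lemma equidistribution:
  assumes r: "prime r" and n: "1 \<le> n" "n < r"
    and E: "\<And>lam. lam \<in> Pnr n r \<Longrightarrow> det_exponent_eq n lam (E lam)"
  shows "r * card {lam \<in> Pnr n r. mset (sizes lam) = mset a \<and> [E lam = s] (mod r) \<and> p (y_num lam)}
    = card {lam \<in> Pnr n r. mset (sizes lam) = mset a \<and> p (y_num lam)}"
proof -
  define T where "T = {lam \<in> Pnr n r. mset (sizes lam) = mset a \<and> p (y_num lam)}"
  have fin: "finite T" unfolding T_def using finite_Pnr by simp
  have rot: "rotate j lam \<in> T" if "lam \<in> T" for j lam
  proof -
    have lam: "lam \<in> Pnr n r" and m: "mset (rotate j lam) = mset lam"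
      using that mset_rotate unfolding T_def by auto
    have "mset (sizes (rotate j lam)) = mset (sizes lam)" by (simp add: sizes_def mset_rotate)
    then show ?thesis using that Pnr_mset[OF lam m] y_num_Pnr_mset[OF lam m] unfolding T_def by simp
  qed
  have inj: "inj_on (rotate j) T" for j
    unfolding rotate_def using inj_on_subset[OF inj_fn[OF inj_rotate1]] by blast
  have bij: "bij_betw (rotate j) T T" for j
  proof -
    have "rotate j ` T \<subseteq> T" using rot by blast
    then show ?thesis unfolding bij_betw_def using inj endo_inj_surj[OF fin] by blast
  qed
  have same: "card {lam \<in> T. [E (rotate j lam) = s] (mod r)} = card {lam \<in> T. [E lam = s] (mod r)}" for j
  proof -
    have "bij_betw (rotate j) {lam \<in> T. [E (rotate j lam) = s] (mod r)} {lam \<in> T. [E lam = s] (mod r)}"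
    proof (rule bij_betw_subset[OF bij[of j]])
      show "rotate j ` {lam \<in> T. [E (rotate j lam) = s] (mod r)} = {lam \<in> T. [E lam = s] (mod r)}"
      proof -
        have "rotate j ` {lam \<in> T. [E (rotate j lam) = s] (mod r)} = {lam \<in> rotate j ` T. [E lam = s] (mod r)}"
          by auto
        then show ?thesis unfolding bij_betw_imp_surj_on[OF bij[of j]] .
      qed
    qed auto
    then show ?thesis by (rule bij_betw_same_card)
  qed
  have "r * card {lam \<in> T. [E lam = s] (mod r)} = (\<Sum>j<r. card {lam \<in> T. [E (rotate j lam) = s] (mod r)})"
    by (simp add: same)
  also have "\<dots> = (\<Sum>j<r. \<Sum>lam\<in>T. if [E (rotate j lam) = s] (mod r) then 1 else 0)"
    using fin by (simp add: sum.If_cases Int_def)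
  also have "\<dots> = (\<Sum>lam\<in>T. \<Sum>j<r. if [E (rotate j lam) = s] (mod r) then 1 else 0)"
    by (rule sum.swap)
  also have "\<dots> = (\<Sum>lam\<in>T. card {j \<in> {..<r}. [E (rotate j lam) = s] (mod r)})"
    by (simp add: sum.If_cases Int_def)
  also have "\<dots> = (\<Sum>lam\<in>T. 1)"
  proof (rule sum.cong[OF refl])
    fix lam assume lam: "lam \<in> T"
    show "card {j \<in> {..<r}. [E (rotate j lam) = s] (mod r)} = 1"
    proof (rule rotation_residues[OF r n])
      show "lam \<in> Pnr n r" using lam unfolding T_def by blast
      show "det_exponent_eq n (rotate j lam) (E (rotate j lam))" for j
        using E rot[OF lam] unfolding T_def by blast
    qed
  qed
  also have "\<dots> = card T" by simp
  finally show ?thesis unfolding T_def by (simp add: conj_commute conj_left_commute)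
qed

text \<open>No entry of \<open>a\<close> exceeds \<open>n\<close>, and absent values have factor
  \<open>0! = 1\<close>. The product thus agrees with the one in the formula for the number of
  arrangements of a multiset.\<close>

lemma prod_fact_count:
  fixes a :: "nat list"
  assumes len: "length a = r" and n: "sum_list a = n"
  shows "(\<Prod>v\<le>n. fact (card {k. k < r \<and> a ! k = v})) = (\<Prod>v\<in>set_mset (mset a). fact (count (mset a) v) :: nat)"
proof -
  have c: "card {k. k < r \<and> a ! k = v} = count (mset a) v" for v
    unfolding count_mset using len by (simp add: count_list_eq_length_filter length_filter_conv_card eq_commute)
  have "(\<Prod>v\<in>set a. fact (count (mset a) v) :: nat) = (\<Prod>v\<le>n. fact (count (mset a) v))"
  proof (rule prod.mono_neutral_left)
    show "\<forall>v\<in>{..n} - set a. fact (count (mset a) v) = (1::nat)"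
      by (metis DiffE count_mset_0_iff fact_0)
  qed (use member_le_sum_list[of _ a] n in auto)
  then show ?thesis unfolding c by simp
qed

theorem proposition10:
  fixes r n s :: nat and a :: "nat list" and \<zeta> :: complex
  assumes "prime r" and "odd r"
    and "n \<ge> 1" and "\<not> r dvd n"
    and "primitive_root_unity r \<zeta>"
    and "length a = r" and "sorted_wrt (\<ge>) a" and "sum_list a = n"
    and "\<forall>k<r. a ! k < r"
    and "\<not> (\<forall>k<r. \<forall>l<r.
          [multinomial (n - 1) ((map int a)[k := int (a ! k) - 1])
           = multinomial (n - 1) ((map int a)[l := int (a ! l) - 1])] (mod r))"
    and "1 \<le> s" and "s \<le> r"
  shows "(of_nat (N_plus n r \<zeta> s a) :: rat)
           = fact (r - 1) / (\<Prod>v\<le>n. fact (card {k. k < r \<and> a ! k = v})) * of_nat (A0 n r a)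
       \<and> (of_nat (N_minus n r \<zeta> s a) :: rat)
           = fact (r - 1) / (\<Prod>v\<le>n. fact (card {k. k < r \<and> a ! k = v})) * of_nat (A1 n r a)"
proof -
  have nr: "n < r" using multinomials_incongruent_imp_less assms by blast
  have r2: "r \<ge> 2" using \<open>prime r\<close> by (rule prime_ge_2_nat)
  let ?M = "(\<Prod>v\<le>n. fact (card {k. k < r \<and> a ! k = v})) :: nat"
  have "\<forall>lam\<in>Pnr n r. \<exists>E. det_exponent_eq n lam E \<and>
    (\<forall>s. (\<forall>g\<in>carrier (Gnr n r). det (rho \<zeta> lam g) = zeta_char \<zeta> n g ^ s)
        \<longleftrightarrow> [E = s] (mod r) \<and> is_even (y_num lam)) \<and>
    (n \<noteq> 1 \<longrightarrow> (\<forall>s. (\<forall>g\<in>carrier (Gnr n r). det (rho \<zeta> lam g) = zeta_char \<zeta> n g ^ s * sgn_char g)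
        \<longleftrightarrow> [E = s] (mod r) \<and> is_odd (y_num lam)))"
    using det_rho_character[OF assms(5) r2 assms(3)] by blast
  \<comment> \<open>One exponent function on all of \<open>Pnr n r\<close> is fixed, since the
    double counting compares exponents of different rotations.\<close>
  from bchoice[OF this] obtain E where
    E: "\<And>lam. lam \<in> Pnr n r \<Longrightarrow> det_exponent_eq n lam (E lam)"
    and plus: "\<And>lam s. lam \<in> Pnr n r \<Longrightarrow> (\<forall>g\<in>carrier (Gnr n r). det (rho \<zeta> lam g) = zeta_char \<zeta> n g ^ s)
        \<longleftrightarrow> [E lam = s] (mod r) \<and> is_even (y_num lam)"
    and minus: "\<And>lam s. lam \<in> Pnr n r \<Longrightarrow> n \<noteq> 1 \<Longrightarrow>
        (\<forall>g\<in>carrier (Gnr n r). det (rho \<zeta> lam g) = zeta_char \<zeta> n g ^ s * sgn_char g)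
        \<longleftrightarrow> [E lam = s] (mod r) \<and> is_odd (y_num lam)"
    by blast
  have perms: "card (permutations_of_multiset (mset a)) * ?M = fact r"
    unfolding prod_fact_count[OF assms(6,8)] card_permutations_of_multiset_aux by (simp add: assms(6))
  have fact_r: "fact r = r * (fact (r - 1) :: nat)" using r2 by (simp add: fact_reduce)
  have M0: "?M \<noteq> 0" by simp
  have count: "(of_nat (card {lam \<in> Pnr n r. mset (sizes lam) = mset a \<and> [E lam = s] (mod r) \<and> p (y_num lam)}) :: rat)
      = fact (r - 1) / (\<Prod>v\<le>n. fact (card {k. k < r \<and> a ! k = v}))
        * of_nat (card {lam \<in> Pnr n r. sizes lam = a \<and> p (y_num lam)})" for p
  proof -
    let ?N = "card {lam \<in> Pnr n r. mset (sizes lam) = mset a \<and> [E lam = s] (mod r) \<and> p (y_num lam)}"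
    let ?A = "card {lam \<in> Pnr n r. sizes lam = a \<and> p (y_num lam)}"
    \<comment> \<open>Here \<open>r N\<close> is the number of arrangements of \<open>a\<close>
      times \<open>A\<close>, and arrangements times \<open>M\<close> make
      \<open>r! = r (r-1)!\<close>; cancelling \<open>r\<close> avoids division until the last
      step.\<close>
    have "r * (?N * ?M) = r * ?N * ?M" by (simp only: mult.assoc)
    also have "r * ?N = card (permutations_of_multiset (mset a)) * ?A"
      using equidistribution[OF assms(1,3) nr E] unfolding card_all_rearrangements .
    also have "\<dots> * ?M = card (permutations_of_multiset (mset a)) * ?M * ?A" by (simp only: ac_simps)
    also have "\<dots> = r * (fact (r - 1) * ?A)" unfolding perms fact_r by (simp only: mult.assoc)
    finally have "?N * ?M = fact (r - 1) * ?A" using r2 by simp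
    from arg_cong[OF this, of "of_nat :: nat \<Rightarrow> rat"]
    have "of_nat ?N * of_nat ?M = fact (r - 1) * (of_nat ?A :: rat)" by (simp only: of_nat_mult of_nat_fact)
    moreover have "(of_nat ?M :: rat) = (\<Prod>v\<le>n. fact (card {k. k < r \<and> a ! k = v}))" by simp
    moreover have "(of_nat ?M :: rat) \<noteq> 0" using M0 by (simp only: of_nat_eq_0_iff not_False_eq_True)
    ultimately show ?thesis by (simp add: field_simps)
  qed
  have "N_plus n r \<zeta> s a
      = card {lam \<in> Pnr n r. mset (sizes lam) = mset a \<and> [E lam = s] (mod r) \<and> is_even (y_num lam)}"
    unfolding N_plus_def by (rule arg_cong[of _ _ card]) (use plus in blast)
  then have 1: "(of_nat (N_plus n r \<zeta> s a) :: rat)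
           = fact (r - 1) / (\<Prod>v\<le>n. fact (card {k. k < r \<and> a ! k = v})) * of_nat (A0 n r a)"
    unfolding A0_def using count[of is_even] by simp
  have 2: "(of_nat (N_minus n r \<zeta> s a) :: rat)
           = fact (r - 1) / (\<Prod>v\<le>n. fact (card {k. k < r \<and> a ! k = v})) * of_nat (A1 n r a)"
  proof (cases "n = 1")
    \<comment> \<open>For \<open>n = 1\<close> the left side is 0 by convention, and so is
      \<open>A1\<close>, because \<open>y = 0\<close> is never odd.\<close>
    case True
    have "\<not> is_odd (y_num lam)" if "lam \<in> Pnr n r" for lam
    proof -
      have "sum_list (sizes lam) = 1" using that True by (simp add: Pnr_def sizes_def)
      then have "y_num lam = of_nat 0" unfolding y_num_def Let_def by simp
      then show ?thesis by (simp only: is_odd_of_nat) simp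
    qed
    then have "{lam \<in> Pnr n r. sizes lam = a \<and> is_odd (y_num lam)} = {}" by blast
    then have "A1 n r a = 0" unfolding A1_def by (simp only: card.empty)
    moreover have "N_minus n r \<zeta> s a = 0" unfolding N_minus_def using True by simp
    ultimately show ?thesis by simp
  next
    case False
    then have "N_minus n r \<zeta> s a
        = card {lam \<in> Pnr n r. mset (sizes lam) = mset a \<and> [E lam = s] (mod r) \<and> is_odd (y_num lam)}"
      unfolding N_minus_def if_not_P[OF False] by (intro arg_cong[of _ _ card]) (use minus in blast)
    then show ?thesis unfolding A1_def using count[of is_odd] by simp
  qed
  show ?thesis using 1 2 by blast
qed

end
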